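(* Suppose that $Q_0$ and $Q_1$ are unitary operators that prepare purifications of mixed quantum states $\rho_0$ and $\rho_1$, respectively. For every fixed real constant $\alpha>1$, there is a quantum query algorithm that estimates $\mathrm{T}_\alpha(\rho_0,\rho_1)$ to within additive error $\epsilon$ by using $O\big(1/\epsilon^{\alpha+1+\frac{1}{\alpha-1}}\big)$ queries to $Q_0$ and $Q_1$.
   Context: $\mathrm{T}_\alpha(\rho_0,\rho_1)=\frac12\big(\mathrm{tr}(|\rho_0-\rho_1|^\alpha)\big)^{1/\alpha}$, with $|A|=(A^\dagger A)^{1/2}$. A unitary $Q$ on $n+a$ qubits prepares a purification of an $n$-qubit state $\rho$ if tracing out the $a$ ancilla qubits of $Q|0\rangle^{\otimes(n+a)}$ yields $\rho$. "Queries to $Q_b$" include queries to $Q_b$, $Q_b^\dagger$ and their controlled versions. The algorithm outputs an estimate that is within the stated error with probability at least $2/3$, for $\epsilon\in(0,1)$. The constant in $O(\cdot)$ depends only on $\alpha$ (in particular not on the dimension or rank). *)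

theory Defs
  imports Complex_Main "Jordan_Normal_Form.Schur_Decomposition"
begin

section \<open>Matrices\<close>

definition trace_mat :: "complex mat \<Rightarrow> complex" where
  "trace_mat A = (\<Sum>i<dim_row A. A $$ (i, i))"

definition unitary_mat :: "nat \<Rightarrow> complex mat \<Rightarrow> bool" where
  "unitary_mat d U \<longleftrightarrow> U \<in> carrier_mat d d \<and>
     mat_adjoint U * U = 1\<^sub>m d \<and> U * mat_adjoint U = 1\<^sub>m d"

definition tensor_mat :: "complex mat \<Rightarrow> complex mat \<Rightarrow> complex mat" where
  "tensor_mat A B = mat (dim_row A * dim_row B) (dim_col A * dim_col B)
     (\<lambda>(i, j). A $$ (i div dim_row B, j div dim_col B) * B $$ (i mod dim_row B, j mod dim_col B))"

text \<open>
  Real powers of a positive semidefinite matrix by functional calculus. A spectral decomposition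
  of such a matrix always exists, and the matrix selected below does not depend on which one is
  used, so the choice operator is harmless. Only exponents s > 0 are of interest; then
  0 powr s = 0 is the right value on the kernel.
\<close>
definition mat_powr :: "complex mat \<Rightarrow> real \<Rightarrow> complex mat" where
  "mat_powr A s = (SOME B. \<exists>U d. unitary_mat (dim_row A) U \<and> (\<forall>i<dim_row A. (0::real) \<le> d i) \<and>
     A = U * mat_diag (dim_row A) (\<lambda>i. complex_of_real (d i)) * mat_adjoint U \<and>
     B = U * mat_diag (dim_row A) (\<lambda>i. complex_of_real (d i powr s)) * mat_adjoint U)"

definition mat_abs :: "complex mat \<Rightarrow> complex mat" where
  "mat_abs A = mat_powr (mat_adjoint A * A) (1/2)"

text \<open>
  The trace of a positive semidefinite matrix is a nonnegative real number, so taking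
  the real part is only a type conversion.
\<close>
definition T_dist :: "real \<Rightarrow> complex mat \<Rightarrow> complex mat \<Rightarrow> real" where
  "T_dist \<alpha> \<rho>0 \<rho>1 = 1/2 * Re (trace_mat (mat_powr (mat_abs (\<rho>0 - \<rho>1)) \<alpha>)) powr (1/\<alpha>)"

section \<open>Purifications\<close>

text \<open>
  Qubit registers are ordered with the most significant bit first: in a register of n + a qubits,
  the basis state with index i * 2^a + k has the first n qubits in state i and the last a qubits,
  the ancillas, in state k.
\<close>
definition partial_trace :: "nat \<Rightarrow> nat \<Rightarrow> complex mat \<Rightarrow> complex mat" where
  "partial_trace n a A = mat (2^n) (2^n) (\<lambda>(i, j). \<Sum>k<2^a. A $$ (i * 2^a + k, j * 2^a + k))"

definition ket_bra :: "complex vec \<Rightarrow> complex mat" where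
  "ket_bra v = mat (dim_vec v) (dim_vec v) (\<lambda>(i, j). v $ i * cnj (v $ j))"

definition zero_state :: "nat \<Rightarrow> complex vec" where
  "zero_state m = unit_vec (2^m) 0"

definition prepares_purification :: "nat \<Rightarrow> nat \<Rightarrow> complex mat \<Rightarrow> complex mat \<Rightarrow> bool" where
  "prepares_purification n a Q \<rho> \<longleftrightarrow> unitary_mat (2^(n + a)) Q \<and>
     \<rho> = partial_trace n a (ket_bra (Q *\<^sub>v zero_state (n + a)))"

section \<open>Quantum query algorithms\<close>

datatype black_box = Box0 | Box1

text \<open>
  A step is either a fixed unitary on the whole workspace, not depending on the queried unitaries,
  or a query to a black-box unitary; the two flags of a query say whether the
  adjoint and whether the controlled version is applied.
\<close>
datatype step = Fixed "complex mat" | Query black_box (is_adjoint: bool) (is_controlled: bool)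

text \<open>
  A circuit on a workspace of a given number of qubits, followed by a measurement of all of them
  in the computational basis and classical post-processing of the outcome into a real number.
\<close>
datatype query_alg = Query_Alg (num_qubits: nat) (steps: "step list") (result: "nat \<Rightarrow> real")

definition controlled_mat :: "complex mat \<Rightarrow> complex mat" where
  "controlled_mat U =
     four_block_mat (1\<^sub>m (dim_row U)) (0\<^sub>m (dim_row U) (dim_col U)) (0\<^sub>m (dim_row U) (dim_col U)) U"

text \<open>
  The argument q gives the number of qubits on which each black box acts.
  Black boxes are applied to the last qubits of the workspace, the control being the qubit just before
  them. Other placements are obtained by permuting qubits with fixed unitaries.
\<close>
fun query_qubits :: "(black_box \<Rightarrow> nat) \<Rightarrow> black_box \<Rightarrow> bool \<Rightarrow> nat" where
  "query_qubits q b ctrl = q b + (if ctrl then 1 else 0)"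

fun valid_step :: "nat \<Rightarrow> (black_box \<Rightarrow> nat) \<Rightarrow> step \<Rightarrow> bool" where
  "valid_step m q (Fixed U) \<longleftrightarrow> unitary_mat (2^m) U"
| "valid_step m q (Query b adj ctrl) \<longleftrightarrow> query_qubits q b ctrl \<le> m"

fun step_mat :: "nat \<Rightarrow> (black_box \<Rightarrow> nat) \<Rightarrow> (black_box \<Rightarrow> complex mat) \<Rightarrow> step \<Rightarrow> complex mat" where
  "step_mat m q Q (Fixed U) = U"
| "step_mat m q Q (Query b adj ctrl) =
     (let V = (if adj then mat_adjoint (Q b) else Q b);
          W = (if ctrl then controlled_mat V else V)
      in tensor_mat (1\<^sub>m (2^(m - query_qubits q b ctrl))) W)"

definition valid_alg :: "(black_box \<Rightarrow> nat) \<Rightarrow> query_alg \<Rightarrow> bool" where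
  "valid_alg q alg \<longleftrightarrow> (\<forall>s \<in> set (steps alg). valid_step (num_qubits alg) q s)"

fun is_query :: "step \<Rightarrow> bool" where
  "is_query (Fixed U) = False"
| "is_query (Query b adj ctrl) = True"

definition num_queries :: "query_alg \<Rightarrow> nat" where
  "num_queries alg = length (filter is_query (steps alg))"

definition final_state :: "(black_box \<Rightarrow> nat) \<Rightarrow> (black_box \<Rightarrow> complex mat) \<Rightarrow> query_alg \<Rightarrow> complex vec" where
  "final_state q Q alg =
     fold (\<lambda>s v. step_mat (num_qubits alg) q Q s *\<^sub>v v) (steps alg) (zero_state (num_qubits alg))"

definition prob_result ::
  "(black_box \<Rightarrow> nat) \<Rightarrow> (black_box \<Rightarrow> complex mat) \<Rightarrow> query_alg \<Rightarrow> real set \<Rightarrow> real" where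
  "prob_result q Q alg S =
     (\<Sum>x | x < 2^(num_qubits alg) \<and> result alg x \<in> S. (cmod (final_state q Q alg $ x))\<^sup>2)"

end

theory Submission
  imports Defs "Jordan_Normal_Form.Spectral_Radius"
begin

text \<open>
  Put p = \<alpha> - 1 and let \<nu> be the difference of the two states, so that the trace of
  |\<nu>|^\<alpha> is the trace of \<nu> f(\<nu>) for f(x) = sgn(x) |x|^p. The Fourier coefficients u(j) of
  f(cos t) satisfy a two-term recurrence and decay like j^(-1-p). Hence they are summable, and
  J = O(\<delta>^(-1/p)) of them give f up to \<delta> on [-1, 1].

  Exchanging the system with a fresh purification, with a sign that depends on which of the two
  states was purified, is a reflection whose block on the purification is \<nu>/2. Its product W with the
  reflection about the purification therefore has T_k(\<nu>/2) as the block of W^k. The palindromes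
  W^(2j+1) R are involutions, and selecting among them in a superposition with weights |u(j)|, with the
  sign of u(j) and the sign of the prepared state, gives an involution V. In the prepared state \<Psi>
  its expectation is, up to a known bounded factor, the trace of \<nu> f(\<nu>) to within \<delta>.

  That expectation A is read off from the walk (2 \<Psi>\<Psi>* - 1) V: a superposition over l of
  |l> W^l \<Psi> with a slowly varying window is nearly an eigenvector of the path adjacency operator on
  the clock l, with eigenvalue A. Measuring the clock in the eigenbasis of the path has second moment
  O(1/M^2) around A, so M = O(1/\<delta>) steps of O(J) queries suffice. With \<delta> = \<epsilon>^\<alpha> this is
  \<epsilon>^(-\<alpha> - \<alpha>/p) queries, and |x^(1/\<alpha>) - y^(1/\<alpha>)| is at most |x - y|^(1/\<alpha>).
\<close>

section \<open>Fourier expansion of signed powers\<close>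

text \<open>The obstacle is dimension dependence: replacing \<open>f\<close> by an approximation
  with uniform error \<delta> costs \<delta> for every eigenvalue in a bare trace. Here the outer
  factor \<nu> is not computed but supplied by the state, as the difference of the probabilities of
  its two flags; the error then carries the weights |\<mu>|/2 of the eigenvalues \<mu> of \<nu>, and
  these sum to at most 1. The halves throughout come from preparing the two purifications in equal
  superposition. For p < 1 the function \<open>f\<close> has an unbounded derivative at 0, so the
  rate of approximation is read off from the explicit coefficients and not from smoothness.
  Summability of the coefficients bounds the normalisation of the superposition over j independently
  of J: more terms cost only a longer circuit. The outer walk is analysed without its eigenvectors,
  because its powers applied to \<Psi> satisfy a three-term recurrence, by the same argument on two
  reflections that yields the Chebyshev moments of W.\<close>

text \<open>
  The recurrence of the Fourier coefficients of sgn(cos t) |cos t|^p at the odd frequencies 2 j + 1,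
  normalised to start with 1; those at even frequencies vanish.
\<close>
fun power_coeff :: "real \<Rightarrow> nat \<Rightarrow> real" where
  "power_coeff p 0 = 1"
| "power_coeff p (Suc j) = power_coeff p j * (p - 2 * real j - 1) / (p + 2 * real j + 3)"

declare power_coeff.simps(2) [simp del]

lemma power_coeff_rec:
  assumes "p > 0"
  shows "(p + 2 * real j + 3) * power_coeff p (Suc j) = (p - 2 * real j - 1) * power_coeff p j"
  using assms by (simp add: power_coeff.simps(2) field_simps)

text \<open>Once 2j+1 has reached p, consecutive coefficients have opposite signs or vanish, so
  taking absolute values turns the recurrence into an exact telescoping identity.\<close>

lemma power_coeff_abs_telescope:
  assumes "p > 0" "p \<le> 2 * real j + 1"
  shows "p * (\<bar>power_coeff p j\<bar> + \<bar>power_coeff p (Suc j)\<bar>)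
    = (2 * real j + 1) * \<bar>power_coeff p j\<bar> - (2 * real j + 3) * \<bar>power_coeff p (Suc j)\<bar>"
proof -
  have "\<bar>(p + 2 * real j + 3) * power_coeff p (Suc j)\<bar> = \<bar>(p - 2 * real j - 1) * power_coeff p j\<bar>"
    using power_coeff_rec[OF assms(1)] by metis
  then have "(p + 2 * real j + 3) * \<bar>power_coeff p (Suc j)\<bar> = (2 * real j + 1 - p) * \<bar>power_coeff p j\<bar>"
    using assms by (simp only: abs_mult) simp
  then show ?thesis by (simp add: algebra_simps)
qed

text \<open>Adding the telescoped identity, with one nonnegative summand dropped from each step. The
  bound serves twice: it gives summability, and it bounds the tail from J by
  \<open>(2 * J + 1) * \<bar>power_coeff p J\<bar> / p\<close>.\<close>

lemma power_coeff_partial_sum: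
  assumes "p > 0" "p \<le> 2 * real J + 1"
  shows "p * (\<Sum>i<n. \<bar>power_coeff p (i + J)\<bar>)
    \<le> (2 * real J + 1) * \<bar>power_coeff p J\<bar> - (2 * real (n + J) + 1) * \<bar>power_coeff p (n + J)\<bar>"
proof (induction n)
  case (Suc n)
  have pos: "0 \<le> p * \<bar>power_coeff p (Suc (n + J))\<bar>" using assms by simp
  have "p \<le> 2 * real (n + J) + 1" using assms by simp
  then have "p * \<bar>power_coeff p (n + J)\<bar> \<le> (2 * real (n + J) + 1) * \<bar>power_coeff p (n + J)\<bar>
       - (2 * real (n + J) + 3) * \<bar>power_coeff p (Suc (n + J))\<bar>"
    using power_coeff_abs_telescope[of p "n + J"] assms(1) pos unfolding distrib_left[of p] by linarith
  with Suc show ?case by (simp add: algebra_simps)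
qed simp

lemma summable_power_coeff:
  assumes "p > 0"
  shows "summable (\<lambda>j. \<bar>power_coeff p j\<bar>)"
proof -
  obtain J :: nat where J: "p \<le> 2 * real J + 1"
    by (metis add_increasing2 mult_2 of_nat_0_le_iff order_trans real_arch_simple zero_le_one)
  have "(\<Sum>i<n. \<bar>power_coeff p (i + J)\<bar>) \<le> (2 * real J + 1) * \<bar>power_coeff p J\<bar> / p" for n
    using power_coeff_partial_sum[OF assms J, of n] assms
    by (simp add: field_simps) (smt (verit) mult_nonneg_nonneg of_nat_0_le_iff abs_ge_zero)
  then have "summable (\<lambda>i. \<bar>power_coeff p (i + J)\<bar>)"
    by (intro summableI_nonneg_bounded) auto
  then show ?thesis using summable_iff_shift[of "\<lambda>j. \<bar>power_coeff p j\<bar>" J] by simp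
qed

text \<open>The function ln((1+t)/(1-t)) is convex on [0, 1) and vanishes at 0, so scaling the
  argument by b at least scales the value by b. The proof compares the derivatives 2b/(1-t^2) and
  2b/(1-(bt)^2).\<close>

lemma ln_ratio_convex:
  fixes b s :: real
  assumes "b \<ge> 1" "0 \<le> s" "b * s < 1"
  shows "b * ln ((1 + s) / (1 - s)) \<le> ln ((1 + b * s) / (1 - b * s))"
proof -
  let ?f = "\<lambda>t. (ln (1 + b * t) - ln (1 - b * t)) - b * (ln (1 + t) - ln (1 - t))"
  have "?f 0 \<le> ?f s"
  proof (rule DERIV_nonneg_imp_nondecreasing[OF assms(2)])
    fix t assume t: "0 \<le> t" "t \<le> s"
    then have bt: "b * t < 1" using assms by (smt (verit) mult_left_mono)
    have "t \<le> b * t" using assms t by (simp add: mult_le_cancel_right1)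
    then have t1: "t < 1" using bt by linarith
    have d: "(?f has_real_derivative (b / (1 + b * t) + b / (1 - b * t)) - b * (1 / (1 + t) + 1 / (1 - t))) (at t)"
      using t t1 bt assms by (auto intro!: derivative_eq_intros simp: add_pos_nonneg)
    have "b * (1 / (1 + t) + 1 / (1 - t)) = 2 * b / (1 - t\<^sup>2)"
      using t t1 by (simp add: field_simps power2_eq_square)
    moreover have "b / (1 + b * t) + b / (1 - b * t) = 2 * b / (1 - (b * t)\<^sup>2)"
    proof -
      have "1 + b * t \<noteq> 0" "1 - b * t \<noteq> 0" using t bt assms by (smt (verit) mult_nonneg_nonneg)+
      moreover have "1 - (b * t)\<^sup>2 = (1 + b * t) * (1 - b * t)" by (simp add: algebra_simps power2_eq_square)
      ultimately show ?thesis by (simp add: field_simps)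
    qed
    moreover have "2 * b / (1 - t\<^sup>2) \<le> 2 * b / (1 - (b * t)\<^sup>2)"
    proof (rule divide_left_mono)
      have "(b * t)\<^sup>2 < 1" using bt t assms by (simp add: abs_square_less_1)
      moreover have "t\<^sup>2 \<le> (b * t)\<^sup>2" using \<open>t \<le> b * t\<close> t by (simp add: power_mono)
      ultimately show "1 - (b * t)\<^sup>2 \<le> 1 - t\<^sup>2" "0 < (1 - t\<^sup>2) * (1 - (b * t)\<^sup>2)" by auto
      show "0 \<le> 2 * b" using assms by simp
    qed
    ultimately show "\<exists>y. (?f has_real_derivative y) (at t) \<and> 0 \<le> y" using d by force
  qed
  moreover have "s \<le> b * s" using assms by (simp add: mult_le_cancel_right1)
  ultimately show ?thesis using assms
    by (subst (1 2) ln_div) auto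
qed

text \<open>With x = 2j+1 the claim is (x-p)/(x+2+p) <= (x/(x+2))^(1+p). Centring at x+1, that is s
  = 1/(x+1), writes the two fractions as (1-bs)/(1+bs) with b = 1+p and b = 1, which is the form of
  \<open>ln_ratio_convex\<close>.\<close>

lemma power_coeff_ratio:
  assumes "p > 0" "p < 2 * real j + 1"
  shows "\<bar>power_coeff p (Suc j)\<bar> * (2 * real (Suc j) + 1) powr (1 + p)
    \<le> \<bar>power_coeff p j\<bar> * (2 * real j + 1) powr (1 + p)"
proof -
  define x where "x = 2 * real j + 1"
  have x: "x > 0" "p < x" using assms by (auto simp: x_def)
  define s where "s = 1 / (x + 1)"
  have s1: "(1 + s) / (1 - s) = (x + 2) / x"
  proof -
    have "1 + s = (x + 2) / (x + 1)" "1 - s = x / (x + 1)"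
      using x by (simp_all add: s_def field_simps)
    then show ?thesis using x by simp
  qed
  have s2: "(1 + (1 + p) * s) / (1 - (1 + p) * s) = (x + 2 + p) / (x - p)"
  proof -
    have "1 + (1 + p) * s = (x + 2 + p) / (x + 1)" "1 - (1 + p) * s = (x - p) / (x + 1)"
      using x by (simp_all add: s_def field_simps)
    then show ?thesis using x by simp
  qed
  have "(1 + p) * ln ((x + 2) / x) \<le> ln ((x + 2 + p) / (x - p))"
    using ln_ratio_convex[of "1 + p" s] s1 s2 x assms by (simp add: s_def)
  then have "exp ((1 + p) * ln ((x + 2) / x)) \<le> (x + 2 + p) / (x - p)"
    using x assms by (metis add_pos_pos diff_gt_0_iff_gt divide_pos_pos exp_le_cancel_iff exp_ln zero_less_numeral)
  moreover have "exp ((1 + p) * ln ((x + 2) / x)) = (x + 2) powr (1 + p) / x powr (1 + p)"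
    using x by (simp add: powr_def ln_div exp_diff[symmetric] algebra_simps)
  ultimately have "(x + 2) powr (1 + p) / x powr (1 + p) \<le> (x + 2 + p) / (x - p)" by simp
  then have le: "(x + 2) powr (1 + p) * (x - p) \<le> (x + 2 + p) * x powr (1 + p)"
    using x by (simp add: pos_divide_le_eq pos_le_divide_eq)
  have "\<bar>(p + 2 * real j + 3) * power_coeff p (Suc j)\<bar> = \<bar>(p - 2 * real j - 1) * power_coeff p j\<bar>"
    using power_coeff_rec[OF assms(1)] by metis
  then have "(x + 2 + p) * \<bar>power_coeff p (Suc j)\<bar> = (x - p) * \<bar>power_coeff p j\<bar>"
    using x assms by (simp only: abs_mult) (simp add: x_def algebra_simps)
  then have "(x + 2 + p) * (\<bar>power_coeff p (Suc j)\<bar> * (x + 2) powr (1 + p))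
    = \<bar>power_coeff p j\<bar> * ((x + 2) powr (1 + p) * (x - p))" by (simp add: mult_ac)
  also have "\<dots> \<le> \<bar>power_coeff p j\<bar> * ((x + 2 + p) * x powr (1 + p))"
    by (rule mult_left_mono[OF le]) simp
  finally have "(x + 2 + p) * (\<bar>power_coeff p (Suc j)\<bar> * (x + 2) powr (1 + p))
    \<le> (x + 2 + p) * (\<bar>power_coeff p j\<bar> * x powr (1 + p))" by (simp add: mult_ac)
  then have "\<bar>power_coeff p (Suc j)\<bar> * (x + 2) powr (1 + p) \<le> \<bar>power_coeff p j\<bar> * x powr (1 + p)"
    using x assms by (simp add: mult_le_cancel_left_pos)
  then show ?thesis by (simp add: x_def add.commute)
qed

lemma power_coeff_decay:
  assumes "p > 0"
  obtains C where "C > 0" "\<And>j. \<bar>power_coeff p j\<bar> * (2 * real j + 1) powr (1 + p) \<le> C"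
proof -
  let ?w = "\<lambda>j. \<bar>power_coeff p j\<bar> * (2 * real j + 1) powr (1 + p)"
  obtain J :: nat where J: "p < real J" using reals_Archimedean2 by blast
  define C where "C = 1 + (\<Sum>j\<le>J. ?w j)"
  have le: "?w j \<le> C" for j
  proof (induction j)
    case 0
    show ?case using sum_nonneg[of "{..J}" ?w] member_le_sum[of 0 "{..J}" ?w] by (simp add: C_def)
  next
    case (Suc j)
    show ?case
    proof (cases "Suc j \<le> J")
      case True
      then show ?thesis using member_le_sum[of "Suc j" "{..J}" ?w] by (simp add: C_def)
    next
      case False
      then show ?thesis using power_coeff_ratio[of p j] assms J Suc by simp
    qed
  qed
  have "C > 0" using sum_nonneg[of "{..J}" ?w] by (simp add: C_def add_pos_nonneg)
  then show thesis using le that by blast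
qed

text \<open>The telescoped bound loses one power of J against the size of a single coefficient, so
  the decay J^(-1-p) becomes J^(-p) for the tail.\<close>

lemma power_coeff_tail:
  assumes "p > 0"
  obtains C where "C > 0" "\<And>J. (\<Sum>i. \<bar>power_coeff p (i + J)\<bar>) \<le> C * real (Suc J) powr (- p)"
proof -
  let ?u = "\<lambda>j. \<bar>power_coeff p j\<bar>"
  obtain C where C: "C > 0" "\<And>j. ?u j * (2 * real j + 1) powr (1 + p) \<le> C"
    using power_coeff_decay[OF assms] by blast
  have sm: "summable (\<lambda>i. ?u (i + J))" for J
    using summable_power_coeff[OF assms] summable_iff_shift[of ?u J] by simp
  define V where "V = suminf ?u"
  have V: "V \<ge> 0" unfolding V_def by (rule suminf_nonneg[OF summable_power_coeff[OF assms]]) simp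
  define B where "B = C / p + V * (p + 1) powr p"
  have "(\<Sum>i. ?u (i + J)) \<le> B * real (Suc J) powr (- p)" for J
  proof (cases "p \<le> 2 * real J + 1")
    case True
    have "(\<Sum>i. ?u (i + J)) \<le> (2 * real J + 1) * ?u J / p"
    proof (rule suminf_le_const[OF sm])
      fix n
      show "(\<Sum>i<n. ?u (i + J)) \<le> (2 * real J + 1) * ?u J / p"
        using power_coeff_partial_sum[OF assms True, of n] assms
        by (simp add: field_simps) (smt (verit) mult_nonneg_nonneg of_nat_0_le_iff abs_ge_zero)
    qed
    also have "\<dots> = (?u J * (2 * real J + 1) powr (1 + p)) * (2 * real J + 1) powr (- p) / p"
      using powr_add[of "2 * real J + 1" "1 + p" "- p"] by simp
    also have "\<dots> \<le> C * (2 * real J + 1) powr (- p) / p"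
      using C assms by (intro divide_right_mono mult_right_mono) auto
    also have "\<dots> \<le> C * real (Suc J) powr (- p) / p"
      using C assms by (intro divide_right_mono mult_left_mono powr_mono2') auto
    also have "\<dots> \<le> B * real (Suc J) powr (- p)"
      using V assms by (simp add: B_def field_simps)
    finally show ?thesis .
  next
    case False
    have "(\<Sum>i. ?u (i + J)) \<le> V"
      using suminf_split_initial_segment[OF summable_power_coeff[OF assms], of J]
        sum_nonneg[of "{..<J}" ?u] by (simp add: V_def)
    also have "V = V * (p + 1) powr p * (p + 1) powr (- p)"
      using assms powr_add[of "p + 1" p "- p"] by (simp add: mult.assoc)
    also have "\<dots> \<le> V * (p + 1) powr p * real (Suc J) powr (- p)"
      using False V assms by (intro mult_left_mono powr_mono2') auto
    also have "\<dots> \<le> B * real (Suc J) powr (- p)"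
      using C assms by (intro mult_right_mono) (auto simp: B_def)
    finally show ?thesis .
  qed
  moreover have "B > 0" using C V assms by (simp add: B_def add_pos_nonneg)
  ultimately show thesis using that by blast
qed

section \<open>The cosine series and its differential equation\<close>

lemma abs_cos_diff_le: "\<bar>cos x - cos y\<bar> \<le> \<bar>x - y\<bar>" for x y :: real
proof -
  have "\<bar>cos x - cos y\<bar> = 2 * \<bar>sin ((x + y) / 2)\<bar> * \<bar>sin ((y - x) / 2)\<bar>"
    by (simp add: cos_diff_cos abs_mult)
  also have "\<dots> \<le> 2 * 1 * \<bar>(y - x) / 2\<bar>"
    by (intro mult_mono abs_sin_x_le_abs_x) auto
  finally show ?thesis by simp
qed

lemma abs_sin_diff_le: "\<bar>sin x - sin y\<bar> \<le> \<bar>x - y\<bar>" for x y :: real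
proof -
  have "\<bar>sin x - sin y\<bar> = 2 * \<bar>sin ((x - y) / 2)\<bar> * \<bar>cos ((x + y) / 2)\<bar>"
    by (simp add: sin_diff_sin abs_mult)
  also have "\<dots> \<le> 2 * \<bar>(x - y) / 2\<bar> * 1"
    by (intro mult_mono abs_sin_x_le_abs_x) auto
  finally show ?thesis by simp
qed

definition cos_series :: "real \<Rightarrow> real \<Rightarrow> real" where
  "cos_series p t = (\<Sum>j. power_coeff p j * cos ((2 * real j + 1) * t))"

lemma summable_power_coeff_mult:
  assumes "p > 0" "\<And>j. \<bar>g j\<bar> \<le> K"
  shows "summable (\<lambda>j. power_coeff p j * g j)" "summable (\<lambda>j. power_coeff p (Suc j) * g j)"
proof -
  have s: "summable (\<lambda>j. \<bar>power_coeff p j\<bar> * K)"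
    using summable_power_coeff[OF assms(1)] by (rule summable_mult2)
  show "summable (\<lambda>j. power_coeff p j * g j)"
    by (rule summable_comparison_test'[OF s, of 0]) (simp add: abs_mult mult_left_mono assms)
  have "summable (\<lambda>j. \<bar>power_coeff p (Suc j)\<bar> * K)"
    using s by (subst summable_Suc_iff)
  then show "summable (\<lambda>j. power_coeff p (Suc j) * g j)"
    by (rule summable_comparison_test'[of _ 0]) (simp add: abs_mult mult_left_mono assms)
qed

text \<open>Common core of multiplication by cos t (\<open>k = 1\<close>) and by sin t
  (\<open>k = -1\<close>). Each product splits into two neighbouring even frequencies; shifting the
  second sum by one collects equal frequencies and leaves the term at frequency 0 outside.\<close>

lemma trig_mult_cos_series:
  assumes p: "p > 0" and f: "\<And>j. \<bar>f j\<bar> \<le> 1"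
    and prod: "\<And>j. c * cos ((2 * real j + 1) * t) = (f (Suc j) + k * f j) / 2"
  shows "summable (\<lambda>j. (power_coeff p j + k * power_coeff p (Suc j)) / 2 * f (Suc j))" (is ?s)
    and "c * cos_series p t = k * f 0 / 2 + (\<Sum>j. (power_coeff p j + k * power_coeff p (Suc j)) / 2 * f (Suc j))" (is ?e)
proof -
  let ?u = "power_coeff p"
  have h: "\<bar>f j / 2\<bar> \<le> 1" for j using f[of j] by simp
  have s1: "summable (\<lambda>j. ?u j * (f (Suc j) / 2))" and s1': "summable (\<lambda>j. ?u (Suc j) * (f (Suc j) / 2))"
    and s2: "summable (\<lambda>j. ?u j * (f j / 2))"
    by (rule summable_power_coeff_mult[OF p h])+
  have s0: "summable (\<lambda>j. ?u j * cos ((2 * real j + 1) * t))"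
    by (rule summable_power_coeff_mult[OF p, of _ 1]) simp
  have eq: "(?u j + k * ?u (Suc j)) / 2 * f (Suc j) = ?u j * (f (Suc j) / 2) + k * (?u (Suc j) * (f (Suc j) / 2))" for j
    by (simp add: field_simps)
  show ?s unfolding eq by (intro summable_add summable_mult s1 s1')
  have "c * cos_series p t = (\<Sum>j. ?u j * (f (Suc j) / 2) + k * (?u j * (f j / 2)))"
  proof -
    have "c * (?u j * cos ((2 * real j + 1) * t)) = ?u j * (f (Suc j) / 2) + k * (?u j * (f j / 2))" for j
      unfolding mult.left_commute[of c] prod by (simp add: field_simps)
    then show ?thesis unfolding cos_series_def using suminf_mult[OF s0, of c] by simp
  qed
  also have "\<dots> = (\<Sum>j. ?u j * (f (Suc j) / 2)) + k * (\<Sum>j. ?u j * (f j / 2))"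
    using suminf_add[OF s1 summable_mult[OF s2, of k]] suminf_mult[OF s2, of k] by simp
  also have "(\<Sum>j. ?u j * (f j / 2)) = (\<Sum>j. ?u (Suc j) * (f (Suc j) / 2)) + f 0 / 2"
    using suminf_split_head[OF s2] by simp
  finally have "c * cos_series p t = k * f 0 / 2 +
      ((\<Sum>j. ?u j * (f (Suc j) / 2)) + k * (\<Sum>j. ?u (Suc j) * (f (Suc j) / 2)))"
    by (simp add: algebra_simps)
  then show ?e
    unfolding eq using suminf_add[OF s1 summable_mult[OF s1', of k]] suminf_mult[OF s1', of k] by simp
qed

lemma cos_mult_cos_series:
  assumes "p > 0"
  shows "summable (\<lambda>j. (power_coeff p j + power_coeff p (Suc j)) / 2 * cos (2 * real (Suc j) * t))"
    and "cos t * cos_series p t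
      = 1 / 2 + (\<Sum>j. (power_coeff p j + power_coeff p (Suc j)) / 2 * cos (2 * real (Suc j) * t))"
proof -
  have "cos t * cos ((2 * real j + 1) * t) = (cos (2 * real (Suc j) * t) + 1 * cos (2 * real j * t)) / 2" for j
    using cos_times_cos[of "(2 * real j + 1) * t" t] by (simp add: algebra_simps)
  note * = trig_mult_cos_series[of p "\<lambda>j. cos (2 * real j * t)", OF assms abs_cos_le_one this]
  show "summable (\<lambda>j. (power_coeff p j + power_coeff p (Suc j)) / 2 * cos (2 * real (Suc j) * t))"
    and "cos t * cos_series p t
      = 1 / 2 + (\<Sum>j. (power_coeff p j + power_coeff p (Suc j)) / 2 * cos (2 * real (Suc j) * t))"
    using * by simp_all
qed

lemma sin_mult_cos_series:
  assumes "p > 0"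
  shows "summable (\<lambda>j. (power_coeff p j - power_coeff p (Suc j)) / 2 * sin (2 * real (Suc j) * t))"
    and "sin t * cos_series p t
      = (\<Sum>j. (power_coeff p j - power_coeff p (Suc j)) / 2 * sin (2 * real (Suc j) * t))"
proof -
  have "sin t * cos ((2 * real j + 1) * t) = (sin (2 * real (Suc j) * t) + (-1) * sin (2 * real j * t)) / 2" for j
    using sin_times_cos[of t "(2 * real j + 1) * t"] sin_minus[of "2 * real j * t"] by (simp add: algebra_simps)
  note * = trig_mult_cos_series[of p "\<lambda>j. sin (2 * real j * t)", OF assms abs_sin_le_one this]
  show "summable (\<lambda>j. (power_coeff p j - power_coeff p (Suc j)) / 2 * sin (2 * real (Suc j) * t))"
    and "sin t * cos_series p t
      = (\<Sum>j. (power_coeff p j - power_coeff p (Suc j)) / 2 * sin (2 * real (Suc j) * t))"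
    using * by simp_all
qed

text \<open>The recurrence rewritten so that its left side holds the coefficients of the derivative
  of cos t S(t) and its right side those of sin t S(t), for S the cosine series. It is the
  differential equation at the level of coefficients.\<close>

lemma power_coeff_add_diff:
  assumes "p > 0"
  shows "2 * real (Suc j) * (power_coeff p j + power_coeff p (Suc j))
    = (p + 1) * (power_coeff p j - power_coeff p (Suc j))"
  using power_coeff_rec[OF assms, of j] by (simp add: algebra_simps)

text \<open>
  For p < 1 the series itself cannot be differentiated term by term. After multiplication by cos t
  adjacent coefficients, which eventually alternate in sign, are averaged, and this gains one order of decay.
\<close>
lemma DERIV_cos_mult_cos_series:
  assumes "p > 0"
  shows "((\<lambda>t. cos t * cos_series p t) has_real_derivative - (p + 1) * (sin t * cos_series p t)) (at t)"
proof -
  let ?u = "power_coeff p"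
  let ?c = "\<lambda>j. (?u j + ?u (Suc j)) / 2"
  let ?f = "\<lambda>x j. ?c j * cos (2 * real (Suc j) * x)"
  let ?f' = "\<lambda>x j. ?c j * (- sin (2 * real (Suc j) * x) * (2 * real (Suc j)))"
  have key: "?c j * (2 * real (Suc j)) = (p + 1) / 2 * (?u j - ?u (Suc j))" for j
    using power_coeff_add_diff[OF assms, of j] by (simp add: field_simps)
  have f': "?f' x j = - (p + 1) * ((?u j - ?u (Suc j)) / 2 * sin (2 * real (Suc j) * x))" for x j
  proof -
    have "?f' x j = - (?c j * (2 * real (Suc j))) * sin (2 * real (Suc j) * x)" by simp
    also have "\<dots> = - ((p + 1) / 2 * (?u j - ?u (Suc j))) * sin (2 * real (Suc j) * x)"
      by (simp only: key)
    also have "\<dots> = - (p + 1) * ((?u j - ?u (Suc j)) / 2 * sin (2 * real (Suc j) * x))"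
      by (simp add: field_simps)
    finally show ?thesis .
  qed
  note sums = sin_mult_cos_series(1)[OF assms]
  have "DERIV (\<lambda>x. suminf (?f x)) t :> suminf (?f' t)"
  proof (rule DERIV_series'[where a = "t - 1" and b = "t + 1"])
    show "DERIV (\<lambda>x. ?f x n) t :> ?f' t n" for n
      by (auto intro!: derivative_eq_intros)
    show "summable (?f' t)" unfolding f' by (rule summable_mult[OF sums])
    \<comment> \<open>Summable Lipschitz constants for the terms: by \<open>key\<close> the
      frequency is absorbed into a difference of coefficients, which is absolutely summable.\<close>
    show "summable (\<lambda>j. (p + 1) / 2 * (\<bar>?u j\<bar> + \<bar>?u (Suc j)\<bar>))"
      using summable_power_coeff[OF assms] summable_Suc_iff[of "\<lambda>j. \<bar>?u j\<bar>"]
      by (intro summable_mult summable_add) auto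
    fix n x y
    have "\<bar>?f x n - ?f y n\<bar> = \<bar>?c n\<bar> * \<bar>cos (2 * real (Suc n) * x) - cos (2 * real (Suc n) * y)\<bar>"
      by (simp only: abs_mult[symmetric]) (simp add: algebra_simps)
    also have "\<dots> \<le> \<bar>?c n\<bar> * \<bar>2 * real (Suc n) * x - 2 * real (Suc n) * y\<bar>"
      by (intro mult_left_mono abs_cos_diff_le) auto
    also have "\<dots> = \<bar>?c n * (2 * real (Suc n))\<bar> * \<bar>x - y\<bar>"
      by (simp only: abs_mult[symmetric] right_diff_distrib mult.assoc)
    also have "\<dots> \<le> (p + 1) / 2 * (\<bar>?u n\<bar> + \<bar>?u (Suc n)\<bar>) * \<bar>x - y\<bar>"
      unfolding key using assms by (intro mult_right_mono) (auto simp: abs_mult)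
    finally show "\<bar>?f x n - ?f y n\<bar> \<le> (p + 1) / 2 * (\<bar>?u n\<bar> + \<bar>?u (Suc n)\<bar>) * \<bar>x - y\<bar>" .
  qed (use cos_mult_cos_series(1)[OF assms] in auto)
  moreover have "suminf (?f' t) = - (p + 1) * (sin t * cos_series p t)"
    unfolding f' sin_mult_cos_series(2)[OF assms] by (rule suminf_mult[OF sums])
  ultimately show ?thesis
    unfolding cos_mult_cos_series(2)[OF assms] by (auto intro!: derivative_eq_intros)
qed

text \<open>The function g(t) = cos t S(t) satisfies g' = -(p+1) tan t g, so its product with (cos
  t)^(-(p+1)) is constant. The interval is the one on which the cosine is positive.\<close>

lemma cos_series_eq:
  assumes "p > 0" "\<bar>t\<bar> < pi / 2"
  shows "cos_series p t = cos_series p 0 * cos t powr p"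
proof -
  let ?h = "\<lambda>t. cos t * cos_series p t * cos t powr (- (p + 1))"
  have "?h t = ?h 0"
  proof (rule DERIV_isconst3[where f = ?h and a = "- (pi / 2)" and b = "pi / 2"])
    fix x assume "x \<in> {- (pi / 2)<..<pi / 2}"
    then have c: "cos x > 0" by (intro cos_gt_zero_pi) auto
    have "(?h has_real_derivative (- (p + 1) * (sin x * cos_series p x)) * cos x powr (- (p + 1))
       + cos x * cos_series p x * (- (p + 1) * cos x powr (- (p + 1) - 1) * (- sin x))) (at x)"
      using DERIV_mult[OF DERIV_cos_mult_cos_series[OF assms(1), of x]
          DERIV_chain2[OF has_real_derivative_powr[OF c, of "- (p + 1)"] DERIV_cos]] by (simp add: mult_ac add_ac)
    moreover have "cos x powr (- (p + 1)) = cos x * cos x powr (- (p + 1) - 1)"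
      using c powr_add[of "cos x" 1 "- (p + 1) - 1"] by (simp add: algebra_simps)
    ultimately show "(?h has_real_derivative 0) (at x)" by (simp add: algebra_simps)
  qed (use assms in auto)
  then have h: "cos_series p 0 = cos t * cos_series p t * cos t powr (- (p + 1))" by simp
  have pos: "cos t > 0" using assms by (intro cos_gt_zero_pi) auto
  then have inv: "cos t powr (- (p + 1)) * cos t powr p = 1 / cos t"
    using powr_add[of "cos t" "- (p + 1)" p] by (simp add: powr_minus_divide)
  have "cos_series p 0 * cos t powr p = cos t * cos_series p t * (1 / cos t)"
    unfolding h inv[symmetric] by (simp only: mult.assoc)
  then show ?thesis using pos by simp
qed

text \<open>Only odd frequencies occur. The antisymmetry about pi/2 carries the closed form over to
  the half interval where the cosine is negative.\<close>

lemma cos_series_pi_minus: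
  assumes "p > 0"
  shows "cos_series p (pi - t) = - cos_series p t"
proof -
  have "cos ((2 * real j + 1) * (pi - t)) = - cos ((2 * real j + 1) * t)" for j
  proof -
    have "(2 * real j + 1) * (pi - t) = (pi - (2 * real j + 1) * t) + 2 * pi * real j"
      by (simp add: algebra_simps)
    moreover have "cos (x + 2 * pi * real j) = cos x" for x by (induction j) (simp_all add: algebra_simps cos_add sin_add)
    ultimately show ?thesis by (metis cos_pi_minus)
  qed
  moreover have "summable (\<lambda>j. power_coeff p j * cos ((2 * real j + 1) * t))"
    by (rule summable_power_coeff_mult[OF assms, of _ 1]) simp
  ultimately show ?thesis unfolding cos_series_def by (simp add: suminf_minus)
qed
text \<open>
  If the value at 0 were 0, the series would vanish identically; but cos t times the series has mean
  1/2.
\<close>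
lemma cos_series_0_nonzero:
  assumes "p > 0"
  shows "cos_series p 0 \<noteq> 0"
proof
  assume 0: "cos_series p 0 = 0"
  let ?u = "power_coeff p"
  let ?c = "\<lambda>j. (?u j + ?u (Suc j)) / 2"
  let ?f = "\<lambda>x j. ?c j / (2 * real (Suc j)) * sin (2 * real (Suc j) * x)"
  \<comment> \<open>A primitive of \<open>cos t * cos_series p t\<close>. All sines vanish at 0 and
    at pi, so it grows by pi/2 over [0, pi], which contradicts a vanishing derivative.\<close>
  let ?K = "\<lambda>x. x / 2 + suminf (?f x)"
  have sumc: "summable (\<lambda>j. \<bar>?u j\<bar> + \<bar>?u (Suc j)\<bar>)"
    using summable_power_coeff[OF assms] summable_Suc_iff[of "\<lambda>j. \<bar>?u j\<bar>"]
    by (intro summable_add) auto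
  note sumG = cos_mult_cos_series(1)[OF assms]
  have bound: "\<bar>?c j / (2 * real (Suc j))\<bar> \<le> \<bar>?u j\<bar> + \<bar>?u (Suc j)\<bar>" for j
  proof -
    have "\<bar>?c j / (2 * real (Suc j))\<bar> = \<bar>?u j + ?u (Suc j)\<bar> / (4 * real (Suc j))"
      by (simp add: abs_divide)
    also have "\<dots> \<le> \<bar>?u j + ?u (Suc j)\<bar> / 1" by (intro divide_left_mono) auto
    also have "\<dots> \<le> \<bar>?u j\<bar> + \<bar>?u (Suc j)\<bar>" by simp
    finally show ?thesis .
  qed
  have sumf: "summable (?f x)" for x
  proof (rule summable_comparison_test'[OF sumc, of 0])
    fix j
    have "\<bar>?f x j\<bar> \<le> \<bar>?c j / (2 * real (Suc j))\<bar>"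
      unfolding abs_mult by (rule mult_left_le) auto
    then show "norm (?f x j) \<le> \<bar>?u j\<bar> + \<bar>?u (Suc j)\<bar>" using bound[of j] by simp
  qed
  have K: "DERIV ?K t :> cos t * cos_series p t" for t
  proof -
    have "DERIV (\<lambda>x. suminf (?f x)) t :> (\<Sum>j. ?c j * cos (2 * real (Suc j) * t))"
    proof (rule DERIV_series'[where a = "t - 1" and b = "t + 1"])
      have D: "DERIV (\<lambda>x. c / w * sin (w * x)) t :> c * cos (w * t)" if "w \<noteq> 0" for c w
        using that by (auto intro!: derivative_eq_intros)
      show "DERIV (\<lambda>x. ?f x n) t :> ?c n * cos (2 * real (Suc n) * t)" for n
        by (rule D) simp
      have E: "\<bar>c / w\<bar> * \<bar>w * x - w * y\<bar> = \<bar>c\<bar> * \<bar>x - y\<bar>" if "w \<noteq> 0" for c w x y :: real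
        using that by (simp add: right_diff_distrib[symmetric] abs_mult)
      fix n x y
      have "\<bar>?f x n - ?f y n\<bar> = \<bar>?c n / (2 * real (Suc n))\<bar> * \<bar>sin (2 * real (Suc n) * x) - sin (2 * real (Suc n) * y)\<bar>"
        by (simp only: abs_mult[symmetric] right_diff_distrib)
      also have "\<dots> \<le> \<bar>?c n / (2 * real (Suc n))\<bar> * \<bar>2 * real (Suc n) * x - 2 * real (Suc n) * y\<bar>"
        by (intro mult_left_mono abs_sin_diff_le) auto
      also have "\<dots> = \<bar>?c n\<bar> * \<bar>x - y\<bar>"
        by (rule E) simp
      also have "\<dots> \<le> (\<bar>?u n\<bar> + \<bar>?u (Suc n)\<bar>) * \<bar>x - y\<bar>"
        by (intro mult_right_mono) auto
      finally show "\<bar>?f x n - ?f y n\<bar> \<le> (\<bar>?u n\<bar> + \<bar>?u (Suc n)\<bar>) * \<bar>x - y\<bar>" .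
    qed (use sumf sumc sumG in auto)
    then show ?thesis unfolding cos_mult_cos_series(2)[OF assms]
      by (intro derivative_eq_intros) auto
  qed
  have zero: "cos t * cos_series p t = 0" if "0 < t" "t < pi" for t
  proof (cases "t < pi / 2")
    case True
    then show ?thesis using cos_series_eq[OF assms, of t] 0 that by simp
  next
    case False
    show ?thesis
    proof (cases "t = pi / 2")
      case False
      then have "\<bar>pi - t\<bar> < pi / 2" using \<open>\<not> t < pi / 2\<close> that by auto
      then show ?thesis using cos_series_eq[OF assms, of "pi - t"] cos_series_pi_minus[OF assms, of t] 0 by simp
    next
      case True
      then show ?thesis by (metis cos_pi_half mult_zero_left)
    qed
  qed
  have "?K pi = ?K 0"
  proof (rule DERIV_isconst2[of 0 pi])
    show "continuous_on {0..pi} ?K"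
      using K by (intro continuous_at_imp_continuous_on ballI DERIV_isCont) blast
    show "DERIV ?K x :> 0" if "0 < x" "x < pi" for x using K[of x] zero[OF that] by simp
  qed auto
  moreover have "?f pi = (\<lambda>_. 0)"
  proof
    fix j
    have "sin (2 * real (Suc j) * pi) = 0" using sin_npi[of "2 * Suc j"] by simp
    then show "?f pi j = 0" by (simp only: mult_zero_right)
  qed
  then have "suminf (?f pi) = 0" by (simp only: suminf_zero)
  ultimately show False by (simp only:) simp
qed

abbreviation expansion_error :: "real \<Rightarrow> (nat \<Rightarrow> real) \<Rightarrow> nat \<Rightarrow> real \<Rightarrow> real" where
  "expansion_error p u J t \<equiv> \<bar>sgn (cos t) * \<bar>cos t\<bar> powr p - (\<Sum>j<J. u j * cos ((2 * real j + 1) * t))\<bar>"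

text \<open>The coefficients are divided by the value of the series at 0. The bound \<open>L\<close>
  on their absolute sums does not depend on \<open>J\<close>, and \<open>u 0 \<noteq> 0\<close>
  keeps these sums positive for \<open>J \<ge> 1\<close>, so that amplitudes can be normalised by
  them. The range [0, pi] is that of arccos.\<close>

lemma sgn_powr_cos_expansion:
  assumes "p > 0"
  obtains u :: "nat \<Rightarrow> real" and C L where "u 0 \<noteq> 0" "C > 0" "\<And>J. (\<Sum>j<J. \<bar>u j\<bar>) \<le> L"
    "\<And>J t. 0 \<le> t \<Longrightarrow> t \<le> pi \<Longrightarrow>
      expansion_error p u J t \<le> C * real (Suc J) powr (- p)"
proof -
  let ?F = "cos_series p 0"
  have F0: "?F \<noteq> 0" by (rule cos_series_0_nonzero[OF assms])
  define u where "u j = power_coeff p j / ?F" for j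
  obtain C where C: "C > 0" "\<And>J. (\<Sum>i. \<bar>power_coeff p (i + J)\<bar>) \<le> C * real (Suc J) powr (- p)"
    using power_coeff_tail[OF assms] by blast
  have sm: "summable (\<lambda>j. \<bar>power_coeff p j\<bar>)" by (rule summable_power_coeff[OF assms])
  have val: "cos_series p t = ?F * (sgn (cos t) * \<bar>cos t\<bar> powr p)" if t: "0 \<le> t" "t \<le> pi" for t
  proof -
    consider "t < pi / 2" | "t = pi / 2" | "t > pi / 2" by linarith
    then show ?thesis
    proof cases
      case 1
      then have "cos t > 0" using t by (intro cos_gt_zero_pi) auto
      then show ?thesis using cos_series_eq[OF assms, of t] 1 t by simp
    next
      case 2
      then have "pi - t = t" "cos t = 0" using cos_pi_half by (simp, metis)
      moreover from this have "cos_series p t = - cos_series p t"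
        using cos_series_pi_minus[OF assms, of t] by metis
      ultimately show ?thesis by simp
    next
      case 3
      then have "cos (pi - t) > 0" using t by (intro cos_gt_zero_pi) auto
      then have c: "cos t < 0" by simp
      then show ?thesis using cos_series_eq[OF assms, of "pi - t"] cos_series_pi_minus[OF assms, of t] 3 t by simp
    qed
  qed
  show thesis
  proof (rule that[of u "C / \<bar>?F\<bar>" "suminf (\<lambda>j. \<bar>power_coeff p j\<bar>) / \<bar>?F\<bar>"])
    show "u 0 \<noteq> 0" using F0 by (simp add: u_def)
    show "C / \<bar>?F\<bar> > 0" using C F0 by simp
    show "(\<Sum>j<J. \<bar>u j\<bar>) \<le> suminf (\<lambda>j. \<bar>power_coeff p j\<bar>) / \<bar>?F\<bar>" for J
      using sum_le_suminf[OF sm, of "{..<J}"]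
      by (simp add: u_def abs_divide sum_divide_distrib[symmetric] divide_right_mono)
    fix J and t :: real assume t: "0 \<le> t" "t \<le> pi"
    let ?g = "\<lambda>j. power_coeff p j * cos ((2 * real j + 1) * t)"
    have sg: "summable ?g" by (rule summable_power_coeff_mult[OF assms, of _ 1]) simp
    have sa: "summable (\<lambda>j. \<bar>power_coeff p (j + J)\<bar>)" using sm summable_iff_shift[of "\<lambda>j. \<bar>power_coeff p j\<bar>" J] by simp
    have gb: "\<bar>?g j\<bar> \<le> \<bar>power_coeff p j\<bar>" for j by (simp add: abs_mult mult_left_le)
    have sga: "summable (\<lambda>j. \<bar>?g (j + J)\<bar>)"
      by (rule summable_comparison_test'[OF sa, of 0]) (simp only: real_norm_def abs_idempotent gb)
    have "?F * (sgn (cos t) * \<bar>cos t\<bar> powr p) - (\<Sum>j<J. ?g j) = (\<Sum>j. ?g (j + J))"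
      using suminf_split_initial_segment[OF sg, of J] val[OF t] by (simp add: cos_series_def)
    also have "\<bar>\<dots>\<bar> \<le> (\<Sum>j. \<bar>?g (j + J)\<bar>)" by (rule summable_rabs[OF sga])
    also have "\<dots> \<le> (\<Sum>j. \<bar>power_coeff p (j + J)\<bar>)" by (rule suminf_le[OF gb sga sa])
    also have "\<dots> \<le> C * real (Suc J) powr (- p)" by (rule C)
    finally have le: "\<bar>?F * (sgn (cos t) * \<bar>cos t\<bar> powr p) - (\<Sum>j<J. ?g j)\<bar> \<le> C * real (Suc J) powr (- p)" .
    have "sgn (cos t) * \<bar>cos t\<bar> powr p - (\<Sum>j<J. u j * cos ((2 * real j + 1) * t))
      = (?F * (sgn (cos t) * \<bar>cos t\<bar> powr p) - (\<Sum>j<J. ?g j)) / ?F"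
      using F0 by (simp add: u_def diff_divide_distrib sum_divide_distrib)
    then show "expansion_error p u J t \<le> C / \<bar>?F\<bar> * real (Suc J) powr (- p)"
      using le by (simp add: abs_divide divide_right_mono)
  qed
qed

section \<open>Unitary operators on functions over a finite index set\<close>

definition ip :: "'i set \<Rightarrow> ('i \<Rightarrow> complex) \<Rightarrow> ('i \<Rightarrow> complex) \<Rightarrow> complex" where
  "ip E f g = (\<Sum>x\<in>E. cnj (f x) * g x)"

type_synonym 'i transform = "('i \<Rightarrow> complex) \<Rightarrow> 'i \<Rightarrow> complex"

text \<open>Functions are total, but only their values on \<open>E\<close> are meaningful; hence the
  first clause, that the result on \<open>E\<close> depends only on the argument on
  \<open>E\<close>. For finite \<open>E\<close> a linear isometry is unitary, so no inverse has to
  be recorded.\<close>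

definition uop :: "'i set \<Rightarrow> 'i transform \<Rightarrow> bool" where
  "uop E U \<longleftrightarrow>
     (\<forall>f g. (\<forall>x\<in>E. f x = g x) \<longrightarrow> (\<forall>x\<in>E. U f x = U g x)) \<and>
     (\<forall>f g. \<forall>x\<in>E. U (\<lambda>y. f y + g y) x = U f x + U g x) \<and>
     (\<forall>c f. \<forall>x\<in>E. U (\<lambda>y. c * f y) x = c * U f x) \<and>
     (\<forall>f g. ip E (U f) (U g) = ip E f g)"

lemma uopI:
  assumes "\<And>f g x. (\<And>y. y \<in> E \<Longrightarrow> f y = g y) \<Longrightarrow> x \<in> E \<Longrightarrow> U f x = U g x"
    and "\<And>f g x. x \<in> E \<Longrightarrow> U (\<lambda>y. f y + g y) x = U f x + U g x"
    and "\<And>c f x. x \<in> E \<Longrightarrow> U (\<lambda>y. c * f y) x = c * U f x"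
    and "\<And>f g. ip E (U f) (U g) = ip E f g"
  shows "uop E U"
  unfolding uop_def by (intro conjI allI impI ballI) (rule assms; blast)+

lemma uop_cong: "uop E U \<Longrightarrow> (\<And>y. y \<in> E \<Longrightarrow> f y = g y) \<Longrightarrow> x \<in> E \<Longrightarrow> U f x = U g x"
  unfolding uop_def by blast

lemma uop_add: "uop E U \<Longrightarrow> x \<in> E \<Longrightarrow> U (\<lambda>y. f y + g y) x = U f x + U g x"
  unfolding uop_def by blast

lemma uop_scale: "uop E U \<Longrightarrow> x \<in> E \<Longrightarrow> U (\<lambda>y. c * f y) x = c * U f x"
  unfolding uop_def by blast

lemma uop_ip: "uop E U \<Longrightarrow> ip E (U f) (U g) = ip E f g"
  unfolding uop_def by blast

lemma uop_diff:
  assumes "uop E U" "x \<in> E"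
  shows "U (\<lambda>y. f y - g y) x = U f x - U g x"
  using uop_add[OF assms, of f "\<lambda>y. (-1) * g y"] uop_scale[OF assms, of "-1" g] by simp

lemma uop_sum:
  assumes U: "uop E U" and "finite A" "x \<in> E"
  shows "U (\<lambda>y. \<Sum>a\<in>A. c a * f a y) x = (\<Sum>a\<in>A. c a * U (f a) x)"
  using assms(2)
proof (induction A)
  case empty
  then show ?case using uop_scale[OF U \<open>x \<in> E\<close>, of 0] by simp
next
  case (insert a A)
  then show ?case
    using uop_add[OF U \<open>x \<in> E\<close>, of "\<lambda>y. c a * f a y" "\<lambda>y. \<Sum>a\<in>A. c a * f a y"]
      uop_scale[OF U \<open>x \<in> E\<close>, of "c a" "f a"] by simp
qed

lemma ip_cong: "(\<And>x. x \<in> E \<Longrightarrow> f x = f' x) \<Longrightarrow> (\<And>x. x \<in> E \<Longrightarrow> g x = g' x) \<Longrightarrow> ip E f g = ip E f' g'"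
  unfolding ip_def by (intro sum.cong) auto

lemma cnj_ip: "cnj (ip E f g) = ip E g f"
  unfolding ip_def by (simp add: mult.commute)

lemma ip_add_right: "ip E h (\<lambda>x. f x + g x) = ip E h f + ip E h g"
  and ip_diff_left: "ip E (\<lambda>x. f x - g x) h = ip E f h - ip E g h"
  and ip_diff_right: "ip E h (\<lambda>x. f x - g x) = ip E h f - ip E h g"
  and ip_scale_left: "ip E (\<lambda>x. c * f x) h = cnj c * ip E f h"
  and ip_scale_right: "ip E h (\<lambda>x. c * f x) = c * ip E h f"
  unfolding ip_def by (simp_all add: algebra_simps sum.distrib sum_subtractf sum_distrib_left)

lemma ip_self: "ip E f f = of_real (\<Sum>x\<in>E. (cmod (f x))\<^sup>2)"
  unfolding ip_def of_real_sum by (intro sum.cong refl) (metis complex_norm_square mult.commute)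

lemma uop_id: "uop E (\<lambda>f. f)"
  by (rule uopI) auto

lemma uop_comp: "uop E U \<Longrightarrow> uop E V \<Longrightarrow> uop E (\<lambda>f. U (V f))"
proof (rule uopI)
  assume U: "uop E U" and V: "uop E V"
  fix f g :: "'a \<Rightarrow> complex" and c :: complex and x
  show "U (V f) x = U (V g) x" if "\<And>y. y \<in> E \<Longrightarrow> f y = g y" "x \<in> E"
    by (rule uop_cong[OF U uop_cong[OF V that(1)] that(2)])
  assume x: "x \<in> E"
  show "U (V (\<lambda>y. f y + g y)) x = U (V f) x + U (V g) x"
    by (subst uop_cong[OF U uop_add[OF V] x]) (auto intro: uop_add[OF U x])
  show "U (V (\<lambda>y. c * f y)) x = c * U (V f) x"
    by (subst uop_cong[OF U uop_scale[OF V] x]) (auto intro: uop_scale[OF U x])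
qed (simp add: uop_ip)

lemma uop_funpow: "uop E U \<Longrightarrow> uop E (U ^^ k)"
proof (induction k)
  case 0
  show ?case using uop_id[of E] by (simp add: id_def)
next
  case (Suc k)
  then show ?case using uop_comp[of E U "U ^^ k"] by (simp add: comp_def)
qed

definition reflection :: "'i set \<Rightarrow> ('i \<Rightarrow> complex) \<Rightarrow> 'i transform" where
  "reflection E u f = (\<lambda>x. 2 * ip E u f * u x - f x)"

lemma uop_reflection:
  assumes "ip E u u = 1"
  shows "uop E (reflection E u)"
proof (rule uopI)
  fix f g :: "'a \<Rightarrow> complex" and x
  show "reflection E u f x = reflection E u g x" if "\<And>y. y \<in> E \<Longrightarrow> f y = g y" "x \<in> E"
    using that ip_cong[of E u u f g] by (simp add: reflection_def)
  show "ip E (reflection E u f) (reflection E u g) = ip E f g"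
    unfolding reflection_def ip_diff_left ip_diff_right ip_scale_left ip_scale_right using assms cnj_ip[of E u f]
    by (simp add: algebra_simps)
qed (simp_all add: reflection_def ip_add_right ip_scale_right algebra_simps)

lemma uop_neg: "uop E U \<Longrightarrow> uop E (\<lambda>f x. - U f x)"
proof (rule uopI)
  assume U: "uop E U"
  show "- U f x = - U g x" if "\<And>y. y \<in> E \<Longrightarrow> f y = g y" "x \<in> E" for f g x
    using uop_cong[OF U that] by simp
  show "ip E (\<lambda>x. - U f x) (\<lambda>x. - U g x) = ip E f g" for f g
    using uop_ip[OF U, of f g] by (simp add: ip_def)
qed (simp_all add: uop_add uop_scale)

text \<open>Householder: the reflection that negates u-v exchanges u and v exactly when their norms
  agree and their inner product is real. Then the squared norm of u-v is 2 - 2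
  \<open>ip E u v\<close>, which makes the constants match.\<close>

lemma exists_uop_mapping:
  assumes u: "ip E u u = 1" and v: "ip E v v = 1" and real: "ip E u v \<in> \<real>" and fin: "finite E"
  shows "\<exists>U. uop E U \<and> (\<forall>x\<in>E. U u x = v x)"
proof (cases "\<forall>x\<in>E. u x = v x")
  case True
  then show ?thesis using uop_id by blast
next
  case False
  define s where "s = (\<Sum>x\<in>E. (cmod (u x - v x))\<^sup>2)"
  have s: "ip E (\<lambda>x. u x - v x) (\<lambda>x. u x - v x) = of_real s" by (simp add: ip_self s_def)
  have "s > 0"
  proof -
    obtain x where "x \<in> E" "u x \<noteq> v x" using False by blast
    then show ?thesis unfolding s_def using fin by (intro sum_pos2[of E x]) auto
  qed
  define c where "c = complex_of_real (1 / sqrt s)"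
  have c: "cnj c * c * of_real s = 1" "cnj c = c"
    using \<open>s > 0\<close> by (simp_all add: c_def flip: of_real_mult)
  define w where "w = (\<lambda>x. c * (u x - v x))"
  have w1: "ip E w w = 1" unfolding w_def ip_scale_left ip_scale_right s using c by (simp add: mult.assoc)
  have vu: "ip E v u = ip E u v" using real cnj_ip[of E u v] by (simp add: Reals_cnj_iff)
  have s2: "complex_of_real s = 2 - 2 * ip E u v"
    unfolding s[symmetric] by (simp add: ip_diff_left ip_diff_right u v vu)
  have "- reflection E w u x = v x" for x
  proof -
    have wu: "ip E w u = c * (1 - ip E u v)"
      unfolding w_def ip_scale_left ip_diff_left u vu c by simp
    have "2 * ip E w u * w x = c * c * (2 - 2 * ip E u v) * (u x - v x)"
      unfolding wu by (simp add: w_def algebra_simps)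
    also have "\<dots> = u x - v x" using c by (simp add: s2)
    finally show ?thesis by (simp add: reflection_def)
  qed
  then show ?thesis using uop_neg[OF uop_reflection[OF w1]] by blast
qed

section \<open>Adjoints and unitary matrices\<close>

lemma dim_mat_adjoint [simp]: "dim_row (mat_adjoint A) = dim_col A" "dim_col (mat_adjoint A) = dim_row A"
  unfolding mat_adjoint_def by simp_all

lemma mat_adjoint_carrier [simp]: "A \<in> carrier_mat n m \<Longrightarrow> mat_adjoint A \<in> carrier_mat m n"
  unfolding carrier_mat_def by simp

lemma mat_adjoint_index [simp]:
  fixes A :: "complex mat"
  shows "i < dim_col A \<Longrightarrow> j < dim_row A \<Longrightarrow> mat_adjoint A $$ (i, j) = cnj (A $$ (j, i))"
  unfolding mat_adjoint_def by (simp add: mat_of_rows_index)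

lemma mat_adjoint_adjoint [simp]: "mat_adjoint (mat_adjoint A) = (A :: complex mat)"
  by (rule eq_matI) auto

lemma mult_mat_index:
  "A \<in> carrier_mat n m \<Longrightarrow> B \<in> carrier_mat m p \<Longrightarrow> i < n \<Longrightarrow> j < p \<Longrightarrow>
    (A * B) $$ (i, j) = (\<Sum>k<m. A $$ (i, k) * B $$ (k, j))"
  by (auto simp: scalar_prod_def atLeast0LessThan)

lemma mult_mat_vec_index:
  "A \<in> carrier_mat n m \<Longrightarrow> v \<in> carrier_vec m \<Longrightarrow> i < n \<Longrightarrow> (A *\<^sub>v v) $ i = (\<Sum>k<m. A $$ (i, k) * v $ k)"
  by (auto simp: scalar_prod_def atLeast0LessThan)

lemma mat_adjoint_mult:
  fixes A B :: "complex mat"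
  assumes "A \<in> carrier_mat n m" "B \<in> carrier_mat m p"
  shows "mat_adjoint (A * B) = mat_adjoint B * mat_adjoint A"
proof (rule eq_matI)
  fix i j assume "i < dim_row (mat_adjoint B * mat_adjoint A)" "j < dim_col (mat_adjoint B * mat_adjoint A)"
  then have ij: "i < p" "j < n" using assms by auto
  then show "mat_adjoint (A * B) $$ (i, j) = (mat_adjoint B * mat_adjoint A) $$ (i, j)"
    using assms mult_mat_index[OF mat_adjoint_carrier[OF assms(2)] mat_adjoint_carrier[OF assms(1)] ij]
      mult_mat_index[OF assms ij(2) ij(1)] by (simp add: mult.commute)
qed (use assms in auto)

lemma unitary_matI:
  assumes "U \<in> carrier_mat n n" "mat_adjoint U * U = 1\<^sub>m n"
  shows "unitary_mat n U"
  using assms mat_mult_left_right_inverse[of "mat_adjoint U" n U] by (simp add: unitary_mat_def)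

lemma unitary_mat_mult:
  assumes "unitary_mat n U" "unitary_mat n V"
  shows "unitary_mat n (U * V)"
proof (rule unitary_matI)
  have c: "U \<in> carrier_mat n n" "V \<in> carrier_mat n n" using assms by (auto simp: unitary_mat_def)
  then show "U * V \<in> carrier_mat n n" by simp
  have "mat_adjoint (U * V) * (U * V) = mat_adjoint V * ((mat_adjoint U * U) * V)"
    using c by (simp add: mat_adjoint_mult[OF c] assoc_mult_mat[of _ n n _ n _ n])
  then show "mat_adjoint (U * V) * (U * V) = 1\<^sub>m n" using assms c by (simp add: unitary_mat_def)
qed

lemma unitary_mat_col:
  assumes "unitary_mat n U" "i < n" "j < n"
  shows "(\<Sum>k<n. cnj (U $$ (k, i)) * U $$ (k, j)) = (if i = j then 1 else 0)"
proof -
  have c: "U \<in> carrier_mat n n" using assms by (auto simp: unitary_mat_def)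
  have "(mat_adjoint U * U) $$ (i, j) = (if i = j then 1 else 0)" using assms by (simp add: unitary_mat_def)
  then show ?thesis using mult_mat_index[OF mat_adjoint_carrier[OF c] c assms(2,3)] c assms by simp
qed

lemma unitary_mat_row:
  assumes "unitary_mat n U" "i < n" "j < n"
  shows "(\<Sum>k<n. U $$ (i, k) * cnj (U $$ (j, k))) = (if i = j then 1 else 0)"
proof -
  have c: "U \<in> carrier_mat n n" using assms by (auto simp: unitary_mat_def)
  have "(U * mat_adjoint U) $$ (i, j) = (if i = j then 1 else 0)" using assms by (simp add: unitary_mat_def)
  then show ?thesis using mult_mat_index[OF c mat_adjoint_carrier[OF c] assms(2,3)] c assms by simp
qed

lemma unitary_mat_adjoint: "unitary_mat n U \<Longrightarrow> unitary_mat n (mat_adjoint U)"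
  by (simp add: unitary_mat_def)

section \<open>Passing between unitary matrices and operators on functions\<close>

lemma uop_mat:
  assumes "unitary_mat n A"
  shows "uop {..<n} (\<lambda>f i. \<Sum>j<n. A $$ (i, j) * f j)"
proof (rule uopI)
  fix f g :: "nat \<Rightarrow> complex"
  have "ip {..<n} (\<lambda>i. \<Sum>j<n. A $$ (i, j) * f j) (\<lambda>i. \<Sum>j<n. A $$ (i, j) * g j)
     = (\<Sum>i<n. \<Sum>j<n. \<Sum>k<n. cnj (f j) * g k * (cnj (A $$ (i, j)) * A $$ (i, k)))"
    unfolding ip_def cnj_sum sum_product complex_cnj_mult by (intro sum.cong refl) (simp only: mult_ac)
  also have "\<dots> = (\<Sum>j<n. \<Sum>k<n. \<Sum>i<n. cnj (f j) * g k * (cnj (A $$ (i, j)) * A $$ (i, k)))"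
    by (subst sum.swap, rule sum.cong[OF refl], rule sum.swap)
  also have "\<dots> = (\<Sum>j<n. \<Sum>k<n. cnj (f j) * g k * (if j = k then 1 else 0))"
    by (intro sum.cong refl) (simp only: sum_distrib_left[symmetric] unitary_mat_col[OF assms] lessThan_iff)
  also have "\<dots> = ip {..<n} f g" unfolding ip_def by (simp add: if_distrib[of "\<lambda>x. _ * x"] cong: if_cong)
  finally show "ip {..<n} (\<lambda>i. \<Sum>j<n. A $$ (i, j) * f j) (\<lambda>i. \<Sum>j<n. A $$ (i, j) * g j) = ip {..<n} f g" .
qed (auto simp: algebra_simps sum.distrib sum_distrib_left)

definition uop_to_mat :: "nat \<Rightarrow> (nat \<Rightarrow> 'i) \<Rightarrow> 'i transform \<Rightarrow> complex mat" where
  "uop_to_mat n e U = mat n n (\<lambda>(i, j). U (\<lambda>x. if x = e j then 1 else 0) (e i))"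

lemma uop_to_mat_unitary:
  assumes U: "uop E U" and e: "bij_betw e {..<n} E"
  shows "unitary_mat n (uop_to_mat n e U)"
proof (rule unitary_matI)
  let ?M = "uop_to_mat n e U"
  have M: "?M \<in> carrier_mat n n" by (simp add: uop_to_mat_def)
  then show "?M \<in> carrier_mat n n" .
  have fin: "finite E" using bij_betw_finite[OF e] by simp
  show "mat_adjoint ?M * ?M = 1\<^sub>m n"
  proof (rule eq_matI)
    fix i j assume "i < dim_row (1\<^sub>m n)" "j < dim_col (1\<^sub>m n)"
    then have ij: "i < n" "j < n" by auto
    let ?d = "\<lambda>j x. if x = e j then 1 else (0::complex)"
    have ei: "e i \<in> E" "e j \<in> E" "e i = e j \<longleftrightarrow> i = j"
      using e ij by (auto simp: bij_betw_def inj_on_def)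
    have "(mat_adjoint ?M * ?M) $$ (i, j) = (\<Sum>k<n. cnj (U (?d i) (e k)) * U (?d j) (e k))"
      using mult_mat_index[OF mat_adjoint_carrier[OF M] M ij] ij M by (simp add: uop_to_mat_def)
    also have "\<dots> = ip E (U (?d i)) (U (?d j))"
      unfolding ip_def using sum.reindex_bij_betw[OF e, of "\<lambda>x. cnj (U (?d i) x) * U (?d j) x"] by simp
    also have "\<dots> = ip E (?d i) (?d j)" by (rule uop_ip[OF U])
    also have "\<dots> = (if e i = e j then 1 else 0)"
      unfolding ip_def using fin ei by (simp add: if_distrib[of cnj] if_distrib[of "\<lambda>x. x * _"] cong: if_cong)
    also have "\<dots> = (1\<^sub>m n) $$ (i, j)" using ei ij by simp
    finally show "(mat_adjoint ?M * ?M) $$ (i, j) = (1\<^sub>m n) $$ (i, j)" .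
  qed (simp_all add: uop_to_mat_def)
qed

lemma uop_to_mat_mult_vec:
  assumes U: "uop E U" and e: "bij_betw e {..<n} E"
  shows "uop_to_mat n e U *\<^sub>v vec n (\<lambda>i. f (e i)) = vec n (\<lambda>i. U f (e i))"
proof (rule eq_vecI)
  fix i assume "i < dim_vec (vec n (\<lambda>i. U f (e i)))"
  then have i: "i < n" by simp
  let ?d = "\<lambda>z x. if x = z then 1 else (0::complex)"
  have fin: "finite E" using bij_betw_finite[OF e] by simp
  have ei: "e i \<in> E" using e i by (auto simp: bij_betw_def)
  have M: "uop_to_mat n e U \<in> carrier_mat n n" by (simp add: uop_to_mat_def)
  have "(uop_to_mat n e U *\<^sub>v vec n (\<lambda>i. f (e i))) $ i = (\<Sum>k<n. U (?d (e k)) (e i) * f (e k))"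
    using mult_mat_vec_index[OF M _ i, of "vec n (\<lambda>i. f (e i))"] i by (simp add: uop_to_mat_def)
  also have "\<dots> = (\<Sum>z\<in>E. f z * U (?d z) (e i))"
    using sum.reindex_bij_betw[OF e, of "\<lambda>z. f z * U (?d z) (e i)"] by (simp add: mult.commute)
  also have "\<dots> = U (\<lambda>y. \<Sum>z\<in>E. f z * ?d z y) (e i)"
    by (rule uop_sum[OF U fin ei, symmetric])
  also have "\<dots> = U f (e i)"
    by (rule uop_cong[OF U _ ei]) (simp add: fin if_distrib[of "\<lambda>x. _ * x"] cong: if_cong)
  finally show "(uop_to_mat n e U *\<^sub>v vec n (\<lambda>i. f (e i))) $ i = vec n (\<lambda>i. U f (e i)) $ i" using i by simp
qed (simp add: uop_to_mat_def)

section \<open>Spectral theorem and the trace distance\<close>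

abbreviation diag_conj :: "nat \<Rightarrow> complex mat \<Rightarrow> (nat \<Rightarrow> real) \<Rightarrow> complex mat" where
  "diag_conj n U d \<equiv> U * mat_diag n (\<lambda>i. of_real (d i)) * mat_adjoint U"

lemma square_mat_simps:
  fixes A B C :: "complex mat"
  assumes "A \<in> carrier_mat n n"
  shows "B \<in> carrier_mat n n \<Longrightarrow> A * B \<in> carrier_mat n n"
    and "B \<in> carrier_mat n n \<Longrightarrow> mat_adjoint (A * B) = mat_adjoint B * mat_adjoint A"
    and "B \<in> carrier_mat n n \<Longrightarrow> C \<in> carrier_mat n n \<Longrightarrow> A * B * C = A * (B * C)"
    and "1\<^sub>m n * A = A" "A * 1\<^sub>m n = A"
  using assms by (simp_all add: mat_adjoint_mult[of _ n n _ n] assoc_mult_mat[of _ n n _ n _ n])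

lemma unitary_mat_first_col:
  assumes v: "v \<in> carrier_vec (Suc n)" "v \<noteq> 0\<^sub>v (Suc n)"
  obtains W c where "unitary_mat (Suc n) W" "c \<noteq> 0" "\<And>i. i \<le> n \<Longrightarrow> W $$ (i, 0) = c * v $ i"
proof -
  define s where "s = (\<Sum>i<Suc n. (cmod (v $ i))\<^sup>2)"
  have "s > 0"
  proof -
    obtain i where "i < Suc n" "v $ i \<noteq> 0" using v by (metis carrier_vecD eq_vecI index_zero_vec)
    then show ?thesis unfolding s_def by (intro sum_pos2[of _ i]) auto
  qed
  \<comment> \<open>A phase that makes the entry of \<open>v\<close> at 0 real, as the Householder
    map needs a real overlap with the basis vector at 0.\<close>
  define ph where "ph = (if v $ 0 = 0 then 1 else cnj (v $ 0) / of_real (cmod (v $ 0)))"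
  have ph: "cmod ph = 1" by (simp add: ph_def norm_divide)
  have phv: "ph * v $ 0 \<in> \<real>"
    by (simp add: ph_def) (metis Reals_divide Reals_of_real complex_norm_square mult.commute)
  define c where "c = ph / of_real (sqrt s)"
  define e0 where "e0 = (\<lambda>i::nat. if i = 0 then 1 else (0::complex))"
  define w where "w = (\<lambda>i. c * v $ i)"
  have c2: "(cmod c)\<^sup>2 * s = 1" using \<open>s > 0\<close> ph by (simp add: c_def norm_divide power_divide)
  have "ip {..<Suc n} w w = of_real ((cmod c)\<^sup>2 * s)"
    unfolding ip_self w_def s_def norm_mult power_mult_distrib sum_distrib_left ..
  then have w1: "ip {..<Suc n} w w = 1" by (simp add: c2)
  have "ip {..<Suc n} e0 e0 = 1" "ip {..<Suc n} e0 w = w 0"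
    by (simp_all add: ip_def e0_def if_distrib[of cnj] if_distrib[of "\<lambda>x. x * _"] sum.delta' cong: if_cong del: sum.lessThan_Suc)
  moreover have "w 0 \<in> \<real>" using phv by (simp add: w_def c_def)
  ultimately obtain U where U: "uop {..<Suc n} U" "\<And>i. i < Suc n \<Longrightarrow> U e0 i = w i"
    using exists_uop_mapping[of "{..<Suc n}" e0 w] w1 by auto
  show thesis
  proof (rule that[of "uop_to_mat (Suc n) id U" c])
    show "unitary_mat (Suc n) (uop_to_mat (Suc n) id U)"
      by (rule uop_to_mat_unitary[OF U(1)]) simp
    show "c \<noteq> 0" using c2 by auto
    show "uop_to_mat (Suc n) id U $$ (i, 0) = c * v $ i" if "i \<le> n" for i
      using U(2)[of i] that by (simp add: uop_to_mat_def w_def e0_def)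
  qed
qed

text \<open>The direct sum of a scalar and an n by n block, the shape reached by splitting off one
  eigenvector in the spectral theorem.\<close>

definition corner_block :: "nat \<Rightarrow> complex \<Rightarrow> complex mat \<Rightarrow> complex mat" where
  "corner_block n k M = mat (Suc n) (Suc n)
     (\<lambda>(i, j). case (i, j) of (0, 0) \<Rightarrow> k | (Suc a, Suc b) \<Rightarrow> M $$ (a, b) | _ \<Rightarrow> 0)"

lemma corner_block_carrier [simp]: "corner_block n k M \<in> carrier_mat (Suc n) (Suc n)"
  by (simp add: corner_block_def)

lemma corner_block_mult:
  assumes "M \<in> carrier_mat n n" "M' \<in> carrier_mat n n"
  shows "corner_block n k M * corner_block n k' M' = corner_block n (k * k') (M * M')"
proof (rule eq_matI)
  fix i j assume "i < dim_row (corner_block n (k * k') (M * M'))" "j < dim_col (corner_block n (k * k') (M * M'))"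
  then have ij: "i < Suc n" "j < Suc n" by (simp_all add: corner_block_def)
  have "(corner_block n k M * corner_block n k' M') $$ (i, j)
      = (\<Sum>l<Suc n. corner_block n k M $$ (i, l) * corner_block n k' M' $$ (l, j))"
    by (rule mult_mat_index[OF _ _ ij]) simp_all
  also have "\<dots> = corner_block n (k * k') (M * M') $$ (i, j)"
    using ij assms mult_mat_index[OF assms]
    by (cases i; cases j) (simp_all add: corner_block_def sum.lessThan_Suc_shift del: sum.lessThan_Suc)
  finally show "(corner_block n k M * corner_block n k' M') $$ (i, j) = corner_block n (k * k') (M * M') $$ (i, j)" .
qed (simp_all add: corner_block_def)

lemma corner_block_adjoint:
  assumes "M \<in> carrier_mat n n"
  shows "mat_adjoint (corner_block n k M) = corner_block n (cnj k) (mat_adjoint M)"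
proof (rule eq_matI)
  fix i j assume "i < dim_row (corner_block n (cnj k) (mat_adjoint M))" "j < dim_col (corner_block n (cnj k) (mat_adjoint M))"
  then have "i < Suc n" "j < Suc n" by (simp_all add: corner_block_def)
  then show "mat_adjoint (corner_block n k M) $$ (i, j) = corner_block n (cnj k) (mat_adjoint M) $$ (i, j)"
    using assms by (cases i; cases j) (simp_all add: corner_block_def)
qed (simp_all add: corner_block_def)

lemma corner_block_one: "corner_block n 1 (1\<^sub>m n) = 1\<^sub>m (Suc n)"
proof (rule eq_matI)
  fix i j assume "i < dim_row (1\<^sub>m (Suc n))" "j < dim_col (1\<^sub>m (Suc n))"
  then show "corner_block n 1 (1\<^sub>m n) $$ (i, j) = 1\<^sub>m (Suc n) $$ (i, j)"
    by (cases i; cases j) (simp_all add: corner_block_def)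
qed (simp_all add: corner_block_def)

lemma mat_diag_Suc:
  "mat_diag (Suc n) (case_nat k d) = corner_block n k (mat_diag n d)"
proof (rule eq_matI)
  fix i j assume "i < dim_row (corner_block n k (mat_diag n d))" "j < dim_col (corner_block n k (mat_diag n d))"
  then have "i < Suc n" "j < Suc n" by (simp_all add: corner_block_def)
  then show "mat_diag (Suc n) (case_nat k d) $$ (i, j) = corner_block n k (mat_diag n d) $$ (i, j)"
    by (cases i; cases j) (simp_all add: corner_block_def mat_diag_def)
qed (simp_all add: corner_block_def mat_diag_def)

lemma unitary_conj_eq:
  assumes W: "unitary_mat n W" and A: "A \<in> carrier_mat n n" and B: "mat_adjoint W * A * W = B"
  shows "A = W * B * mat_adjoint W"
proof -
  note sq = square_mat_simps[of _ n]
  have c: "W \<in> carrier_mat n n" "mat_adjoint W \<in> carrier_mat n n" using W by (auto simp: unitary_mat_def)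
  have "W * B * mat_adjoint W = (W * mat_adjoint W) * A * (W * mat_adjoint W)"
    unfolding B[symmetric] using c A by (simp add: sq)
  then show ?thesis using W A by (simp add: unitary_mat_def)
qed

text \<open>Deflation: conjugating by a unitary whose column 0 is an eigenvector clears the rest of
  that column, and hermiticity clears the corresponding row. The eigenvalue is real because it sits
  on the diagonal of a Hermitian matrix; the remaining block is smaller.\<close>

lemma hermitian_spectral:
  assumes "A \<in> carrier_mat n n" "mat_adjoint A = A"
  shows "\<exists>U (d :: nat \<Rightarrow> real). unitary_mat n U \<and> A = diag_conj n U d"
  using assms
proof (induction n arbitrary: A)
  case 0
  have "unitary_mat 0 (1\<^sub>m 0)" by (rule unitary_matI) (simp, rule eq_matI, simp_all)
  moreover have "A = 1\<^sub>m 0 * mat_diag 0 (\<lambda>i. of_real ((\<lambda>_. 0) i)) * mat_adjoint (1\<^sub>m 0)"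
    using 0 by (intro eq_matI) simp_all
  ultimately show ?case by (intro exI[of _ "1\<^sub>m 0"] exI[of _ "\<lambda>_. 0"] conjI)
next
  case (Suc n A)
  note sq = square_mat_simps[of _ "Suc n"]
  obtain k where "eigenvalue A k" using spectrum_non_empty[OF Suc.prems(1)] by (auto simp: spectrum_def)
  then obtain v where v: "v \<in> carrier_vec (Suc n)" "v \<noteq> 0\<^sub>v (Suc n)" "A *\<^sub>v v = k \<cdot>\<^sub>v v"
    using Suc.prems by (auto simp: eigenvalue_def eigenvector_def)
  obtain W c where W: "unitary_mat (Suc n) W" "c \<noteq> 0" "\<And>i. i \<le> n \<Longrightarrow> W $$ (i, 0) = c * v $ i"
    using unitary_mat_first_col[OF v(1,2)] by blast
  have Wc: "W \<in> carrier_mat (Suc n) (Suc n)" "mat_adjoint W \<in> carrier_mat (Suc n) (Suc n)"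
    using W by (auto simp: unitary_mat_def)
  have AW: "(A * W) $$ (i, 0) = k * W $$ (i, 0)" if "i < Suc n" for i
  proof -
    have "(A * W) $$ (i, 0) = (\<Sum>l<Suc n. A $$ (i, l) * W $$ (l, 0))"
      by (rule mult_mat_index[OF Suc.prems(1) Wc(1) that]) simp
    also have "\<dots> = c * (\<Sum>l<Suc n. A $$ (i, l) * v $ l)"
      unfolding sum_distrib_left by (intro sum.cong refl) (simp add: W(3) mult_ac)
    also have "\<dots> = c * (A *\<^sub>v v) $ i" by (simp only: mult_mat_vec_index[OF Suc.prems(1) v(1) that])
    also have "\<dots> = k * W $$ (i, 0)" using that v by (simp add: W(3))
    finally show ?thesis .
  qed
  define B where "B = mat_adjoint W * A * W"
  have Bc: "B \<in> carrier_mat (Suc n) (Suc n)" using Wc Suc.prems by (simp add: B_def sq)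
  have Badj: "mat_adjoint B = B"
    unfolding B_def using Wc Suc.prems
    by (simp add: sq)
  have B0: "B $$ (i, 0) = (if i = 0 then k else 0)" if "i < Suc n" for i
  proof -
    have "B = mat_adjoint W * (A * W)"
      unfolding B_def using Wc Suc.prems by (simp add: sq)
    then have "B $$ (i, 0) = (\<Sum>l<Suc n. mat_adjoint W $$ (i, l) * (A * W) $$ (l, 0))"
      using mult_mat_index[of "mat_adjoint W" "Suc n" "Suc n" "A * W" "Suc n" i 0] Wc Suc.prems that
      by (metis mult_carrier_mat zero_less_Suc)
    also have "\<dots> = (\<Sum>l<Suc n. k * (cnj (W $$ (l, i)) * W $$ (l, 0)))"
      using that Wc by (intro sum.cong refl) (simp add: AW)
    also have "\<dots> = (if i = 0 then k else 0)"
      unfolding sum_distrib_left[symmetric] using unitary_mat_col[OF W(1) that, of 0] by simp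
    finally show ?thesis .
  qed
  have Bcnj: "B $$ (i, j) = cnj (B $$ (j, i))" if "i < Suc n" "j < Suc n" for i j
    using Badj Bc that by (metis carrier_matD mat_adjoint_index)
  have kr: "k = of_real (Re k)" using Bcnj[of 0 0] B0[of 0] by (simp add: complex_eq_iff)
  define B' where "B' = mat n n (\<lambda>(i, j). B $$ (Suc i, Suc j))"
  have B'c: "B' \<in> carrier_mat n n" by (simp add: B'_def)
  have "mat_adjoint B' = B'"
    by (rule eq_matI) (auto simp: B'_def Bcnj[symmetric])
  then obtain U d where U: "unitary_mat n U" "B' = diag_conj n U d"
    using Suc.IH[OF B'c] by blast
  have Uc: "U \<in> carrier_mat n n" "mat_adjoint U \<in> carrier_mat n n" using U by (auto simp: unitary_mat_def)
  have BB: "B = corner_block n k B'"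
  proof (rule eq_matI)
    fix i j assume "i < dim_row (corner_block n k B')" "j < dim_col (corner_block n k B')"
    then have ij: "i < Suc n" "j < Suc n" by (simp_all add: corner_block_def)
    show "B $$ (i, j) = corner_block n k B' $$ (i, j)"
    proof (cases j)
      case 0
      then show ?thesis using ij B0[OF ij(1)] by (cases i) (simp_all add: corner_block_def)
    next
      case (Suc j')
      then show ?thesis using ij B0[OF ij(2)] Bcnj[OF ij]
        by (cases i) (simp_all add: corner_block_def B'_def)
    qed
  qed (use Bc in \<open>auto simp: corner_block_def\<close>)
  let ?V = "corner_block n 1 U"
  have "corner_block n k B' = ?V * corner_block n k (mat_diag n (\<lambda>i. of_real (d i))) * mat_adjoint ?V"
    using Uc U(2) by (simp add: corner_block_adjoint corner_block_mult)
  also have "corner_block n k (mat_diag n (\<lambda>i. of_real (d i))) = mat_diag (Suc n) (\<lambda>i. of_real (case_nat (Re k) d i))"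
    unfolding mat_diag_Suc[symmetric] by (subst kr) (auto simp: mat_diag_def fun_eq_iff split: nat.split intro!: cong_mat)
  finally have BV: "B = ?V * mat_diag (Suc n) (\<lambda>i. of_real (case_nat (Re k) d i)) * mat_adjoint ?V"
    using BB by simp
  have Vu: "unitary_mat (Suc n) ?V"
    using U(1) Uc by (intro unitary_matI) (simp_all add: corner_block_adjoint corner_block_mult corner_block_one unitary_mat_def)
  have Vc: "?V \<in> carrier_mat (Suc n) (Suc n)" "mat_adjoint ?V \<in> carrier_mat (Suc n) (Suc n)" by simp_all
  have "A = W * B * mat_adjoint W" by (rule unitary_conj_eq[OF W(1) Suc.prems(1)]) (simp add: B_def)
  also have "\<dots> = (W * ?V) * mat_diag (Suc n) (\<lambda>i. of_real (case_nat (Re k) d i)) * mat_adjoint (W * ?V)"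
    unfolding BV using Wc Vc mat_diag_dim
    by (simp add: sq)
  finally show ?case using unitary_mat_mult[OF W(1) Vu] by blast
qed

lemma conj_diag_index:
  assumes "U \<in> carrier_mat n n" "i < n" "j < n"
  shows "(U * mat_diag n d * mat_adjoint U) $$ (i, j) = (\<Sum>k<n. U $$ (i, k) * d k * cnj (U $$ (j, k)))"
proof -
  have "U * mat_diag n d = mat n n (\<lambda>(i, j). U $$ (i, j) * d j)" by (rule mat_diag_mult_right[OF assms(1)])
  then show ?thesis
    using assms mult_mat_index[of "mat n n (\<lambda>(i, j). U $$ (i, j) * d j)" n n "mat_adjoint U" n i j] by simp
qed

text \<open>The unitary Z = U^* V intertwines the two diagonal matrices, so its entry at (i, j)
  vanishes unless \<open>d i = d' j\<close>. The squared moduli of its entries form a doubly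
  stochastic matrix that redistributes one sum into the other. This makes results independent of the
  decomposition chosen in \<open>mat_powr\<close>.\<close>

lemma spectral_sum_unique:
  fixes d d' :: "nat \<Rightarrow> real" and g :: "real \<Rightarrow> real"
  assumes U: "unitary_mat n U" and V: "unitary_mat n V"
    and eq: "diag_conj n U d = diag_conj n V d'"
  shows "(\<Sum>i<n. g (d i)) = (\<Sum>i<n. g (d' i))"
proof -
  have c: "U \<in> carrier_mat n n" "mat_adjoint U \<in> carrier_mat n n" "V \<in> carrier_mat n n" "mat_adjoint V \<in> carrier_mat n n"
    using U V by (auto simp: unitary_mat_def)
  let ?D = "mat_diag n (\<lambda>i. complex_of_real (d i))" and ?D' = "mat_diag n (\<lambda>i. complex_of_real (d' i))"
  note sq = square_mat_simps[of _ n]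
  define Z where "Z = mat_adjoint U * V"
  have Z: "unitary_mat n Z" unfolding Z_def by (intro unitary_mat_mult unitary_mat_adjoint U V)
  then have Zc: "Z \<in> carrier_mat n n" by (simp add: unitary_mat_def)
  have "?D * Z = (mat_adjoint U * U) * ?D * Z" using U c Zc by (simp add: unitary_mat_def sq)
  also have "\<dots> = mat_adjoint U * (U * ?D * mat_adjoint U) * V"
    using c by (simp add: Z_def sq)
  also have "\<dots> = mat_adjoint U * V * ?D' * (mat_adjoint V * V)"
    unfolding eq using c by (simp add: sq)
  also have "\<dots> = Z * ?D'" using V c Zc by (simp add: unitary_mat_def Z_def[symmetric] sq)
  finally have DZ: "?D * Z = Z * ?D'" .
  have key: "g (d i) * (cmod (Z $$ (i, j)))\<^sup>2 = g (d' j) * (cmod (Z $$ (i, j)))\<^sup>2" if "i < n" "j < n" for i j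
  proof -
    have "(?D * Z) $$ (i, j) = (Z * ?D') $$ (i, j)" by (simp only: DZ)
    then have "of_real (d i) * Z $$ (i, j) = Z $$ (i, j) * of_real (d' j)"
      using that Zc by (simp add: mat_diag_mult_left[OF Zc] mat_diag_mult_right[OF Zc])
    then show ?thesis by (cases "Z $$ (i, j) = 0") (auto simp: mult.commute)
  qed
  have r: "(\<Sum>j<n. (cmod (Z $$ (i, j)))\<^sup>2) = 1" if "i < n" for i
  proof -
    have "complex_of_real (\<Sum>j<n. (cmod (Z $$ (i, j)))\<^sup>2) = 1"
      using unitary_mat_row[OF Z that that] by (simp only: of_real_sum complex_norm_square simp_thms if_True)
    then show ?thesis by (simp only: of_real_eq_1_iff)
  qed
  have l: "(\<Sum>i<n. (cmod (Z $$ (i, j)))\<^sup>2) = 1" if "j < n" for j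
  proof -
    have "complex_of_real (\<Sum>i<n. (cmod (Z $$ (i, j)))\<^sup>2) = 1"
      using unitary_mat_col[OF Z that that] by (simp only: of_real_sum complex_norm_square simp_thms if_True mult.commute)
    then show ?thesis by (simp only: of_real_eq_1_iff)
  qed
  have "(\<Sum>i<n. g (d i)) = (\<Sum>i<n. \<Sum>j<n. g (d i) * (cmod (Z $$ (i, j)))\<^sup>2)"
    by (intro sum.cong refl) (simp add: sum_distrib_left[symmetric] r)
  also have "\<dots> = (\<Sum>i<n. \<Sum>j<n. g (d' j) * (cmod (Z $$ (i, j)))\<^sup>2)"
    by (intro sum.cong refl) (simp add: key)
  also have "\<dots> = (\<Sum>j<n. \<Sum>i<n. g (d' j) * (cmod (Z $$ (i, j)))\<^sup>2)" by (rule sum.swap)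
  also have "\<dots> = (\<Sum>i<n. g (d' i))"
    by (intro sum.cong refl) (simp add: sum_distrib_left[symmetric] l)
  finally show ?thesis .
qed

lemma trace_conj_diag:
  assumes U: "unitary_mat n U"
  shows "trace_mat (U * mat_diag n d * mat_adjoint U) = (\<Sum>k<n. d k)"
proof -
  have c: "U \<in> carrier_mat n n" using U by (auto simp: unitary_mat_def)
  then have "trace_mat (U * mat_diag n d * mat_adjoint U) = (\<Sum>i<n. \<Sum>k<n. U $$ (i, k) * d k * cnj (U $$ (i, k)))"
    unfolding trace_mat_def by (intro sum.cong conj_diag_index) auto
  also have "\<dots> = (\<Sum>k<n. \<Sum>i<n. d k * (cnj (U $$ (i, k)) * U $$ (i, k)))"
    by (subst sum.swap) (simp add: mult_ac)
  also have "\<dots> = (\<Sum>k<n. d k)"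
    by (intro sum.cong refl) (simp add: sum_distrib_left[symmetric] unitary_mat_col[OF U])
  finally show ?thesis .
qed

text \<open>The choice in \<open>mat_powr\<close> may select a decomposition other than the given
  one; only its existence is transferred.\<close>

lemma mat_powr_spec:
  assumes U: "unitary_mat n U" and d: "\<And>i. i < n \<Longrightarrow> 0 \<le> d i"
    and A: "A = diag_conj n U d"
  obtains V d' where "unitary_mat n V" "\<And>i. i < n \<Longrightarrow> (0::real) \<le> d' i"
    "A = diag_conj n V d'"
    "mat_powr A s = V * mat_diag n (\<lambda>i. of_real (d' i powr s)) * mat_adjoint V"
proof -
  have "U \<in> carrier_mat n n" using U by (auto simp: unitary_mat_def)
  then have dim: "dim_row A = n" by (simp add: A)
  let ?P = "\<lambda>B V d'. unitary_mat n V \<and> (\<forall>i<n. (0::real) \<le> d' i) \<and>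
     A = diag_conj n V d' \<and>
     B = V * mat_diag n (\<lambda>i. complex_of_real (d' i powr s)) * mat_adjoint V"
  have "?P (U * mat_diag n (\<lambda>i. complex_of_real (d i powr s)) * mat_adjoint U) U d"
    by (intro conjI allI impI U d A refl)
  then have "\<exists>B V d'. ?P B V d'" by iprover
  from someI_ex[OF this] obtain V d' where "?P (mat_powr A s) V d'"
    unfolding mat_powr_def dim by iprover
  then show thesis by (intro that[of V d']) iprover+
qed

text \<open>The square root and the \<alpha>-th power each choose their own decomposition. Only sums
  over eigenvalues are needed, and \<open>spectral_sum_unique\<close> carries these back through
  both choices to \<open>d\<close>.\<close>

lemma T_dist_spectral:
  fixes d :: "nat \<Rightarrow> real"
  assumes U: "unitary_mat n U" and A: "\<rho>0 - \<rho>1 = diag_conj n U d"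
  shows "T_dist \<alpha> \<rho>0 \<rho>1 = 1 / 2 * (\<Sum>i<n. \<bar>d i\<bar> powr \<alpha>) powr (1 / \<alpha>)"
proof -
  define A where "A = \<rho>0 - \<rho>1"
  have c: "U \<in> carrier_mat n n" "mat_adjoint U \<in> carrier_mat n n" using U by (auto simp: unitary_mat_def)
  let ?D = "mat_diag n (\<lambda>i. complex_of_real (d i))"
  note sq = square_mat_simps[of _ n]
  have "mat_adjoint ?D = ?D" by (rule eq_matI) (auto simp: mat_diag_def)
  then have adj: "mat_adjoint A = A"
    unfolding A_def A using c mat_diag_dim by (simp add: sq)
  have "mat_adjoint A * A = U * (?D * ((mat_adjoint U * U) * (?D * mat_adjoint U)))"
    unfolding adj unfolding A_def A using c mat_diag_dim by (simp add: sq)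
  also have "\<dots> = U * (?D * (?D * mat_adjoint U))"
    using U c mat_diag_dim by (simp add: unitary_mat_def sq)
  also have "\<dots> = U * (?D * ?D) * mat_adjoint U" using c mat_diag_dim by (simp add: sq del: mat_diag_diag)
  finally have AA: "mat_adjoint A * A = U * mat_diag n (\<lambda>i. of_real ((d i)\<^sup>2)) * mat_adjoint U"
    by (simp add: power2_eq_square)
  obtain V e where V: "unitary_mat n V" "\<And>i. i < n \<Longrightarrow> 0 \<le> e i"
    "mat_adjoint A * A = diag_conj n V e"
    "mat_abs A = V * mat_diag n (\<lambda>i. of_real (e i powr (1 / 2))) * mat_adjoint V"
    using mat_powr_spec[OF U _ AA, of "1 / 2"] unfolding mat_abs_def by auto
  obtain W f where W: "unitary_mat n W" "\<And>i. i < n \<Longrightarrow> 0 \<le> f i"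
    "mat_abs A = diag_conj n W f"
    "mat_powr (mat_abs A) \<alpha> = W * mat_diag n (\<lambda>i. of_real (f i powr \<alpha>)) * mat_adjoint W"
    using mat_powr_spec[OF V(1) _ V(4), of \<alpha>] by auto
  have "Re (trace_mat (mat_powr (mat_abs A) \<alpha>)) = (\<Sum>i<n. f i powr \<alpha>)"
    unfolding W(4) trace_conj_diag[OF W(1)] by simp
  also have "\<dots> = (\<Sum>i<n. (e i powr (1 / 2)) powr \<alpha>)"
    by (rule spectral_sum_unique[OF W(1) V(1)]) (simp only: W(3)[symmetric] V(4)[symmetric])
  also have "\<dots> = (\<Sum>i<n. ((d i)\<^sup>2 powr (1 / 2)) powr \<alpha>)"
    by (rule spectral_sum_unique[OF V(1) U, of e "\<lambda>i. (d i)\<^sup>2" "\<lambda>x. (x powr (1 / 2)) powr \<alpha>"])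
      (simp only: V(3)[symmetric] AA[symmetric])
  also have "\<dots> = (\<Sum>i<n. \<bar>d i\<bar> powr \<alpha>)" by (simp add: powr_half_sqrt)
  finally show ?thesis by (simp add: T_dist_def A_def)
qed

section \<open>Operators implemented by query circuits\<close>

lemma uop_signed_perm:
  assumes "bij_betw \<pi> E E" "\<And>x. x \<in> E \<Longrightarrow> cmod (s x) = 1"
  shows "uop E (\<lambda>f x. s x * f (\<pi> x))"
proof (rule uopI)
  fix f g :: "'a \<Rightarrow> complex"
  have "ip E (\<lambda>x. s x * f (\<pi> x)) (\<lambda>x. s x * g (\<pi> x)) = (\<Sum>x\<in>E. cnj (f (\<pi> x)) * g (\<pi> x))"
    unfolding ip_def
  proof (rule sum.cong[OF refl])
    fix x assume "x \<in> E"
    then have "cnj (s x) * s x = 1" using assms(2) by (metis complex_norm_square mult.commute of_real_1 one_power2)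
    then have "cnj (f (\<pi> x)) * (cnj (s x) * s x) * g (\<pi> x) = cnj (f (\<pi> x)) * g (\<pi> x)" by simp
    then show "cnj (s x * f (\<pi> x)) * (s x * g (\<pi> x)) = cnj (f (\<pi> x)) * g (\<pi> x)" by (simp add: mult_ac)
  qed
  also have "\<dots> = ip E f g" unfolding ip_def by (rule sum.reindex_bij_betw[OF assms(1), of "\<lambda>x. cnj (f x) * g x"])
  finally show "ip E (\<lambda>x. s x * f (\<pi> x)) (\<lambda>x. s x * g (\<pi> x)) = ip E f g" .
next
  fix f g :: "'a \<Rightarrow> complex" and x
  assume "\<And>y. y \<in> E \<Longrightarrow> f y = g y" "x \<in> E"
  then show "s x * f (\<pi> x) = s x * g (\<pi> x)" using bij_betwE[OF assms(1)] by simp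
qed (simp_all add: algebra_simps)

lemma uop_perm: "bij_betw \<pi> E E \<Longrightarrow> uop E (\<lambda>f x. f (\<pi> x))"
  using uop_signed_perm[of \<pi> E "\<lambda>_. 1"] by simp

abbreviation run_steps ::
  "nat \<Rightarrow> (black_box \<Rightarrow> nat) \<Rightarrow> (black_box \<Rightarrow> complex mat) \<Rightarrow> step list \<Rightarrow> complex vec \<Rightarrow> complex vec" where
  "run_steps m q Q \<equiv> fold (\<lambda>s v. step_mat m q Q s *\<^sub>v v)"

text \<open>
  The state of the m qubits is described by a function on an arbitrary index type, which the bijection
  e identifies with the basis states. Since permutations are free, the choice of e is immaterial.
\<close>
definition implements ::
  "nat \<Rightarrow> (black_box \<Rightarrow> nat) \<Rightarrow> (nat \<Rightarrow> 'i) \<Rightarrow> nat \<Rightarrow>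
    ((black_box \<Rightarrow> complex mat) \<Rightarrow> 'i transform) \<Rightarrow> bool" where
  "implements m q e t F \<longleftrightarrow> (\<exists>L. (\<forall>s\<in>set L. valid_step m q s) \<and> length (filter is_query L) \<le> t \<and>
     (\<forall>Q f. (\<forall>b. unitary_mat (2 ^ q b) (Q b)) \<longrightarrow>
        run_steps m q Q L (vec (2 ^ m) (\<lambda>i. f (e i))) = vec (2 ^ m) (\<lambda>i. F Q f (e i))))"

lemma implements_comp:
  assumes "implements m q e t F" "implements m q e t' G"
  shows "implements m q e (t + t') (\<lambda>Q f. G Q (F Q f))"
proof -
  obtain L where L: "\<forall>s\<in>set L. valid_step m q s" "length (filter is_query L) \<le> t"
    "\<And>Q f. \<forall>b. unitary_mat (2 ^ q b) (Q b) \<Longrightarrow>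
      run_steps m q Q L (vec (2 ^ m) (\<lambda>i. f (e i))) = vec (2 ^ m) (\<lambda>i. F Q f (e i))"
    using assms(1) unfolding implements_def by blast
  obtain L' where L': "\<forall>s\<in>set L'. valid_step m q s" "length (filter is_query L') \<le> t'"
    "\<And>Q f. \<forall>b. unitary_mat (2 ^ q b) (Q b) \<Longrightarrow>
      run_steps m q Q L' (vec (2 ^ m) (\<lambda>i. f (e i))) = vec (2 ^ m) (\<lambda>i. G Q f (e i))"
    using assms(2) unfolding implements_def by blast
  show ?thesis unfolding implements_def
    by (rule exI[of _ "L @ L'"]) (use L L' in auto)
qed

lemma implements_cong:
  assumes "implements m q e t F" "bij_betw e {..<2 ^ m} E"
    and "\<And>Q f x. (\<And>b. unitary_mat (2 ^ q b) (Q b)) \<Longrightarrow> x \<in> E \<Longrightarrow> F' Q f x = F Q f x"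
  shows "implements m q e t F'"
proof -
  have "vec (2 ^ m) (\<lambda>i. F' Q f (e i)) = vec (2 ^ m) (\<lambda>i. F Q f (e i))"
    if "\<forall>b. unitary_mat (2 ^ q b) (Q b)" for Q f
    using that assms(3) bij_betwE[OF assms(2)] by (intro eq_vecI) auto
  moreover obtain L where "\<forall>s\<in>set L. valid_step m q s" "length (filter is_query L) \<le> t"
    "\<And>Q f. \<forall>b. unitary_mat (2 ^ q b) (Q b) \<Longrightarrow>
      run_steps m q Q L (vec (2 ^ m) (\<lambda>i. f (e i))) = vec (2 ^ m) (\<lambda>i. F Q f (e i))"
    using assms(1) unfolding implements_def by blast
  ultimately show ?thesis unfolding implements_def by (intro exI[of _ L]) simp
qed

lemma implements_fixed:
  assumes "uop E U" "bij_betw e {..<2 ^ m} E"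
  shows "implements m q e 0 (\<lambda>_. U)"
  unfolding implements_def
  by (rule exI[of _ "[Fixed (uop_to_mat (2 ^ m) e U)]"])
    (simp add: uop_to_mat_unitary[OF assms] uop_to_mat_mult_vec[OF assms])

text \<open>Two encodings differ by a permutation of basis states, a fixed unitary that costs no
  query. Every query may therefore be analysed in the layout that suits it.\<close>

lemma implements_reencode:
  assumes F: "implements m q e' t F" and e: "bij_betw e {..<2 ^ m} E" and e': "bij_betw e' {..<2 ^ m} E"
  shows "implements m q e t F"
proof -
  obtain L where L: "\<forall>s\<in>set L. valid_step m q s" "length (filter is_query L) \<le> t"
    "\<And>Q f. \<forall>b. unitary_mat (2 ^ q b) (Q b) \<Longrightarrow>
      run_steps m q Q L (vec (2 ^ m) (\<lambda>i. f (e' i))) = vec (2 ^ m) (\<lambda>i. F Q f (e' i))"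
    using F unfolding implements_def by blast
  let ?inv = "inv_into {..<2 ^ m} e" and ?inv' = "inv_into {..<2 ^ m} e'"
  let ?U = "\<lambda>f x. f (e' (?inv x))" and ?V = "\<lambda>f x. f (e (?inv' x))"
  have U: "uop E ?U" using bij_betw_trans[OF bij_betw_inv_into[OF e] e'] by (intro uop_perm) (simp add: comp_def)
  have V: "uop E ?V" using bij_betw_trans[OF bij_betw_inv_into[OF e'] e] by (intro uop_perm) (simp add: comp_def)
  have 1: "uop_to_mat (2 ^ m) e ?U *\<^sub>v vec (2 ^ m) (\<lambda>i. f (e i)) = vec (2 ^ m) (\<lambda>i. f (e' i))" for f
    unfolding uop_to_mat_mult_vec[OF U e] using bij_betw_inv_into_left[OF e] by (intro eq_vecI) auto
  have 2: "uop_to_mat (2 ^ m) e' ?V *\<^sub>v vec (2 ^ m) (\<lambda>i. f (e' i)) = vec (2 ^ m) (\<lambda>i. f (e i))" for f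
    unfolding uop_to_mat_mult_vec[OF V e'] using bij_betw_inv_into_left[OF e'] by (intro eq_vecI) auto
  show ?thesis unfolding implements_def
    by (rule exI[of _ "Fixed (uop_to_mat (2 ^ m) e ?U) # L @ [Fixed (uop_to_mat (2 ^ m) e' ?V)]"])
      (use L in \<open>auto simp: uop_to_mat_unitary[OF U e] uop_to_mat_unitary[OF V e'] 1 2\<close>)
qed

section \<open>Block indices and the action of a controlled query\<close>

lemma sum_mult_split: "(\<Sum>k<P * N. g k) = (\<Sum>r<P. \<Sum>s<N. g (r * N + s))" for g :: "nat \<Rightarrow> 'a::comm_monoid_add"
proof -
  have "(\<Sum>k<P * N. g k) = (\<Sum>r<P. sum g {r * N..<r * N + N})" by (simp add: sum.nat_group)
  moreover have "sum g {k..<k + N} = (\<Sum>s<N. g (k + s))" for k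
    using sum.shift_bounds_nat_ivl[of g 0 k N] by (simp add: atLeast0LessThan add.commute)
  ultimately show ?thesis by simp
qed

lemma block_index_less:
  fixes r s P N :: nat
  assumes "r < P" "s < N"
  shows "r * N + s < P * N"
proof -
  have "r * N + s < Suc r * N" using assms by simp
  also have "\<dots> \<le> P * N" using assms by (intro mult_le_mono1) simp
  finally show ?thesis .
qed

lemma tensor_one_mult_vec:
  assumes W: "W \<in> carrier_mat N N" and v: "v \<in> carrier_vec (P * N)" and i: "i < P * N"
  shows "(tensor_mat (1\<^sub>m P) W *\<^sub>v v) $ i = (\<Sum>s<N. W $$ (i mod N, s) * v $ (i div N * N + s))"
proof -
  have N: "N > 0" using i by (cases N) auto
  have iN: "i div N < P" using i N by (simp add: div_less_iff_less_mult)
  have T: "tensor_mat (1\<^sub>m P) W \<in> carrier_mat (P * N) (P * N)" using W by (auto simp: tensor_mat_def)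
  have "(tensor_mat (1\<^sub>m P) W *\<^sub>v v) $ i
      = (\<Sum>r<P. \<Sum>s<N. tensor_mat (1\<^sub>m P) W $$ (i, r * N + s) * v $ (r * N + s))"
    unfolding mult_mat_vec_index[OF T v i] by (rule sum_mult_split)
  also have "\<dots> = (\<Sum>r<P. if r = i div N then \<Sum>s<N. W $$ (i mod N, s) * v $ (i div N * N + s) else 0)"
  proof (rule sum.cong[OF refl])
    fix r assume r: "r \<in> {..<P}"
    have "tensor_mat (1\<^sub>m P) W $$ (i, r * N + s) = (if r = i div N then W $$ (i mod N, s) else 0)" if "s < N" for s
    proof -
      have "r * N + s < P * N" using r that by (intro block_index_less) auto
      then show ?thesis using W i r that N iN by (auto simp: tensor_mat_def)
    qed
    then show "(\<Sum>s<N. tensor_mat (1\<^sub>m P) W $$ (i, r * N + s) * v $ (r * N + s))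
      = (if r = i div N then \<Sum>s<N. W $$ (i mod N, s) * v $ (i div N * N + s) else 0)"
      by simp
  qed
  also have "\<dots> = (\<Sum>s<N. W $$ (i mod N, s) * v $ (i div N * N + s))" using iN by simp
  finally show ?thesis .
qed

lemma controlled_mat_index:
  assumes "V \<in> carrier_mat N N" "x < 2 * N" "y < 2 * N"
  shows "controlled_mat V $$ (x, y) =
    (if x < N \<or> y < N then if x = y then 1 else 0 else V $$ (x - N, y - N))"
  using assms by (auto simp: controlled_mat_def)

lemma controlled_mat_sum:
  assumes V: "V \<in> carrier_mat N N" and x: "x < 2 * N"
  shows "(\<Sum>s<2 * N. controlled_mat V $$ (x, s) * g s)
    = (if x < N then g x else \<Sum>j<N. V $$ (x - N, j) * g (N + j))"
proof -
  have "(\<Sum>s<2 * N. controlled_mat V $$ (x, s) * g s)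
      = (\<Sum>s<N. controlled_mat V $$ (x, s) * g s) + (\<Sum>j<N. controlled_mat V $$ (x, N + j) * g (N + j))"
    using sum_mult_split[of "\<lambda>s. controlled_mat V $$ (x, s) * g s" 2 N] by (simp add: numeral_2_eq_2)
  also have "(\<Sum>s<N. controlled_mat V $$ (x, s) * g s) = (\<Sum>s<N. if s = x then g s else 0)"
    by (intro sum.cong refl) (auto simp: controlled_mat_index[OF V x])
  also have "\<dots> = (if x < N then g x else 0)" by simp
  also have "(\<Sum>j<N. controlled_mat V $$ (x, N + j) * g (N + j))
      = (if x < N then 0 else \<Sum>j<N. V $$ (x - N, j) * g (N + j))"
    by (auto simp: controlled_mat_index[OF V x] intro!: sum.neutral sum.cong)
  finally show ?thesis by auto
qed

lemma bij_betw_div_mod: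
  fixes N :: nat
  assumes "N > 0"
  shows "bij_betw (\<lambda>i. (i div N, i mod N)) {..<P * N} ({..<P} \<times> {..<N})"
proof (rule bij_betw_byWitness[where f' = "\<lambda>(r, s). r * N + s"])
qed (use assms in \<open>auto simp: less_mult_imp_div_less block_index_less\<close>)

text \<open>The map \<phi> reads an index as (rest, control, target). The control may thus be any
  yes/no property of the index, such as the identity of the selected box, and the rest may include
  spare ancillas.\<close>

definition ctrl_query ::
  "'i set \<Rightarrow> ('i \<Rightarrow> 'r \<times> bool \<times> nat) \<Rightarrow> complex mat \<Rightarrow> 'i transform" where
  "ctrl_query E \<phi> V f x = (case \<phi> x of (r, c, i) \<Rightarrow>
     if c then \<Sum>j<dim_row V. V $$ (i, j) * f (inv_into E \<phi> (r, True, j)) else f x)"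

text \<open>A query acts on the last qubits, its control being just before them. The encoding
  \<open>e'\<close> is built so that the quotient by 2N, the top bit of the remainder and the
  remaining bits are the three components of \<phi>; re-encoding does the rest.\<close>

lemma implements_controlled_query:
  fixes \<phi> :: "'i \<Rightarrow> 'r \<times> bool \<times> nat"
  assumes e: "bij_betw e {..<2 ^ m} E" and \<phi>: "bij_betw \<phi> E (R \<times> UNIV \<times> {..<2 ^ q b})"
  shows "implements m q e 1 (\<lambda>Q. ctrl_query E \<phi> (if adj then mat_adjoint (Q b) else Q b))"
proof -
  let ?N = "2 ^ q b :: nat"
  have finE: "finite E" and cardE: "card E = 2 ^ m"
    using bij_betw_finite[OF e] bij_betw_same_card[OF e] by auto
  have "finite (R \<times> (UNIV :: bool set) \<times> {..<?N})" using bij_betw_finite[OF \<phi>] finE by simp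
  then have finR: "finite R" by (rule finite_cartesian_productD1) (simp add: lessThan_empty_iff)
  have cR: "card R * (2 * ?N) = 2 ^ m"
    using bij_betw_same_card[OF \<phi>] cardE by (simp add: card_cartesian_product)
  then have "2 ^ Suc (q b) dvd (2 ^ m :: nat)" by (metis dvd_triv_right power_Suc)
  then have qm: "Suc (q b) \<le> m" by (simp add: power_dvd_imp_le)
  define P :: nat where "P = 2 ^ (m - Suc (q b))"
  have Pm: "P * (2 * ?N) = 2 ^ m" using qm power_add[of "2::nat" "m - Suc (q b)" "Suc (q b)"] by (simp add: P_def)
  then have "card R = P" using cR by (metis mult_cancel2 zero_less_power pos2 mult_pos_pos less_numeral_extra(3))
  then obtain h where h: "bij_betw h {..<P} R"
    using ex_bij_betw_nat_finite[OF finR] by (auto simp: atLeast0LessThan)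
  define st where "st i = (h (i div (2 * ?N)), \<not> i mod (2 * ?N) < ?N, i mod ?N)" for i
  have st: "bij_betw st {..<2 ^ m} (R \<times> UNIV \<times> {..<?N})"
  proof -
    have 1: "bij_betw (\<lambda>i. (i div (2 * ?N), i mod (2 * ?N))) {..<2 ^ m} ({..<P} \<times> {..<2 * ?N})"
      using bij_betw_div_mod[of "2 * ?N" P] Pm by simp
    have 2: "bij_betw (\<lambda>x. (\<not> x < ?N, x mod ?N)) {..<2 * ?N} (UNIV \<times> {..<?N})"
      by (rule bij_betw_byWitness[where f' = "\<lambda>(c, x). if c then ?N + x else x"])
        (auto simp: mod_if not_less split: if_splits)
    have 3: "bij_betw (map_prod h (\<lambda>x. (\<not> x < ?N, x mod ?N))) ({..<P} \<times> {..<2 * ?N}) (R \<times> UNIV \<times> {..<?N})"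
      by (rule bij_betw_map_prod[OF h 2])
    have "map_prod h (\<lambda>x. (\<not> x < ?N, x mod ?N)) \<circ> (\<lambda>i. (i div (2 * ?N), i mod (2 * ?N))) = st"
      by (auto simp: st_def fun_eq_iff mod_mod_cancel)
    then show ?thesis using bij_betw_trans[OF 1 3] by simp
  qed
  define e' where "e' i = inv_into E \<phi> (st i)" for i
  have e': "bij_betw e' {..<2 ^ m} E"
    using bij_betw_trans[OF st bij_betw_inv_into[OF \<phi>]] by (simp add: comp_def e'_def[abs_def])
  have "implements m q e' 1 (\<lambda>Q. ctrl_query E \<phi> (if adj then mat_adjoint (Q b) else Q b))"
    unfolding implements_def
  proof (rule exI[of _ "[Query b adj True]"], intro conjI allI impI)
    fix Q :: "black_box \<Rightarrow> complex mat" and f :: "'i \<Rightarrow> complex"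
    assume Q: "\<forall>b. unitary_mat (2 ^ q b) (Q b)"
    define V where "V = (if adj then mat_adjoint (Q b) else Q b)"
    have V: "V \<in> carrier_mat ?N ?N" using Q by (auto simp: V_def unitary_mat_def)
    have W: "controlled_mat V \<in> carrier_mat (2 * ?N) (2 * ?N)"
      using V by (auto simp: controlled_mat_def mult_2)
    let ?out = "vec (2 ^ m) (\<lambda>i. ctrl_query E \<phi> V f (e' i))"
    let ?in = "vec (2 ^ m) (\<lambda>i. f (e' i))"
    have "step_mat m q Q (Query b adj True) *\<^sub>v ?in
        = ?out"
    proof (rule eq_vecI)
      fix i assume "i < dim_vec (?out)"
      then have i: "i < P * (2 * ?N)" using Pm by simp
      let ?x = "i mod (2 * ?N)" and ?d = "i div (2 * ?N)"
      have x: "?x < 2 * ?N" by simp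
      have d: "?d < P" using i by (simp add: less_mult_imp_div_less)
      have lt: "?d * (2 * ?N) + s < P * (2 * ?N)" if "s < 2 * ?N" for s
        using d that by (rule block_index_less)
      have "(step_mat m q Q (Query b adj True) *\<^sub>v ?in) $ i
         = (\<Sum>s<2 * ?N. controlled_mat V $$ (?x, s) * ?in $ (?d * (2 * ?N) + s))"
        using tensor_one_mult_vec[OF W _ i, of "?in"] Pm
        by (simp add: Let_def V_def[symmetric] P_def)
      also have "\<dots> = (\<Sum>s<2 * ?N. controlled_mat V $$ (?x, s) * f (e' (?d * (2 * ?N) + s)))"
        using lt unfolding Pm by (intro sum.cong refl) simp
      also have "\<dots> = (if ?x < ?N then f (e' (?d * (2 * ?N) + ?x))
          else \<Sum>j<?N. V $$ (?x - ?N, j) * f (e' (?d * (2 * ?N) + (?N + j))))"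
        by (rule controlled_mat_sum[OF V x])
      also have "\<dots> = ctrl_query E \<phi> V f (e' i)"
      proof -
        have "st i \<in> \<phi> ` E" using st \<phi> i Pm unfolding bij_betw_def by (metis image_eqI lessThan_iff)
        then have \<phi>e: "\<phi> (e' i) = st i" unfolding e'_def by (rule f_inv_into_f)
        have st': "st (?d * (2 * ?N) + (?N + j)) = (h ?d, True, j)" if "j < ?N" for j
        proof -
          have "?d * (2 * ?N) + (?N + j) = (?N + j) + ?d * (2 * ?N)" by simp
          moreover have "(?N + j) div (2 * ?N) = 0" "(?N + j) mod (2 * ?N) = ?N + j" using that by simp_all
          moreover have "((?N + j) + ?d * (2 * ?N)) mod ?N = j"
            using that by (metis mod_add_self1 mod_less mod_mult_self1 mult.assoc mult.commute)
          ultimately show ?thesis unfolding st_def by (simp only: div_mult_self3 mod_mult_self1) simp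
        qed
        have "?x - ?N = i mod ?N" if "\<not> ?x < ?N"
        proof -
          have "i mod ?N = ?x mod ?N" by (rule mod_mod_cancel[symmetric]) simp
          also have "\<dots> = (?x - ?N) mod ?N" by (rule le_mod_geq) (use that in linarith)
          also have "\<dots> = ?x - ?N" by (rule mod_less) (use that x in linarith)
          finally show ?thesis by (rule sym)
        qed
        moreover have "e' (?d * (2 * ?N) + (?N + j)) = inv_into E \<phi> (h ?d, True, j)" if "j < ?N" for j
          unfolding e'_def st'[OF that] ..
        moreover have "?d * (2 * ?N) + ?x = i" by (rule div_mult_mod_eq)
        ultimately show ?thesis
          unfolding ctrl_query_def \<phi>e st_def using V by simp
      qed
      finally show "(step_mat m q Q (Query b adj True) *\<^sub>v ?in) $ i
        = ?out $ i" using i Pm by simp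
    qed (use W Pm in \<open>simp add: Let_def V_def[symmetric] tensor_mat_def P_def\<close>)
    then show "fold (\<lambda>s. (*\<^sub>v) (step_mat m q Q s)) [Query b adj True] (?in) =
       vec (2 ^ m) (\<lambda>i. ctrl_query E \<phi> (if adj then mat_adjoint (Q b) else Q b) f (e' i))"
      by (simp add: V_def)
  qed (use qm in auto)
  then show ?thesis by (rule implements_reencode[OF _ e e'])
qed

section \<open>Controlled preparation of the purifications\<close>

lemma ip_Times: "ip (A \<times> E) f g = (\<Sum>a\<in>A. ip E (\<lambda>x. f (a, x)) (\<lambda>x. g (a, x)))"
  unfolding ip_def sum.cartesian_product by (simp add: case_prod_unfold)

lemma uop_block:
  assumes "\<And>a. a \<in> A \<Longrightarrow> uop E (U a)"
  shows "uop (A \<times> E) (\<lambda>f (a, x). U a (\<lambda>x'. f (a, x')) x)"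
proof (rule uopI)
  fix f g :: "'a \<times> 'b \<Rightarrow> complex" and p
  assume "\<And>y. y \<in> A \<times> E \<Longrightarrow> f y = g y" "p \<in> A \<times> E"
  then show "(\<lambda>(a, x). U a (\<lambda>x'. f (a, x')) x) p = (\<lambda>(a, x). U a (\<lambda>x'. g (a, x')) x) p"
    by (auto intro!: uop_cong[OF assms])
next
  fix f g :: "'a \<times> 'b \<Rightarrow> complex"
  show "ip (A \<times> E) (\<lambda>(a, x). U a (\<lambda>x'. f (a, x')) x) (\<lambda>(a, x). U a (\<lambda>x'. g (a, x')) x) = ip (A \<times> E) f g"
    unfolding ip_Times by (intro sum.cong refl) (simp add: uop_ip[OF assms])
qed (auto intro: uop_add[OF assms] uop_scale[OF assms])

lemma uop_fst_factor:
  assumes "uop A U"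
  shows "uop (A \<times> E) (\<lambda>f (a, x). U (\<lambda>a'. f (a', x)) a)"
proof (rule uopI)
  fix f g :: "'a \<times> 'b \<Rightarrow> complex" and p
  assume "\<And>y. y \<in> A \<times> E \<Longrightarrow> f y = g y" "p \<in> A \<times> E"
  then show "(\<lambda>(a, x). U (\<lambda>x'. f (x', x)) a) p = (\<lambda>(a, x). U (\<lambda>x'. g (x', x)) a) p"
    by (auto intro!: uop_cong[OF assms])
next
  fix f g :: "'a \<times> 'b \<Rightarrow> complex"
  have *: "ip (A \<times> E) f g = (\<Sum>x\<in>E. ip A (\<lambda>a. f (a, x)) (\<lambda>a. g (a, x)))" for f g
    unfolding ip_Times unfolding ip_def by (rule sum.swap)
  show "ip (A \<times> E) (\<lambda>(a, x). U (\<lambda>x'. f (x', x)) a) (\<lambda>(a, x). U (\<lambda>x'. g (x', x)) a) = ip (A \<times> E) f g"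
    unfolding * by (intro sum.cong refl) (simp add: uop_ip[OF assms])
qed (auto intro: uop_add[OF assms] uop_scale[OF assms])

context
  fixes E :: "'i set" and \<phi> :: "'i \<Rightarrow> 'r \<times> bool \<times> nat" and R N
  assumes \<phi>: "bij_betw \<phi> E (R \<times> UNIV \<times> {..<N})"
begin

lemma ctrl_query_inv:
  assumes "r \<in> R" "i < N" "dim_row V = N"
  shows "ctrl_query E \<phi> V f (inv_into E \<phi> (r, c, i)) =
    (if c then \<Sum>j<N. V $$ (i, j) * f (inv_into E \<phi> (r, True, j)) else f (inv_into E \<phi> (r, False, i)))"
proof -
  have "\<phi> (inv_into E \<phi> (r, c, i)) = (r, c, i)"
    by (rule f_inv_into_f) (use \<phi> assms in \<open>auto simp: bij_betw_def\<close>)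
  then show ?thesis using assms by (cases c) (simp_all add: ctrl_query_def)
qed

lemma ip_via_bij:
  "ip E f g = (\<Sum>r\<in>R. \<Sum>c\<in>UNIV. \<Sum>i<N. cnj (f (inv_into E \<phi> (r, c, i))) * g (inv_into E \<phi> (r, c, i)))"
  unfolding ip_def
  using sum.reindex_bij_betw[OF bij_betw_inv_into[OF \<phi>], of "\<lambda>x. cnj (f x) * g x"]
  by (simp add: sum.cartesian_product case_prod_unfold)

lemma eq_via_bij:
  assumes "\<And>r c i. r \<in> R \<Longrightarrow> i < N \<Longrightarrow> f (inv_into E \<phi> (r, c, i)) = g (inv_into E \<phi> (r, c, i))" "x \<in> E"
  shows "f x = g x"
proof -
  obtain r c i where "\<phi> x = (r, c, i)" by (metis prod.exhaust)
  moreover have "\<phi> x \<in> R \<times> UNIV \<times> {..<N}" using \<phi> assms(2) by (rule bij_betw_apply)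
  moreover have "x = inv_into E \<phi> (\<phi> x)" using bij_betw_inv_into_left[OF \<phi> assms(2)] by simp
  ultimately show ?thesis using assms(1)[of r i c] by simp
qed

lemma uop_ctrl_query:
  assumes V: "unitary_mat N V"
  shows "uop E (ctrl_query E \<phi> V)"
proof (rule uopI)
  have d: "dim_row V = N" using V by (auto simp: unitary_mat_def)
  fix f g :: "'i \<Rightarrow> complex" and c :: complex and x
  show "ctrl_query E \<phi> V f x = ctrl_query E \<phi> V g x"
    if h: "\<And>y. y \<in> E \<Longrightarrow> f y = g y" and x: "x \<in> E"
  proof (rule eq_via_bij[OF _ x])
    have I: "inv_into E \<phi> (r, c, i) \<in> E" if "r \<in> R" "i < N" for r c i
      using that \<phi> by (auto simp: bij_betw_def intro!: inv_into_into)
    fix r c i assume "r \<in> R" "i < N"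
    then show "ctrl_query E \<phi> V f (inv_into E \<phi> (r, c, i)) = ctrl_query E \<phi> V g (inv_into E \<phi> (r, c, i))"
      using h I by (simp add: ctrl_query_inv d)
  qed
  show "ctrl_query E \<phi> V (\<lambda>y. f y + g y) x = ctrl_query E \<phi> V f x + ctrl_query E \<phi> V g x"
    by (simp add: ctrl_query_def algebra_simps sum.distrib split: prod.split)
  show "ctrl_query E \<phi> V (\<lambda>y. c * f y) x = c * ctrl_query E \<phi> V f x"
    by (simp add: ctrl_query_def sum_distrib_left mult_ac split: prod.split)
  show "ip E (ctrl_query E \<phi> V f) (ctrl_query E \<phi> V g) = ip E f g"
    unfolding ip_via_bij
  proof (rule sum.cong[OF refl], rule sum.cong[OF refl])
    fix r c assume r: "r \<in> R"
    have "(\<Sum>i<N. cnj (\<Sum>j<N. V $$ (i, j) * f (inv_into E \<phi> (r, True, j))) * (\<Sum>j<N. V $$ (i, j) * g (inv_into E \<phi> (r, True, j))))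
      = (\<Sum>i<N. cnj (f (inv_into E \<phi> (r, True, i))) * g (inv_into E \<phi> (r, True, i)))"
      using uop_ip[OF uop_mat[OF V], of "\<lambda>j. f (inv_into E \<phi> (r, True, j))" "\<lambda>j. g (inv_into E \<phi> (r, True, j))"]
      unfolding ip_def .
    then show "(\<Sum>i<N. cnj (ctrl_query E \<phi> V f (inv_into E \<phi> (r, c, i))) * ctrl_query E \<phi> V g (inv_into E \<phi> (r, c, i)))
      = (\<Sum>i<N. cnj (f (inv_into E \<phi> (r, c, i))) * g (inv_into E \<phi> (r, c, i)))"
      using r d by (cases c) (simp_all add: ctrl_query_inv)
  qed
qed

lemma ctrl_query_adjoint:
  assumes V: "unitary_mat N V" and x: "x \<in> E"
  shows "ctrl_query E \<phi> V (ctrl_query E \<phi> (mat_adjoint V) f) x = f x"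
proof (rule eq_via_bij[OF _ x])
  fix r c i assume r: "r \<in> R" "i < N"
  have d: "dim_row V = N" "dim_col V = N" using V by (auto simp: unitary_mat_def)
  let ?F = "\<lambda>j. f (inv_into E \<phi> (r, True, j))"
  have "(\<Sum>j<N. V $$ (i, j) * (\<Sum>k<N. mat_adjoint V $$ (j, k) * ?F k))
     = (\<Sum>j<N. \<Sum>k<N. ?F k * (V $$ (i, j) * cnj (V $$ (k, j))))"
    using d by (intro sum.cong refl) (simp add: sum_distrib_left mult_ac)
  also have "\<dots> = (\<Sum>k<N. ?F k * (\<Sum>j<N. V $$ (i, j) * cnj (V $$ (k, j))))"
    by (subst sum.swap) (simp add: sum_distrib_left)
  also have "\<dots> = (\<Sum>k<N. ?F k * (if i = k then 1 else 0))"
    by (intro sum.cong refl) (simp add: unitary_mat_row[OF V r(2)])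
  also have "\<dots> = ?F i" using r by (simp add: if_distrib[of "\<lambda>x. _ * x"] cong: if_cong)
  finally show "ctrl_query E \<phi> V (ctrl_query E \<phi> (mat_adjoint V) f) (inv_into E \<phi> (r, c, i))
     = f (inv_into E \<phi> (r, c, i))"
    using r d by (cases c) (simp_all add: ctrl_query_inv)
qed

end

lemma UNIV_black_box: "(UNIV :: black_box set) = {Box0, Box1}"
  using black_box.exhaust by auto

lemma sum_black_box: "(\<Sum>b\<in>UNIV. f b) = f Box0 + f Box1" for f :: "black_box \<Rightarrow> 'a::comm_monoid_add"
  by (simp add: UNIV_black_box)

definition half_amp :: complex where "half_amp = of_real (1 / sqrt 2)"

lemma half_amp_sq: "half_amp * half_amp = 1 / 2"
  by (simp add: half_amp_def flip: of_real_mult)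

lemma cnj_half_amp [simp]: "cnj half_amp = half_amp"
  by (simp add: half_amp_def)

text \<open>
  A purification register holds (b, i, e): a qubit b selecting the black box, the system i, and an
  ancilla index e from a range large enough for both black boxes. A work index (l, j, g, h) adds
  a clock l and the index j of a term of the expansion to two purification registers: the state whose
  trace is estimated and the fresh copy used by the walk.
\<close>
type_synonym purif_index = "black_box \<times> nat \<times> nat"
type_synonym pair_index = "purif_index \<times> purif_index"
type_synonym term_index = "nat \<times> pair_index"
type_synonym work_index = "nat \<times> term_index"
type_synonym boxes = "black_box \<Rightarrow> complex mat"

locale purification_setup =
  fixes n :: nat and a :: "black_box \<Rightarrow> nat"
begin

definition anc :: nat where "anc = a Box0 + a Box1"

lemma a_le_anc: "a b \<le> anc" by (cases b) (simp_all add: anc_def)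

definition G :: "purif_index set" where "G = UNIV \<times> {..<2 ^ n} \<times> {..<2 ^ anc}"

lemma finite_G: "finite G" by (simp add: G_def UNIV_black_box)

lemma card_G: "card G = 2 ^ (1 + n + anc)"
  by (simp add: G_def card_cartesian_product UNIV_black_box power_add)

text \<open>The selecting qubit is itself the control, with value true on the branch of box
  \<open>b\<close>. Box \<open>b\<close> uses only the low part of the common ancilla index; the
  high part belongs to the rest.\<close>

definition query_index :: "black_box \<Rightarrow> purif_index \<Rightarrow> nat \<times> bool \<times> nat" where
  "query_index b = (\<lambda>(b', i, e). (e div 2 ^ a b, b' = b, i * 2 ^ a b + e mod 2 ^ a b))"

fun other :: "black_box \<Rightarrow> black_box" where "other Box0 = Box1" | "other Box1 = Box0"

definition query_unindex :: "black_box \<Rightarrow> nat \<times> bool \<times> nat \<Rightarrow> purif_index" where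
  "query_unindex b = (\<lambda>(r, c, x). (if c then b else other b, x div 2 ^ a b, r * 2 ^ a b + x mod 2 ^ a b))"

lemma other_neq: "b' \<noteq> b \<Longrightarrow> other b = b'" by (cases b; cases b') auto
lemma other_neq': "other b \<noteq> b" by (cases b) auto

lemma query_unindex_index: "query_unindex b (query_index b g) = g"
  by (cases g) (auto simp: query_unindex_def query_index_def other_neq div_mult_mod_eq)

lemma query_index_unindex: "query_index b (query_unindex b y) = y"
  by (cases y) (auto simp: query_unindex_def query_index_def other_neq' div_mult_mod_eq)

lemma bij_query_index: "bij_betw (query_index b) G ({..<2 ^ (anc - a b)} \<times> UNIV \<times> {..<2 ^ (n + a b)})"
proof (rule bij_betw_byWitness[where f' = "query_unindex b"])
  have p: "(2::nat) ^ anc = 2 ^ (anc - a b) * 2 ^ a b" using a_le_anc[of b] by (simp flip: power_add)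
  have p': "(2::nat) ^ (n + a b) = 2 ^ n * 2 ^ a b" by (simp add: power_add)
  show "query_index b ` G \<subseteq> {..<2 ^ (anc - a b)} \<times> UNIV \<times> {..<2 ^ (n + a b)}"
    unfolding p' by (auto simp: G_def query_index_def p less_mult_imp_div_less intro!: block_index_less)
  show "query_unindex b ` ({..<2 ^ (anc - a b)} \<times> UNIV \<times> {..<2 ^ (n + a b)}) \<subseteq> G"
    unfolding p' by (auto simp: G_def query_unindex_def p less_mult_imp_div_less intro!: block_index_less)
qed (simp_all add: query_unindex_index query_index_unindex)

lemma inv_query_index:
  assumes "r < 2 ^ (anc - a b)" "j < 2 ^ (n + a b)"
  shows "inv_into G (query_index b) (r, c, j) = query_unindex b (r, c, j)"
proof -
  have "query_unindex b (r, c, j) \<in> G"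
  proof -
    have p: "(2::nat) ^ anc = 2 ^ (anc - a b) * 2 ^ a b" using a_le_anc[of b] by (simp flip: power_add)
    show ?thesis using assms
      by (auto simp: G_def query_unindex_def p power_add less_mult_imp_div_less intro!: block_index_less)
  qed
  then have "inv_into G (query_index b) (query_index b (query_unindex b (r, c, j))) = query_unindex b (r, c, j)"
    by (rule bij_betw_inv_into_left[OF bij_query_index])
  then show ?thesis by (simp only: query_index_unindex)
qed

abbreviation "cq b \<equiv> ctrl_query G (query_index b)"

definition prep :: "boxes \<Rightarrow> purif_index transform" where
  "prep Q f = cq Box1 (Q Box1) (cq Box0 (Q Box0) f)"

definition unprep :: "boxes \<Rightarrow> purif_index transform" where
  "unprep Q f = cq Box0 (mat_adjoint (Q Box0)) (cq Box1 (mat_adjoint (Q Box1)) f)"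

definition init :: "purif_index \<Rightarrow> complex" where
  "init = (\<lambda>(b, i, e). if i = 0 \<and> e = 0 then half_amp else 0)"

text \<open>The state (|0> Q0|0> + |1> Q1|0>)/sqrt 2, the ancillas beyond those of the selected box
  being 0.\<close>

definition chi :: "boxes \<Rightarrow> purif_index \<Rightarrow> complex" where
  "chi Q = (\<lambda>(b, i, e). if e < 2 ^ a b then Q b $$ (i * 2 ^ a b + e, 0) * half_amp else 0)"

lemma ip_G: "ip G f g = (\<Sum>b\<in>UNIV. \<Sum>i<2 ^ n. \<Sum>e<2 ^ anc. cnj (f (b, i, e)) * g (b, i, e))"
  unfolding G_def ip_Times unfolding ip_def ..

lemma ip_init: "ip G init init = 1"
proof -
  have "(\<Sum>i<2 ^ n. \<Sum>e<2 ^ anc. cnj (init (b, i, e)) * init (b, i, e)) = 1 / 2" for b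
  proof -
    have "cnj (init (b, i, e)) * init (b, i, e) = (if i = 0 then if e = 0 then 1 / 2 else 0 else 0)" for i e
      using half_amp_sq by (auto simp: init_def)
    then have "(\<Sum>e<2 ^ anc. cnj (init (b, i, e)) * init (b, i, e)) = (if i = 0 then 1 / 2 else 0)" for i
      by (cases "i = 0") simp_all
    then show ?thesis by simp
  qed
  then show ?thesis unfolding ip_G sum_black_box by (simp only:) simp
qed

context
  fixes Q :: "boxes"
  assumes Q: "\<And>b. unitary_mat (2 ^ (n + a b)) (Q b)"
begin

lemma uop_prep: "uop G (prep Q)" and uop_unprep: "uop G (unprep Q)"
  unfolding prep_def[abs_def] unprep_def[abs_def]
  by (rule uop_comp[OF uop_ctrl_query[OF bij_query_index] uop_ctrl_query[OF bij_query_index]];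
      simp add: Q unitary_mat_adjoint)+

lemma prep_unprep: "g \<in> G \<Longrightarrow> prep Q (unprep Q f) g = f g"
  unfolding prep_def unprep_def
  using uop_cong[OF uop_ctrl_query[OF bij_query_index Q, of Box1] ctrl_query_adjoint[OF bij_query_index Q, of _ Box0]]
    ctrl_query_adjoint[OF bij_query_index Q, of _ Box1] by simp

text \<open>Agreement with \<open>init\<close> is demanded only on the branch of \<open>b\<close>,
  so that the lemma still applies to the second box after the other branch has been changed.\<close>

lemma cq_init:
  assumes g: "(b', i, e) \<in> G" and f: "\<And>i e. f (b, i, e) = init (b, i, e)"
  shows "cq b (Q b) f (b', i, e) = (if b' = b then chi Q (b, i, e) else f (b', i, e))"
proof -
  have d: "dim_row (Q b) = 2 ^ (n + a b)" using Q[of b] by (auto simp: unitary_mat_def)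
  have p: "(2::nat) ^ anc = 2 ^ (anc - a b) * 2 ^ a b" using a_le_anc[of b] by (simp flip: power_add)
  have r: "e div 2 ^ a b < 2 ^ (anc - a b)" using g by (auto simp: G_def p less_mult_imp_div_less)
  let ?x = "i * 2 ^ a b + e mod 2 ^ a b"
  have "(\<Sum>j<2 ^ (n + a b). Q b $$ (?x, j) * f (inv_into G (query_index b) (e div 2 ^ a b, True, j)))
      = (\<Sum>j<(2::nat) ^ (n + a b). if j = 0 then chi Q (b, i, e) else 0)"
  proof (rule sum.cong[OF refl])
    fix j :: nat assume "j \<in> {..<2 ^ (n + a b)}"
    then have "f (inv_into G (query_index b) (e div 2 ^ a b, True, j))
       = init (b, j div 2 ^ a b, e div 2 ^ a b * 2 ^ a b + j mod 2 ^ a b)"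
      using r by (simp add: inv_query_index query_unindex_def f)
    also have "\<dots> = (if j = 0 \<and> e < 2 ^ a b then half_amp else 0)"
      by (auto simp: init_def div_eq_0_iff dest: mod_eq_self_iff_div_eq_0[THEN iffD2])
    finally show "Q b $$ (?x, j) * f (inv_into G (query_index b) (e div 2 ^ a b, True, j))
        = (if j = 0 then chi Q (b, i, e) else 0)"
      by (auto simp: chi_def)
  qed
  then show ?thesis
    by (auto simp: ctrl_query_def query_index_def d)
qed

lemma prep_init: "g \<in> G \<Longrightarrow> prep Q init g = chi Q g"
proof -
  assume g: "g \<in> G"
  obtain b i e where gg: "g = (b, i, e)" by (metis prod.exhaust)
  let ?f = "\<lambda>(b, i, e). if b = Box0 then chi Q (b, i, e) else init (b, i, e)"
  have "prep Q init g = cq Box1 (Q Box1) ?f g"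
    unfolding prep_def
  proof (rule uop_cong[OF uop_ctrl_query[OF bij_query_index Q] _ g])
    fix y assume "y \<in> G"
    then show "cq Box0 (Q Box0) init y = ?f y" by (cases y) (auto simp: cq_init)
  qed
  also have "\<dots> = chi Q g" using g unfolding gg by (cases b) (auto simp: cq_init)
  finally show ?thesis .
qed

lemma ip_chi: "ip G (chi Q) (chi Q) = 1"
  using uop_ip[OF uop_prep, of init init] ip_init
    ip_cong[of G "prep Q init" "chi Q" "prep Q init" "chi Q"] prep_init by simp

end

lemma chi_reduced_state:
  assumes "prepares_purification n (a b) (Q b) (\<rho> b)" "i < 2 ^ n" "j < 2 ^ n"
  shows "(\<Sum>e<2 ^ anc. chi Q (b, i, e) * cnj (chi Q (b, j, e))) = \<rho> b $$ (i, j) / 2"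
proof -
  let ?N = "2 ^ (n + a b) :: nat"
  let ?q = "\<lambda>e. Q b $$ (i * 2 ^ a b + e, 0) * cnj (Q b $$ (j * 2 ^ a b + e, 0))"
  have U: "Q b \<in> carrier_mat ?N ?N" using assms by (auto simp: prepares_purification_def unitary_mat_def)
  have v: "(Q b *\<^sub>v zero_state (n + a b)) $ x = Q b $$ (x, 0)" if "x < ?N" for x
    using mult_mat_vec_index[OF U _ that, of "zero_state (n + a b)"]
    by (simp add: zero_state_def unit_vec_def if_distrib[of "\<lambda>x. _ * x"] sum.delta cong: if_cong)
  have lt: "i * 2 ^ a b + e < ?N" if "i < 2 ^ n" "e < 2 ^ a b" for i e
    unfolding power_add using that by (rule block_index_less)
  have "\<rho> b $$ (i, j) = (\<Sum>e<2 ^ a b. ?q e)"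
    using assms U lt v by (auto simp: prepares_purification_def partial_trace_def ket_bra_def intro!: sum.cong)
  moreover have "(\<Sum>e<2 ^ anc. chi Q (b, i, e) * cnj (chi Q (b, j, e)))
     = (\<Sum>e<2 ^ a b. ?q e / 2)"
  proof (rule sum.mono_neutral_cong_right)
    show "{..<2 ^ a b} \<subseteq> {..<2 ^ anc :: nat}" using a_le_anc[of b] by (auto intro: less_le_trans power_increasing)
    fix e :: nat assume "e \<in> {..<2 ^ a b}"
    then have "chi Q (b, i, e) * cnj (chi Q (b, j, e)) = ?q e
       * (half_amp * half_amp)"
      by (simp add: chi_def)
    then show "chi Q (b, i, e) * cnj (chi Q (b, j, e)) = ?q e / 2"
      unfolding half_amp_sq by simp
  qed (auto simp: chi_def)
  ultimately show ?thesis by (simp add: sum_divide_distrib)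
qed

end

section \<open>The walk and Chebyshev polynomials\<close>

lemma three_term_funpow:
  assumes W: "uop E W" and rec: "\<And>x. x \<in> E \<Longrightarrow> W (W v) x = c * W v x - v x" and x: "x \<in> E"
  shows "(W ^^ Suc (Suc k)) v x = c * (W ^^ Suc k) v x - (W ^^ k) v x"
proof -
  note Wk = uop_funpow[OF W, of k]
  have "(W ^^ Suc (Suc k)) v x = (W ^^ k) (W (W v)) x" by (simp add: funpow_swap1)
  also have "\<dots> = (W ^^ k) (\<lambda>x. c * W v x - v x) x" by (rule uop_cong[OF Wk rec x])
  also have "\<dots> = c * (W ^^ k) (W v) x - (W ^^ k) v x"
    by (simp only: uop_diff[OF Wk x] uop_scale[OF Wk x])
  finally show ?thesis by (simp add: funpow_swap1)
qed

text \<open>The span of v and S v is invariant under both reflections. There R S has trace c and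
  determinant 1, so the identity is Cayley-Hamilton applied to v.\<close>

lemma walk_three_term:
  assumes R: "uop E R" and S: "uop E S" and SS: "\<And>x. x \<in> E \<Longrightarrow> S (S v) x = v x"
    and Rv: "\<And>x. x \<in> E \<Longrightarrow> R v x = v x" and RSv: "\<And>x. x \<in> E \<Longrightarrow> R (S v) x = c * v x - S v x"
    and x: "x \<in> E"
  shows "R (S (R (S v))) x = c * R (S v) x - v x"
proof -
  have 1: "S (R (S v)) y = c * S v y - v y" if y: "y \<in> E" for y
  proof -
    have "S (R (S v)) y = S (\<lambda>y. c * v y - S v y) y" by (rule uop_cong[OF S RSv y])
    then show ?thesis by (simp only: uop_diff[OF S y] uop_scale[OF S y] SS[OF y])
  qed
  have "R (S (R (S v))) x = R (\<lambda>y. c * S v y - v y) x" by (rule uop_cong[OF R 1 x])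
  then show ?thesis by (simp only: uop_diff[OF R x] uop_scale[OF R x] Rv[OF x])
qed

text \<open>The moments obey the Chebyshev recurrence. The case k = 1 uses that u is fixed by R: the
  inner product of u with R S v equals that with S v, and comparing with the formula for R S v
  determines it.\<close>

lemma walk_moment:
  assumes R: "uop E R" and S: "uop E S" and SS: "\<And>x. x \<in> E \<Longrightarrow> S (S v) x = v x"
    and Rv: "\<And>x. x \<in> E \<Longrightarrow> R v x = v x"
    and RSv: "\<And>x. x \<in> E \<Longrightarrow> R (S v) x = 2 * of_real (cos t) * v x - S v x"
    and Ru: "\<And>x. x \<in> E \<Longrightarrow> R u x = u x"
  shows "ip E u (((\<lambda>f. R (S f)) ^^ k) v) = of_real (cos (real k * t)) * ip E u v"
proof (induction k rule: induct_nat_012)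
  case 0
  show ?case by simp
next
  case 1
  have "ip E u (R (S v)) = ip E (R u) (R (S v))" by (rule ip_cong) (simp_all add: Ru)
  also have "\<dots> = ip E u (S v)" by (rule uop_ip[OF R])
  finally have "ip E u (S v) = ip E u (\<lambda>x. 2 * of_real (cos t) * v x - S v x)"
    using ip_cong[of E u u "R (S v)", OF _ RSv] by simp
  then have "2 * ip E u (S v) = 2 * (of_real (cos t) * ip E u v)"
    unfolding ip_diff_right ip_scale_right by simp
  then show ?case using \<open>ip E u (R (S v)) = ip E (R u) (R (S v))\<close> uop_ip[OF R, of u "S v"] by simp
next
  case (ge2 k)
  let ?W = "\<lambda>f. R (S f)"
  have W: "uop E ?W" by (rule uop_comp[OF R S])
  have "ip E u ((?W ^^ Suc (Suc k)) v)
      = ip E u (\<lambda>x. 2 * of_real (cos t) * (?W ^^ Suc k) v x - (?W ^^ k) v x)"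
    by (rule ip_cong[OF refl three_term_funpow[OF W walk_three_term[OF R S SS Rv RSv]]])
  also have "\<dots> = (2 * of_real (cos t) * of_real (cos (real (Suc k) * t)) - of_real (cos (real k * t))) * ip E u v"
    unfolding ip_diff_right ip_scale_right ge2 by (simp add: algebra_simps)
  also have "2 * complex_of_real (cos t) * of_real (cos (real (Suc k) * t)) - of_real (cos (real k * t))
     = of_real (cos (real (Suc (Suc k)) * t))"
  proof -
    have "2 * cos t * cos (real (Suc k) * t) - cos (real k * t) = cos (real (Suc (Suc k)) * t)"
      using cos_times_cos[of "real (Suc k) * t" t] by (simp add: algebra_simps)
    from arg_cong[OF this, of complex_of_real] show ?thesis by (simp only: of_real_diff of_real_mult of_real_numeral)
  qed
  finally show ?case .
qed

section \<open>The signed swap and the sign of the prepared state\<close>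

fun box_sign :: "black_box \<Rightarrow> complex" where
  "box_sign Box0 = 1" | "box_sign Box1 = -1"

lemma box_sign_sq [simp]: "box_sign b * box_sign b = 1" "cnj (box_sign b) = box_sign b" "cmod (box_sign b) = 1"
    "box_sign b * (box_sign b * z) = z"
  by (cases b; simp)+

text \<open>Only the two system indices are exchanged, not flags or ancillas. Contracting the second
  register with \<chi> on both sides leaves the operator (\<rho>0 - \<rho>1)/2 on the first system,
  the minus sign coming from the flag of the second register.\<close>

definition swap_op :: "pair_index transform" where
  "swap_op f = (\<lambda>((b, i, e), (c, i', e')). box_sign c * f ((b, i', e), (c, i, e')))"

text \<open>The flag of the first register supplies the outer factor \<nu>/2 of the trace. Since
  \<open>swap_op\<close> does not move this flag, the sign commutes with both reflections of the
  walk.\<close>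

definition sign_op :: "pair_index transform" where
  "sign_op f = (\<lambda>(g, h). box_sign (fst g) * f (g, h))"

definition snd_refl :: "'h set \<Rightarrow> ('h \<Rightarrow> complex) \<Rightarrow> ('g \<times> 'h \<Rightarrow> complex) \<Rightarrow> 'g \<times> 'h \<Rightarrow> complex" where
  "snd_refl H u f = (\<lambda>(g, h). reflection H u (\<lambda>h'. f (g, h')) h)"

lemma reflection_reflection:
  assumes "ip E u u = 1"
  shows "reflection E u (reflection E u f) = f"
  unfolding reflection_def ip_diff_right ip_scale_right assms by simp

lemma swap_op_swap_op [simp]: "swap_op (swap_op f) = f"
  by (auto simp: swap_op_def fun_eq_iff)

lemma sign_op_sign_op [simp]: "sign_op (sign_op f) = f"
  by (auto simp: sign_op_def fun_eq_iff)

lemma snd_refl_snd_refl: "ip H u u = 1 \<Longrightarrow> snd_refl H u (snd_refl H u f) = f"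
  using reflection_reflection[of H u] by (auto simp: snd_refl_def fun_eq_iff)

lemma sign_op_swap_op: "sign_op (swap_op f) = swap_op (sign_op f)"
  by (auto simp: swap_op_def sign_op_def fun_eq_iff)

lemma sign_op_snd_refl: "sign_op (snd_refl H u f) = snd_refl H u (sign_op f)"
  by (auto simp: snd_refl_def sign_op_def fun_eq_iff reflection_def ip_scale_right algebra_simps)

context purification_setup
begin

lemma uop_swap_op: "uop (G \<times> G) swap_op"
proof -
  let ?\<pi> = "\<lambda>((b, i, e), (c, i', e')). ((b, i', e), (c, i, e')) :: pair_index"
  have "bij_betw ?\<pi> (G \<times> G) (G \<times> G)"
    by (rule bij_betw_byWitness[where f' = ?\<pi>]) (auto simp: G_def)
  then have "uop (G \<times> G) (\<lambda>f x. box_sign (fst (snd x)) * f (?\<pi> x))"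
    by (rule uop_signed_perm) simp
  moreover have "(\<lambda>f x. box_sign (fst (snd x)) * f (?\<pi> x)) = swap_op"
    by (auto simp: fun_eq_iff swap_op_def)
  ultimately show ?thesis by simp
qed

lemma uop_sign_op: "uop (G \<times> G) sign_op"
proof -
  have "uop (G \<times> G) (\<lambda>f x. box_sign (fst (fst x)) * f (id x))"
    by (rule uop_signed_perm[OF bij_betw_id]) simp
  moreover have "(\<lambda>f x. box_sign (fst (fst x)) * f (id x)) = sign_op"
    by (auto simp: fun_eq_iff sign_op_def)
  ultimately show ?thesis by simp
qed

lemma uop_snd_refl: "ip G u u = 1 \<Longrightarrow> uop (G \<times> G) (snd_refl G u)"
  unfolding snd_refl_def[abs_def] using uop_block[of G G "\<lambda>_. reflection G u"] uop_reflection by blast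

definition walk ::
  "boxes \<Rightarrow> pair_index transform" where
  "walk Q f = snd_refl G (chi Q) (swap_op f)"

lemma uop_walk: "(\<And>b. unitary_mat (2 ^ (n + a b)) (Q b)) \<Longrightarrow> uop (G \<times> G) (walk Q)"
  unfolding walk_def[abs_def] by (rule uop_comp[OF uop_snd_refl[OF ip_chi] uop_swap_op])

end

definition tensor :: "('g \<Rightarrow> complex) \<Rightarrow> ('h \<Rightarrow> complex) \<Rightarrow> 'g \<times> 'h \<Rightarrow> complex" where
  "tensor u v = (\<lambda>(g, h). u g * v h)"

lemma ip_tensor: "ip (A \<times> B) (tensor u v) (tensor u' v') = ip A u u' * ip B v v'"
  unfolding ip_Times unfolding ip_def tensor_def
  by (simp add: sum_product mult_ac)

lemma snd_refl_tensor: "ip H u u = 1 \<Longrightarrow> snd_refl H u (tensor v u) = tensor v u"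
  by (auto simp: snd_refl_def tensor_def fun_eq_iff reflection_def ip_scale_right)

locale purified_states = purification_setup +
  fixes Q \<rho> :: "boxes" and U :: "complex mat" and \<mu> :: "nat \<Rightarrow> real"
  assumes prepares: "\<And>b. prepares_purification n (a b) (Q b) (\<rho> b)"
    and U: "unitary_mat (2 ^ n) U"
    and diff: "\<rho> Box0 - \<rho> Box1 = diag_conj (2 ^ n) U \<mu>"
begin

abbreviation "\<chi> \<equiv> chi Q"

lemma Q_unitary: "unitary_mat (2 ^ (n + a b)) (Q b)"
  using prepares by (simp add: prepares_purification_def)

lemmas ip_\<chi> = ip_chi[OF Q_unitary]

lemma \<rho>_carrier: "\<rho> b \<in> carrier_mat (2 ^ n) (2 ^ n)"
  using prepares[of b] by (simp add: prepares_purification_def partial_trace_def)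

abbreviation "\<nu> i j \<equiv> \<rho> Box0 $$ (i, j) - \<rho> Box1 $$ (i, j)"

lemma diff_index:
  assumes "i < 2 ^ n" "j < 2 ^ n"
  shows "\<nu> i j = (\<Sum>k<2 ^ n. U $$ (i, k) * of_real (\<mu> k) * cnj (U $$ (j, k)))"
proof -
  have "U \<in> carrier_mat (2 ^ n) (2 ^ n)" using U by (simp add: unitary_mat_def)
  then have "(\<rho> Box0 - \<rho> Box1) $$ (i, j) = (\<Sum>k<2 ^ n. U $$ (i, k) * of_real (\<mu> k) * cnj (U $$ (j, k)))"
    unfolding diff using assms by (rule conj_diag_index)
  then show ?thesis using \<rho>_carrier assms by (metis carrier_matD index_minus_mat(1))
qed

definition coef :: "nat \<Rightarrow> black_box \<Rightarrow> nat \<Rightarrow> complex" where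
  "coef j b e = (\<Sum>i<2 ^ n. cnj (U $$ (i, j)) * \<chi> (b, i, e))"

text \<open>The projection of \<chi> onto the \<open>j\<close>-th eigenvector of \<nu> in the system
  register.\<close>

definition comp :: "nat \<Rightarrow> purif_index \<Rightarrow> complex" where
  "comp j = (\<lambda>(b, i, e). U $$ (i, j) * coef j b e)"

lemma \<chi>_decomp: "g \<in> G \<Longrightarrow> \<chi> g = (\<Sum>j<2 ^ n. comp j g)"
proof -
  assume g: "g \<in> G"
  obtain b i e where gg: "g = (b, i, e)" by (metis prod.exhaust)
  then have i: "i < 2 ^ n" using g by (simp add: G_def)
  have "(\<Sum>j<2 ^ n. comp j g) = (\<Sum>j<2 ^ n. \<Sum>i'<2 ^ n. \<chi> (b, i', e) * (U $$ (i, j) * cnj (U $$ (i', j))))"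
    unfolding gg comp_def coef_def by (simp add: sum_distrib_left mult_ac)
  also have "\<dots> = (\<Sum>i'<2 ^ n. \<chi> (b, i', e) * (\<Sum>j<2 ^ n. U $$ (i, j) * cnj (U $$ (i', j))))"
    by (subst sum.swap) (simp add: sum_distrib_left)
  also have "\<dots> = (\<Sum>i'<2 ^ n. \<chi> (b, i', e) * (if i = i' then 1 else 0))"
    by (intro sum.cong refl) (simp add: unitary_mat_row[OF U i])
  also have "\<dots> = \<chi> g" using i by (simp add: gg if_distrib[of "\<lambda>x. _ * x"] cong: if_cong)
  finally show ?thesis by simp
qed

lemma diff_eigenvector:
  assumes "i < 2 ^ n" "j < 2 ^ n"
  shows "(\<Sum>i'<2 ^ n. \<nu> i i' * U $$ (i', j)) = of_real (\<mu> j) * U $$ (i, j)"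
proof -
  have "(\<Sum>i'<2 ^ n. \<nu> i i' * U $$ (i', j))
     = (\<Sum>i'<2 ^ n. \<Sum>k<2 ^ n. U $$ (i, k) * of_real (\<mu> k) * (cnj (U $$ (i', k)) * U $$ (i', j)))"
    using assms by (intro sum.cong refl) (simp add: diff_index sum_distrib_left sum_distrib_right mult_ac)
  also have "\<dots> = (\<Sum>k<2 ^ n. U $$ (i, k) * of_real (\<mu> k) * (\<Sum>i'<2 ^ n. cnj (U $$ (i', k)) * U $$ (i', j)))"
    by (subst sum.swap) (simp add: sum_distrib_left)
  also have "\<dots> = (\<Sum>k<2 ^ n. U $$ (i, k) * of_real (\<mu> k) * (if k = j then 1 else 0))"
    by (intro sum.cong refl) (simp add: unitary_mat_col[OF U _ assms(2)])
  also have "\<dots> = of_real (\<mu> j) * U $$ (i, j)"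
    using assms by (simp add: if_distrib[of "\<lambda>x. _ * x"] cong: if_cong)
  finally show ?thesis .
qed

lemma diff_comp:
  assumes "i < 2 ^ n" "j < 2 ^ n"
  shows "(\<Sum>i'<2 ^ n. \<nu> i i' * comp j (b, i', e)) = of_real (\<mu> j) * comp j (b, i, e)"
  using arg_cong[OF diff_eigenvector[OF assms], of "\<lambda>z. z * coef j b e"]
  by (simp add: comp_def sum_distrib_right mult.assoc)

lemma coef_norm: "(\<Sum>i<2 ^ n. cnj (\<chi> (b, i, e)) * comp j (b, i, e)) = of_real ((cmod (coef j b e))\<^sup>2)"
proof -
  have "cnj (coef j b e) = (\<Sum>i<2 ^ n. U $$ (i, j) * cnj (\<chi> (b, i, e)))"
    by (simp add: coef_def)
  then have "(\<Sum>i<2 ^ n. cnj (\<chi> (b, i, e)) * comp j (b, i, e)) = coef j b e * cnj (coef j b e)"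
    by (simp add: comp_def sum_distrib_left mult_ac)
  then show ?thesis by (simp only: complex_norm_square)
qed

text \<open>The probability that measuring \<chi> yields eigenvector \<open>j\<close> and flag
  \<open>b\<close>; equivalently, half the expectation of \<open>\<rho> b\<close> in this
  eigenvector.\<close>

definition weight :: "nat \<Rightarrow> black_box \<Rightarrow> real" where
  "weight j b = (\<Sum>e<2 ^ anc. (cmod (coef j b e))\<^sup>2)"

lemma weight_nonneg: "weight j b \<ge> 0"
  unfolding weight_def by (rule sum_nonneg) simp

lemma weight_eq: "of_real (weight j b) = (\<Sum>i<2 ^ n. \<Sum>e<2 ^ anc. cnj (\<chi> (b, i, e)) * comp j (b, i, e))"
  unfolding weight_def of_real_sum coef_norm[symmetric] by (rule sum.swap)

lemma weight_sum: "(\<Sum>j<2 ^ n. weight j Box0 + weight j Box1) = 1"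
proof -
  have "complex_of_real (\<Sum>j<2 ^ n. weight j Box0 + weight j Box1)
     = (\<Sum>j<2 ^ n. ip G \<chi> (comp j))"
    unfolding ip_G of_real_sum of_real_add weight_eq sum_black_box ..
  also have "\<dots> = ip G \<chi> (\<lambda>g. \<Sum>j<2 ^ n. comp j g)"
    unfolding ip_def sum_distrib_left by (rule sum.swap)
  also have "\<dots> = ip G \<chi> \<chi>" by (rule ip_cong) (simp_all add: \<chi>_decomp)
  finally have "complex_of_real (\<Sum>j<2 ^ n. weight j Box0 + weight j Box1) = 1" by (simp only: ip_\<chi>)
  then show ?thesis by (simp only: of_real_eq_1_iff)
qed

lemma ip_sign_comp: "ip G (\<lambda>g. box_sign (fst g) * \<chi> g) (comp j) = of_real (weight j Box0 - weight j Box1)"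
  unfolding ip_G of_real_diff weight_eq sum_black_box by (simp add: sum_negf)

text \<open>Both weights are half expectations in the same eigenvector, so their difference is half
  an expectation of \<nu>, that is, half the eigenvalue.\<close>

lemma weight_diff:
  assumes "j < 2 ^ n"
  shows "weight j Box0 - weight j Box1 = \<mu> j / 2"
proof -
  have w: "of_real (weight j b) = (\<Sum>i<2 ^ n. \<Sum>i'<2 ^ n. cnj (U $$ (i', j)) * U $$ (i, j) * (\<rho> b $$ (i', i) / 2))" for b
  proof -
    have "of_real (weight j b) = (\<Sum>i<2 ^ n. \<Sum>e<2 ^ anc. \<Sum>i'<2 ^ n.
        cnj (U $$ (i', j)) * U $$ (i, j) * (\<chi> (b, i', e) * cnj (\<chi> (b, i, e))))"
      unfolding weight_eq comp_def coef_def by (simp add: sum_distrib_left mult_ac)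
    also have "\<dots> = (\<Sum>i<2 ^ n. \<Sum>i'<2 ^ n. cnj (U $$ (i', j)) * U $$ (i, j) * (\<Sum>e<2 ^ anc. \<chi> (b, i', e) * cnj (\<chi> (b, i, e))))"
      unfolding sum_distrib_left by (rule sum.cong[OF refl], rule sum.swap)
    also have "\<dots> = (\<Sum>i<2 ^ n. \<Sum>i'<2 ^ n. cnj (U $$ (i', j)) * U $$ (i, j) * (\<rho> b $$ (i', i) / 2))"
      by (intro sum.cong refl) (simp add: chi_reduced_state[of b Q \<rho>, OF prepares])
    finally show ?thesis .
  qed
  have "complex_of_real (weight j Box0 - weight j Box1)
     = (\<Sum>i'<2 ^ n. \<Sum>i<2 ^ n. cnj (U $$ (i', j)) * ((\<nu> i' i * U $$ (i, j)) / 2))"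
    unfolding of_real_diff w sum_subtractf[symmetric]
    by (subst sum.swap) (simp add: algebra_simps diff_divide_distrib)
  also have "\<dots> = (\<Sum>i'<2 ^ n. cnj (U $$ (i', j)) * ((\<Sum>i<2 ^ n. \<nu> i' i * U $$ (i, j)) / 2))"
    by (simp only: sum_distrib_left sum_divide_distrib)
  also have "\<dots> = (\<Sum>i'<2 ^ n. of_real (\<mu> j / 2) * (cnj (U $$ (i', j)) * U $$ (i', j)))"
  proof (rule sum.cong[OF refl])
    fix i' :: nat assume "i' \<in> {..<2 ^ n}"
    then have i': "i' < 2 ^ n" by simp
    show "cnj (U $$ (i', j)) * ((\<Sum>i<2 ^ n. \<nu> i' i * U $$ (i, j)) / 2)
       = of_real (\<mu> j / 2) * (cnj (U $$ (i', j)) * U $$ (i', j))"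
      unfolding diff_eigenvector[OF i' assms] by simp
  qed
  also have "\<dots> = of_real (\<mu> j / 2)"
    unfolding sum_distrib_left[symmetric] unitary_mat_col[OF U assms assms] by simp
  finally show ?thesis by (simp only: of_real_eq_iff)
qed

text \<open>The weights form a probability distribution, and |a-b| <= a+b for each pair. This trace
  norm bound is what keeps the final error independent of the dimension.\<close>

lemma \<mu>_sum_le: "(\<Sum>j<2 ^ n. \<bar>\<mu> j / 2\<bar>) \<le> 1"
proof -
  have "(\<Sum>j<2 ^ n. \<bar>\<mu> j / 2\<bar>) \<le> (\<Sum>j<2 ^ n. weight j Box0 + weight j Box1)"
  proof (rule sum_mono)
    fix j :: nat assume "j \<in> {..<2 ^ n}"
    then show "\<bar>\<mu> j / 2\<bar> \<le> weight j Box0 + weight j Box1"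
      using weight_diff[of j] weight_nonneg[of j Box0] weight_nonneg[of j Box1] by auto
  qed
  then show ?thesis by (simp only: weight_sum)
qed

lemma \<mu>_le: "j < 2 ^ n \<Longrightarrow> \<bar>\<mu> j / 2\<bar> \<le> 1"
  using member_le_sum[of j "{..<2 ^ n}" "\<lambda>j. \<bar>\<mu> j / 2\<bar>"] \<mu>_sum_le by simp

text \<open>The partial inner product with \<chi> applies \<nu>/2 to the system, where
  \<open>comp j\<close> is an eigenvector. This is the hypothesis of \<open>walk_moment\<close> with
  cos t = \<open>\<mu> j / 2\<close>.\<close>

lemma snd_refl_swap_comp:
  assumes j: "j < 2 ^ n" and x: "x \<in> G \<times> G"
  shows "snd_refl G \<chi> (swap_op (tensor (comp j) \<chi>)) x
    = 2 * of_real (\<mu> j / 2) * tensor (comp j) \<chi> x - swap_op (tensor (comp j) \<chi>) x"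
proof -
  obtain b i e h where xx: "x = ((b, i, e), h)" by (metis prod.exhaust)
  then have i: "i < 2 ^ n" using x by (simp add: G_def)
  have "ip G \<chi> (\<lambda>h'. swap_op (tensor (comp j) \<chi>) ((b, i, e), h'))
     = (\<Sum>c\<in>UNIV. \<Sum>i'<2 ^ n. box_sign c * comp j (b, i', e) * (\<Sum>e'<2 ^ anc. \<chi> (c, i, e') * cnj (\<chi> (c, i', e'))))"
    unfolding ip_G by (simp add: swap_op_def tensor_def sum_distrib_left mult_ac)
  also have "\<dots> = (\<Sum>c\<in>UNIV. \<Sum>i'<2 ^ n. box_sign c * comp j (b, i', e) * (\<rho> c $$ (i, i') / 2))"
    using i by (intro sum.cong refl) (simp add: chi_reduced_state[of _ Q \<rho>, OF prepares])
  also have "\<dots> = (\<Sum>i'<2 ^ n. \<nu> i i' * comp j (b, i', e)) / 2"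
    unfolding sum_black_box sum.distrib[symmetric] sum_divide_distrib
    by (intro sum.cong refl) (simp add: field_simps)
  also have "\<dots> = of_real (\<mu> j / 2) * comp j (b, i, e)" unfolding diff_comp[OF i j] by simp
  finally have F: "ip G \<chi> (\<lambda>h'. swap_op (tensor (comp j) \<chi>) ((b, i, e), h'))
      = of_real (\<mu> j / 2) * comp j (b, i, e)" .
  show ?thesis
    unfolding xx snd_refl_def reflection_def prod.case F by (simp add: tensor_def)
qed

lemma walk_comp_moment:
  assumes "j < 2 ^ n"
  shows "ip (G \<times> G) (tensor v \<chi>) ((walk Q ^^ k) (tensor (comp j) \<chi>))
    = of_real (cos (real k * arccos (\<mu> j / 2))) * ip G v (comp j)"
proof -
  have c: "cos (arccos (\<mu> j / 2)) = \<mu> j / 2" using \<mu>_le[OF assms] by (intro cos_arccos) auto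
  have "ip (G \<times> G) (tensor v \<chi>) (((\<lambda>f. snd_refl G \<chi> (swap_op f)) ^^ k) (tensor (comp j) \<chi>))
    = of_real (cos (real k * arccos (\<mu> j / 2))) * ip (G \<times> G) (tensor v \<chi>) (tensor (comp j) \<chi>)"
    by (rule walk_moment[OF uop_snd_refl[OF ip_\<chi>] uop_swap_op])
      (simp_all add: snd_refl_tensor[OF ip_\<chi>] snd_refl_swap_comp[OF assms] c del: of_real_divide)
  then show ?thesis unfolding walk_def[abs_def] ip_tensor ip_\<chi> by simp
qed

text \<open>Expanding \<chi> in eigencomponents decouples the walk. The sign in the left vector
  turns the weight of each component into a difference of weights, hence into the factor
  \<open>\<mu> j / 2\<close>.\<close>

lemma walk_moment_sum:
  "ip (G \<times> G) (tensor (\<lambda>g. box_sign (fst g) * \<chi> g) \<chi>) ((walk Q ^^ k) (tensor \<chi> \<chi>))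
    = of_real (\<Sum>j<2 ^ n. \<mu> j / 2 * cos (real k * arccos (\<mu> j / 2)))"
proof -
  let ?u = "tensor (\<lambda>g. box_sign (fst g) * \<chi> g) \<chi>"
  note Wk = uop_funpow[OF uop_walk[OF Q_unitary], of k]
  have "ip (G \<times> G) ?u ((walk Q ^^ k) (tensor \<chi> \<chi>))
     = ip (G \<times> G) ?u (\<lambda>x. \<Sum>j<2 ^ n. 1 * (walk Q ^^ k) (tensor (comp j) \<chi>) x)"
  proof (rule ip_cong[OF refl])
    fix x assume x: "x \<in> G \<times> G"
    have "(walk Q ^^ k) (tensor \<chi> \<chi>) x = (walk Q ^^ k) (\<lambda>x. \<Sum>j<2 ^ n. 1 * tensor (comp j) \<chi> x) x"
      by (rule uop_cong[OF Wk _ x]) (auto simp: tensor_def \<chi>_decomp[symmetric] sum_distrib_right[symmetric])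
    also have "\<dots> = (\<Sum>j<2 ^ n. 1 * (walk Q ^^ k) (tensor (comp j) \<chi>) x)"
      by (rule uop_sum[OF Wk _ x]) simp
    finally show "(walk Q ^^ k) (tensor \<chi> \<chi>) x = (\<Sum>j<2 ^ n. 1 * (walk Q ^^ k) (tensor (comp j) \<chi>) x)" .
  qed
  also have "\<dots> = (\<Sum>j<2 ^ n. ip (G \<times> G) ?u ((walk Q ^^ k) (tensor (comp j) \<chi>)))"
    unfolding ip_def sum_distrib_left mult_1 by (rule sum.swap)
  also have "\<dots> = (\<Sum>j<2 ^ n. of_real (cos (real k * arccos (\<mu> j / 2))) * of_real (\<mu> j / 2))"
    by (intro sum.cong refl) (simp add: walk_comp_moment ip_sign_comp weight_diff del: of_real_divide of_real_diff)
  finally show ?thesis by (simp add: mult.commute)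
qed

end

section \<open>The circuit\<close>

lemma conjugated_reflection:
  assumes P: "uop E P" and inv: "\<And>f x. x \<in> E \<Longrightarrow> P (P' f) x = f x" and u: "\<And>x. x \<in> E \<Longrightarrow> P u0 x = u x"
    and x: "x \<in> E"
  shows "P (reflection E u0 (P' f)) x = reflection E u f x"
proof -
  have "ip E u0 (P' f) = ip E (P u0) (P (P' f))" by (rule uop_ip[OF P, symmetric])
  also have "\<dots> = ip E u f" by (rule ip_cong) (simp_all add: u inv)
  finally have i: "ip E u0 (P' f) = ip E u f" .
  show ?thesis unfolding reflection_def
    by (simp only: uop_diff[OF P x] uop_scale[OF P x] i u[OF x] inv[OF x])
qed

abbreviation l1 :: "(nat \<Rightarrow> real) \<Rightarrow> nat \<Rightarrow> real" where "l1 u J \<equiv> \<Sum>j<J. \<bar>u j\<bar>"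

text \<open>The bijection forces M J |G|^2 to be a power of two, so \<open>M\<close> and
  \<open>J\<close> have to be powers of two themselves.\<close>

locale workspace = purification_setup +
  fixes M J m :: nat and e :: "nat \<Rightarrow> work_index"
  assumes e: "bij_betw e {..<2 ^ m} ({..<M} \<times> {..<J} \<times> G \<times> G)"
begin

abbreviation "Y \<equiv> {..<J} \<times> G \<times> G"
abbreviation "q \<equiv> \<lambda>b. n + a b"

text \<open>
  Operators that act on the purifications under the control of l and j. These registers only have to
  control fixed unitaries: each one stands between a preparation and its inverse, which cancel when
  the control is off.
\<close>
definition lift_T ::
  "(nat \<Rightarrow> nat \<Rightarrow> pair_index transform) \<Rightarrow>
    work_index transform" where
  "lift_T F f = (\<lambda>(l, j, t). F l j (\<lambda>t'. f (l, j, t')) t)"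

definition lift_Y ::
  "(nat \<Rightarrow> term_index transform) \<Rightarrow>
    work_index transform" where
  "lift_Y F f = (\<lambda>(l, y). F l (\<lambda>y'. f (l, y')) y)"

abbreviation "impl \<equiv> implements m q e"
abbreviation "impl_T t F \<equiv> impl t (\<lambda>Q. lift_T (F Q))"
abbreviation "impl_Y t F \<equiv> impl t (\<lambda>Q. lift_Y (F Q))"

lemma lift_T_comp: "lift_T F' (lift_T F f) = lift_T (\<lambda>l j f. F' l j (F l j f)) f"
  by (auto simp: lift_T_def fun_eq_iff)

lemma lift_Y_comp: "lift_Y F' (lift_Y F f) = lift_Y (\<lambda>l f. F' l (F l f)) f"
  by (auto simp: lift_Y_def fun_eq_iff)

lemma lift_Y_lift_T: "lift_T F = lift_Y (\<lambda>l y (j, t). F l j (\<lambda>t'. y (j, t')) t)"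
  by (auto simp: lift_Y_def lift_T_def fun_eq_iff)

lemma impl_T_comp: "impl_T t F \<Longrightarrow> impl_T t' F' \<Longrightarrow> impl_T (t + t') (\<lambda>Q l j f. F' Q l j (F Q l j f))"
  by (drule (1) implements_comp) (simp only: lift_T_comp)

lemma impl_Y_comp: "impl_Y t F \<Longrightarrow> impl_Y t' F' \<Longrightarrow> impl_Y (t + t') (\<lambda>Q l f. F' Q l (F Q l f))"
  by (drule (1) implements_comp) (simp only: lift_Y_comp)

lemma impl_Y_fixed:
  assumes "\<And>l. l < M \<Longrightarrow> uop Y (F l)"
  shows "impl_Y 0 (\<lambda>_. F)"
proof (rule implements_fixed[OF _ e])
  show "uop ({..<M} \<times> Y) (lift_Y F)"
    unfolding lift_Y_def[abs_def] by (rule uop_block) (use assms in auto)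
qed

lemma impl_T_fixed:
  assumes "\<And>l j. l < M \<Longrightarrow> j < J \<Longrightarrow> uop (G \<times> G) (F l j)"
  shows "impl_T 0 (\<lambda>_. F)"
  unfolding lift_Y_lift_T by (rule impl_Y_fixed, rule uop_block) (use assms in auto)

lemma impl_T_cong:
  assumes "impl_T t F"
    and "\<And>Q l j f x. (\<And>b. unitary_mat (2 ^ q b) (Q b)) \<Longrightarrow> l < M \<Longrightarrow> j < J \<Longrightarrow> x \<in> G \<times> G \<Longrightarrow> F' Q l j f x = F Q l j f x"
  shows "impl_T t F'"
  by (rule implements_cong[OF assms(1) e]) (use assms(2) in \<open>auto simp: lift_T_def\<close>)

lemma impl_Y_cong:
  assumes "impl_Y t F"
    and "\<And>Q l f x. (\<And>b. unitary_mat (2 ^ q b) (Q b)) \<Longrightarrow> l < M \<Longrightarrow> x \<in> Y \<Longrightarrow> F' Q l f x = F Q l f x"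
  shows "impl_Y t F'"
  by (rule implements_cong[OF assms(1) e]) (use assms(2) in \<open>auto simp: lift_Y_def\<close>)

text \<open>An index is split into one purification register \<open>cmp\<close> and everything else
  \<open>ctx\<close>, and \<open>mk\<close> reassembles it. Abstracting this split lets one proof
  serve both registers.\<close>

lemma implements_component_query:
  fixes ctx :: "work_index \<Rightarrow> 'c" and cmp mk C
  defines "\<Omega> \<equiv> {..<M} \<times> Y"
  assumes mk: "\<And>c g. c \<in> C \<Longrightarrow> g \<in> G \<Longrightarrow> mk c g \<in> \<Omega> \<and> ctx (mk c g) = c \<and> cmp (mk c g) = g"
    and split: "\<And>x. x \<in> \<Omega> \<Longrightarrow> ctx x \<in> C \<and> cmp x \<in> G \<and> mk (ctx x) (cmp x) = x"
  shows "impl 1 (\<lambda>Q f x. cq b (if adj then mat_adjoint (Q b) else Q b) (\<lambda>g. f (mk (ctx x) g)) (cmp x))"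
proof -
  let ?R = "{..<2 ^ (anc - a b)}" and ?X = "{..<2 ^ (n + a b)}"
  define \<phi> where "\<phi> = (\<lambda>x. case query_index b (cmp x) of (r, c, i) \<Rightarrow> ((ctx x, r), c, i))"
  have q: "query_index b g \<in> ?R \<times> UNIV \<times> ?X" if "g \<in> G" for g
    using bij_betw_apply[OF bij_query_index that] .
  have u: "query_unindex b y \<in> G" if "y \<in> ?R \<times> UNIV \<times> ?X" for y
    using that bij_betw_apply[OF bij_betw_inv_into[OF bij_query_index] that] inv_query_index by (cases y) auto
  let ?inv = "\<lambda>((c, r), k, i). mk c (query_unindex b (r, k, i))"
  have \<phi>: "bij_betw \<phi> \<Omega> ((C \<times> ?R) \<times> UNIV \<times> ?X)"
  proof (rule bij_betw_byWitness[where f' = ?inv])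
    show "\<forall>x\<in>\<Omega>. ?inv (\<phi> x) = x"
    proof
      fix x assume "x \<in> \<Omega>"
      then show "?inv (\<phi> x) = x" using split[of x] query_unindex_index[of b "cmp x"]
        by (cases "query_index b (cmp x)") (simp add: \<phi>_def)
    qed
    show "\<forall>y\<in>(C \<times> ?R) \<times> UNIV \<times> ?X. \<phi> (?inv y) = y"
      using mk u by (auto simp: \<phi>_def query_index_unindex)
    show "\<phi> ` \<Omega> \<subseteq> (C \<times> ?R) \<times> UNIV \<times> ?X"
    proof
      fix y assume "y \<in> \<phi> ` \<Omega>"
      then obtain x where "x \<in> \<Omega>" "y = \<phi> x" by blast
      then show "y \<in> (C \<times> ?R) \<times> UNIV \<times> ?X" using q[of "cmp x"] split[of x]
        by (cases "query_index b (cmp x)") (auto simp: \<phi>_def)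
    qed
    show "?inv ` ((C \<times> ?R) \<times> UNIV \<times> ?X) \<subseteq> \<Omega>"
    proof
      fix y assume "y \<in> ?inv ` ((C \<times> ?R) \<times> UNIV \<times> ?X)"
      then obtain c r k i where "y = mk c (query_unindex b (r, k, i))" "c \<in> C" "r \<in> ?R" "i \<in> ?X" by auto
      then show "y \<in> \<Omega>" using mk[of c "query_unindex b (r, k, i)"] u[of "(r, k, i)"] by simp
    qed
  qed
  have inv: "inv_into \<Omega> \<phi> ((ctx x, r), True, j) = mk (ctx x) (inv_into G (query_index b) (r, True, j))"
    if "x \<in> \<Omega>" "r \<in> ?R" "j \<in> ?X" for x r j
  proof -
    have g: "query_unindex b (r, True, j) \<in> G" using u that by auto
    have "\<phi> (mk (ctx x) (query_unindex b (r, True, j))) = ((ctx x, r), True, j)"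
      using mk[OF conjunct1[OF split[OF that(1)]] g] by (simp add: \<phi>_def query_index_unindex)
    moreover have "mk (ctx x) (query_unindex b (r, True, j)) \<in> \<Omega>"
      using mk[OF conjunct1[OF split[OF that(1)]] g] by simp
    ultimately have "inv_into \<Omega> \<phi> ((ctx x, r), True, j) = mk (ctx x) (query_unindex b (r, True, j))"
      using bij_betw_inv_into_left[OF \<phi>] by metis
    then show ?thesis using that by (simp add: inv_query_index)
  qed
  have "impl 1 (\<lambda>Q. ctrl_query \<Omega> \<phi> (if adj then mat_adjoint (Q b) else Q b))"
    by (rule implements_controlled_query) (use e \<phi> in \<open>simp_all add: \<Omega>_def\<close>)
  then show ?thesis
  proof (rule implements_cong[OF _ e])
    fix Q :: "boxes" and f x
    assume Q: "\<And>b. unitary_mat (2 ^ (n + a b)) (Q b)" and "x \<in> {..<M} \<times> Y"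
    then have x: "x \<in> \<Omega>" by (simp add: \<Omega>_def)
    define V where "V = (if adj then mat_adjoint (Q b) else Q b)"
    have V: "dim_row V = 2 ^ (n + a b)" using Q[of b] by (auto simp: V_def unitary_mat_def)
    obtain r c i where rci: "query_index b (cmp x) = (r, c, i)" by (metis prod.exhaust)
    then have r: "r \<in> ?R" using q[of "cmp x"] split[OF x] by auto
    have "cq b V (\<lambda>g. f (mk (ctx x) g)) (cmp x) = ctrl_query \<Omega> \<phi> V f x"
      using split[OF x] inv[OF x r] by (auto simp: ctrl_query_def rci \<phi>_def V intro!: sum.cong)
    then show "cq b (if adj then mat_adjoint (Q b) else Q b) (\<lambda>g. f (mk (ctx x) g)) (cmp x) =
        ctrl_query \<Omega> \<phi> (if adj then mat_adjoint (Q b) else Q b) f x"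
      by (simp only: V_def)
  qed
qed

definition on_fst :: "purif_index transform \<Rightarrow>
    pair_index transform" where
  "on_fst P f = (\<lambda>(g, h). P (\<lambda>g'. f (g', h)) g)"

definition on_snd :: "purif_index transform \<Rightarrow>
    pair_index transform" where
  "on_snd P f = (\<lambda>(g, h). P (\<lambda>h'. f (g, h')) h)"

lemma on_fst_comp: "on_fst P (on_fst P' f) = on_fst (\<lambda>v. P (P' v)) f"
  and on_snd_comp: "on_snd P (on_snd P' f) = on_snd (\<lambda>v. P (P' v)) f"
  by (auto simp: on_fst_def on_snd_def fun_eq_iff)

lemma uop_on_fst: "uop G P \<Longrightarrow> uop (G \<times> G) (on_fst P)"
  unfolding on_fst_def[abs_def] by (rule uop_fst_factor)

lemma uop_on_snd: "uop G P \<Longrightarrow> uop (G \<times> G) (on_snd P)"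
  unfolding on_snd_def[abs_def] by (rule uop_block)

lemma impl_cq_fst: "impl_T 1 (\<lambda>Q l j. on_fst (cq b (if adj then mat_adjoint (Q b) else Q b)))"
  using implements_component_query[of "{..<M} \<times> {..<J} \<times> G" "\<lambda>(l, j, h) g. (l, j, g, h)"
      "\<lambda>(l, j, g, h). (l, j, h)" "\<lambda>(l, j, g, h). g" b adj]
  by (auto simp: lift_T_def[abs_def] on_fst_def case_prod_unfold)

lemma impl_cq_snd: "impl_T 1 (\<lambda>Q l j. on_snd (cq b (if adj then mat_adjoint (Q b) else Q b)))"
  using implements_component_query[of "{..<M} \<times> {..<J} \<times> G" "\<lambda>(l, j, g) h. (l, j, g, h)"
      "\<lambda>(l, j, g, h). (l, j, g)" "\<lambda>(l, j, g, h). h" b adj]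
  by (auto simp: lift_T_def[abs_def] on_snd_def case_prod_unfold)

lemma impl_prep:
  "impl_T 2 (\<lambda>Q l j. on_fst (prep Q))" "impl_T 2 (\<lambda>Q l j. on_snd (prep Q))"
  "impl_T 2 (\<lambda>Q l j. on_fst (unprep Q))" "impl_T 2 (\<lambda>Q l j. on_snd (unprep Q))"
  using impl_T_comp[OF impl_cq_fst[of Box0 False] impl_cq_fst[of Box1 False]]
    impl_T_comp[OF impl_cq_snd[of Box0 False] impl_cq_snd[of Box1 False]]
    impl_T_comp[OF impl_cq_fst[of Box1 True] impl_cq_fst[of Box0 True]]
    impl_T_comp[OF impl_cq_snd[of Box1 True] impl_cq_snd[of Box0 True]]
  unfolding on_fst_comp on_snd_comp if_True if_False prep_def[abs_def] unprep_def[abs_def] numeral_2_eq_2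
  by simp_all

lemma impl_snd_refl: "impl_T 4 (\<lambda>Q l j. if p l j then snd_refl G (chi Q) else (\<lambda>f. f))"
proof -
  have "impl_T 0 (\<lambda>Q l j. if p l j then snd_refl G init else (\<lambda>f. f))"
    by (rule impl_T_fixed) (simp add: uop_snd_refl[OF ip_init] uop_id)
  from impl_T_comp[OF impl_T_comp[OF impl_prep(4) this] impl_prep(2)]
  have "impl_T 4 (\<lambda>Q l j f. on_snd (prep Q) ((if p l j then snd_refl G init else (\<lambda>f. f)) (on_snd (unprep Q) f)))"
    by simp
  then show ?thesis
  proof (rule impl_T_cong)
    fix Q :: "boxes" and l j f x
    assume Q: "\<And>b. unitary_mat (2 ^ (n + a b)) (Q b)" and x: "x \<in> G \<times> G"
    show "(if p l j then snd_refl G (chi Q) else (\<lambda>f. f)) f x =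
       on_snd (prep Q) ((if p l j then snd_refl G init else (\<lambda>f. f)) (on_snd (unprep Q) f)) x"
      using x conjugated_reflection[OF uop_prep[OF Q] prep_unprep[OF Q] prep_init[OF Q]] prep_unprep[OF Q]
      by (auto simp: on_snd_def snd_refl_def)
  qed
qed

lemma impl_walk: "impl_T 4 (\<lambda>Q l j. if p l j then walk Q else (\<lambda>f. f))"
proof -
  have "impl_T 0 (\<lambda>Q l j. if p l j then swap_op else (\<lambda>f. f))"
    by (rule impl_T_fixed) (simp add: uop_swap_op uop_id)
  from impl_T_comp[OF this impl_snd_refl[of p]]
  have "impl_T 4 (\<lambda>Q l j f. (if p l j then snd_refl G (chi Q) else (\<lambda>f. f)) ((if p l j then swap_op else (\<lambda>f. f)) f))"
    by simp
  then show ?thesis by (rule impl_T_cong) (simp add: walk_def)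
qed

text \<open>One circuit of \<open>N\<close> rounds performs all powers coherently: a round is active
  while its number is below \<open>k l j\<close>. The cost is therefore that of the highest power,
  not the sum over all powers; the \<open>min\<close> is the state after \<open>N\<close>
  rounds.\<close>

lemma impl_walk_pow: "impl_T (4 * N) (\<lambda>Q l j. walk Q ^^ min (k l j) N)"
proof (induction N)
  case 0
  have "impl_T 0 (\<lambda>Q l j f. f)" by (rule impl_T_fixed) (rule uop_id)
  then show ?case by (simp add: id_def)
next
  case (Suc N)
  from impl_T_comp[OF Suc.IH impl_walk[of "\<lambda>l j. N < k l j"]]
  have "impl_T (4 * Suc N) (\<lambda>Q l j f. (if N < k l j then walk Q else (\<lambda>f. f)) ((walk Q ^^ min (k l j) N) f))"
    by (simp add: add.commute)
  then show ?case
  proof (rule impl_T_cong)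
    fix Q l j f x
    show "(walk Q ^^ min (k l j) (Suc N)) f x
      = (if N < k l j then walk Q else (\<lambda>f. f)) ((walk Q ^^ min (k l j) N) f) x"
    proof (cases "N < k l j")
      case True
      then have "min (k l j) (Suc N) = Suc N" "min (k l j) N = N" by auto
      then show ?thesis using True by simp
    next
      case False
      then have "min (k l j) (Suc N) = min (k l j) N" by auto
      then show ?thesis using False by simp
    qed
  qed
qed

definition amp_sign :: "(nat \<Rightarrow> real) \<Rightarrow> nat \<Rightarrow> complex" where
  "amp_sign u j = (if u j < 0 then -1 else 1)"

text \<open>Odd powers, because only odd frequencies occur. The reflection applied before the power
  fixes the state \<chi> tensor \<chi>, so it leaves the expectation alone, but it makes the
  operator an involution. Negative coefficients are moved into \<open>amp_sign\<close>.\<close>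

definition select_op :: "(nat \<Rightarrow> real) \<Rightarrow> boxes \<Rightarrow>
    term_index transform" where
  "select_op u Q y = (\<lambda>(j, t). amp_sign u j * sign_op ((walk Q ^^ (2 * j + 1)) (snd_refl G (chi Q) (\<lambda>t'. y (j, t')))) t)"

lemma uop_signed_sign_op: "uop (G \<times> G) (\<lambda>f t. amp_sign u j * sign_op f t)"
proof -
  have "uop (G \<times> G) (\<lambda>f t. amp_sign u j * f (id t))"
    by (rule uop_signed_perm[OF bij_betw_id]) (simp add: amp_sign_def)
  from uop_comp[OF this uop_sign_op] show ?thesis by simp
qed

lemma impl_select: "impl_Y (8 * J + 4) (\<lambda>Q l. if p l then select_op u Q else (\<lambda>f. f))"
proof -
  have fixed: "impl_T 0 (\<lambda>Q l j. if p l then (\<lambda>f t. amp_sign u j * sign_op f t) else (\<lambda>f. f))"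
    by (rule impl_T_fixed) (simp add: uop_signed_sign_op uop_id)
  \<comment> \<open>For j < J the power 2j+1 is below 2J, so the truncation by \<open>min\<close>
    has no effect. The cost is 4 for the reflection and 4 for each of 2J rounds.\<close>
  from impl_T_comp[OF impl_T_comp[OF impl_snd_refl[of "\<lambda>l _. p l"]
      impl_walk_pow[of "2 * J" "\<lambda>l j. if p l then 2 * j + 1 else 0"]] fixed]
  have "impl_T (8 * J + 4) (\<lambda>Q l j f. (if p l then (\<lambda>f t. amp_sign u j * sign_op f t) else (\<lambda>f. f))
      ((walk Q ^^ min (if p l then 2 * j + 1 else 0) (2 * J)) ((if p l then snd_refl G (chi Q) else (\<lambda>f. f)) f)))"
    by (simp add: add.commute)
  then have "impl_T (8 * J + 4) (\<lambda>Q l j f. if p l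
      then (\<lambda>t. amp_sign u j * sign_op ((walk Q ^^ (2 * j + 1)) (snd_refl G (chi Q) f)) t) else f)"
    by (rule impl_T_cong) simp
  then show ?thesis
    by (rule implements_cong[OF _ e]) (auto simp: lift_T_def lift_Y_def select_op_def)
qed

text \<open>Squared amplitudes proportional to \<open>\<bar>u j\<bar>\<close>: the expectation of an
  operator selected by j becomes the average with these weights, and the signs are added by
  \<open>select_op\<close>.\<close>

definition amp_vec :: "(nat \<Rightarrow> real) \<Rightarrow> (purif_index \<Rightarrow> complex) \<Rightarrow> term_index \<Rightarrow> complex" where
  "amp_vec u v = (\<lambda>(j, t). of_real (sqrt (\<bar>u j\<bar> / l1 u J)) * tensor v v t)"

lemma ip_amp_vec:
  assumes "ip G v v = 1" "l1 u J > 0"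
  shows "ip Y (amp_vec u v) (amp_vec u v) = 1"
proof -
  have "ip Y (amp_vec u v) (amp_vec u v) = (\<Sum>j<J. of_real (\<bar>u j\<bar> / l1 u J))"
    unfolding ip_Times[of _ "G \<times> G"] amp_vec_def using assms(1)
    by (intro sum.cong refl) (simp add: ip_scale_left ip_scale_right ip_tensor sum_nonneg flip: of_real_mult)
  also have "\<dots> = of_real (l1 u J / l1 u J)"
    unfolding sum_divide_distrib of_real_sum ..
  finally show ?thesis using assms(2) by simp
qed

definition prep_pair :: "boxes \<Rightarrow>
    term_index transform" where
  "prep_pair Q y = (\<lambda>(j, t). on_snd (prep Q) (on_fst (prep Q) (\<lambda>t'. y (j, t'))) t)"

definition unprep_pair :: "boxes \<Rightarrow>
    term_index transform" where
  "unprep_pair Q y = (\<lambda>(j, t). on_fst (unprep Q) (on_snd (unprep Q) (\<lambda>t'. y (j, t'))) t)"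

lemma impl_prep_pair: "impl_Y 4 (\<lambda>Q l. prep_pair Q)"
proof -
  have "impl_T 4 (\<lambda>Q l j f. on_snd (prep Q) (on_fst (prep Q) f))"
    using impl_T_comp[OF impl_prep(1) impl_prep(2)] by simp
  then show ?thesis
    by (rule implements_cong[OF _ e]) (auto simp: lift_T_def lift_Y_def prep_pair_def)
qed

lemma impl_unprep_pair: "impl_Y 4 (\<lambda>Q l. unprep_pair Q)"
proof -
  have "impl_T 4 (\<lambda>Q l j f. on_fst (unprep Q) (on_snd (unprep Q) f))"
    using impl_T_comp[OF impl_prep(4) impl_prep(3)] by simp
  then show ?thesis
    by (rule implements_cong[OF _ e]) (auto simp: lift_T_def lift_Y_def unprep_pair_def)
qed

context
  fixes Q :: "boxes"
  assumes Q: "\<And>b. unitary_mat (2 ^ (n + a b)) (Q b)"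
begin

lemma uop_prep_pair: "uop Y (prep_pair Q)"
  unfolding prep_pair_def[abs_def]
  by (rule uop_block) (rule uop_comp[OF uop_on_snd[OF uop_prep[OF Q]] uop_on_fst[OF uop_prep[OF Q]]])

lemma prep_unprep_pair: "x \<in> Y \<Longrightarrow> prep_pair Q (unprep_pair Q y) x = y x"
proof -
  assume x: "x \<in> Y"
  obtain j g h where xx: "x = (j, g, h)" by (metis prod.exhaust)
  then have g: "g \<in> G" "h \<in> G" using x by auto
  have 1: "on_fst (prep Q) (on_fst (unprep Q) f) t = f t" if "t \<in> G \<times> G" for f t
    using that by (auto simp: on_fst_def prep_unprep[OF Q])
  have "prep_pair Q (unprep_pair Q y) x = on_snd (prep Q) (on_fst (prep Q) (on_fst (unprep Q) (on_snd (unprep Q) (\<lambda>t'. y (j, t'))))) (g, h)"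
    by (simp add: xx prep_pair_def unprep_pair_def)
  also have "\<dots> = on_snd (prep Q) (on_snd (unprep Q) (\<lambda>t'. y (j, t'))) (g, h)"
    by (rule uop_cong[OF uop_on_snd[OF uop_prep[OF Q]] 1]) (use g in auto)
  also have "\<dots> = y x" using g by (simp add: xx on_snd_def prep_unprep[OF Q])
  finally show ?thesis .
qed

lemma prep_pair_amp_vec: "x \<in> Y \<Longrightarrow> prep_pair Q (amp_vec u init) x = amp_vec u (chi Q) x"
proof -
  assume x: "x \<in> Y"
  obtain j g h where xx: "x = (j, g, h)" by (metis prod.exhaust)
  then have g: "g \<in> G" "h \<in> G" using x by auto
  define c where "c = complex_of_real (sqrt (\<bar>u j\<bar> / l1 u J))"
  have s: "prep Q (\<lambda>y. k * init y) z = k * chi Q z" if "z \<in> G" for k z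
    using uop_scale[OF uop_prep[OF Q] that] prep_init[OF Q that] by simp
  have 1: "on_fst (prep Q) (\<lambda>t. amp_vec u init (j, t)) t = (\<lambda>(g, h). c * chi Q g * init h) t" if "t \<in> G \<times> G" for t
  proof -
    obtain g' h' where t: "t = (g', h')" by (metis prod.exhaust)
    have "(\<lambda>g'. amp_vec u init (j, g', h')) = (\<lambda>g'. c * init h' * init g')"
      by (simp add: amp_vec_def c_def tensor_def mult_ac)
    then show ?thesis using that s[of g' "c * init h'"] by (simp add: t on_fst_def)
  qed
  have "prep_pair Q (amp_vec u init) x = on_snd (prep Q) (\<lambda>(g, h). c * chi Q g * init h) (g, h)"
    unfolding xx prep_pair_def prod.case
    by (rule uop_cong[OF uop_on_snd[OF uop_prep[OF Q]] 1]) (use g in auto)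
  also have "\<dots> = c * chi Q g * chi Q h" using s[OF g(2)] by (simp add: on_snd_def)
  finally show ?thesis by (simp add: xx amp_vec_def c_def tensor_def)
qed

end

definition outer_walk :: "(nat \<Rightarrow> real) \<Rightarrow> boxes \<Rightarrow>
    term_index transform" where
  "outer_walk u Q y = reflection Y (amp_vec u (chi Q)) (select_op u Q y)"

context
  fixes u :: "nat \<Rightarrow> real"
  assumes u: "l1 u J > 0"
begin

lemma impl_outer_walk: "impl_Y (8 * J + 12) (\<lambda>Q l. if p l then outer_walk u Q else (\<lambda>f. f))"
proof -
  have "impl_Y 0 (\<lambda>Q l. if p l then reflection Y (amp_vec u init) else (\<lambda>f. f))"
    by (rule impl_Y_fixed) (simp add: uop_reflection[OF ip_amp_vec[OF ip_init u]] uop_id)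
  from impl_Y_comp[OF impl_Y_comp[OF impl_unprep_pair this] impl_prep_pair]
  have "impl_Y 8 (\<lambda>Q l f. prep_pair Q ((if p l then reflection Y (amp_vec u init) else (\<lambda>f. f)) (unprep_pair Q f)))"
    by simp
  then have "impl_Y 8 (\<lambda>Q l. if p l then reflection Y (amp_vec u (chi Q)) else (\<lambda>f. f))"
  proof (rule impl_Y_cong)
    fix Q :: "boxes" and l f x
    assume Q: "\<And>b. unitary_mat (2 ^ (n + a b)) (Q b)" and x: "x \<in> Y"
    show "(if p l then reflection Y (amp_vec u (chi Q)) else (\<lambda>f. f)) f x =
       prep_pair Q ((if p l then reflection Y (amp_vec u init) else (\<lambda>f. f)) (unprep_pair Q f)) x"
      using conjugated_reflection[OF uop_prep_pair[OF Q] prep_unprep_pair[OF Q] prep_pair_amp_vec[OF Q, of _ u] x]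
        prep_unprep_pair[OF Q x] by simp
  qed
  from impl_Y_comp[OF impl_select this, of p u]
  have "impl_Y (8 * J + 12) (\<lambda>Q l f. (if p l then reflection Y (amp_vec u (chi Q)) else (\<lambda>f. f)) ((if p l then select_op u Q else (\<lambda>f. f)) f))"
    by (simp add: add.assoc)
  then show ?thesis by (rule impl_Y_cong) (simp add: outer_walk_def)
qed

lemma impl_outer_walk_pow: "impl_Y (N * (8 * J + 12)) (\<lambda>Q l. outer_walk u Q ^^ min l N)"
proof (induction N)
  case 0
  have "impl_Y 0 (\<lambda>Q l f. f)" by (rule impl_Y_fixed) (rule uop_id)
  then show ?case by (simp add: id_def)
next
  case (Suc N)
  from impl_Y_comp[OF Suc.IH impl_outer_walk[of "\<lambda>l. N < l"]]
  have "impl_Y (Suc N * (8 * J + 12)) (\<lambda>Q l f. (if N < l then outer_walk u Q else (\<lambda>f. f)) ((outer_walk u Q ^^ min l N) f))"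
    by (simp add: add.commute)
  then show ?case
  proof (rule impl_Y_cong)
    fix Q l f x
    show "(outer_walk u Q ^^ min l (Suc N)) f x
      = (if N < l then outer_walk u Q else (\<lambda>f. f)) ((outer_walk u Q ^^ min l N) f) x"
    proof (cases "N < l")
      case True
      then have "min l (Suc N) = Suc N" "min l N = N" by auto
      then show ?thesis using True by simp
    next
      case False
      then have "min l (Suc N) = min l N" by auto
      then show ?thesis using False by simp
    qed
  qed
qed

lemma impl_history: "impl_Y (4 + M * (8 * J + 12)) (\<lambda>Q l f. (outer_walk u Q ^^ l) (prep_pair Q f))"
  using impl_Y_comp[OF impl_prep_pair impl_outer_walk_pow[of M]]
  by (rule impl_Y_cong) (simp add: min_def)

end

end

section \<open>Amplitude and clock measurement\<close>

locale estimation = purified_states n a Q \<rho> U \<mu> + workspace n a M J m e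
  for n a Q \<rho> U \<mu> M J m e +
  fixes u :: "nat \<Rightarrow> real"
  assumes u_pos: "l1 u J > 0"
begin

abbreviation "\<Psi> \<equiv> amp_vec u \<chi>"
abbreviation "R \<equiv> snd_refl G \<chi>"

lemma ip_\<Psi>: "ip Y \<Psi> \<Psi> = 1" by (rule ip_amp_vec[OF ip_\<chi> u_pos])

text \<open>With S the signed swap the left side is R S R R S, which collapses from the middle
  because both squares are the identity.\<close>

lemma walk_R_walk: "walk Q (R (walk Q f)) = R f"
  by (simp add: walk_def snd_refl_snd_refl[OF ip_\<chi>])

lemma walk_pow_R: "(walk Q ^^ k) (R ((walk Q ^^ k) f)) = R f"
proof (induction k)
  case (Suc k)
  have "(walk Q ^^ Suc k) (R ((walk Q ^^ Suc k) f)) = (walk Q ^^ k) (walk Q (R (walk Q ((walk Q ^^ k) f))))"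
    by (simp add: funpow_swap1)
  then show ?case by (simp only: walk_R_walk Suc)
qed simp

lemma sign_op_walk_pow: "sign_op ((walk Q ^^ k) f) = (walk Q ^^ k) (sign_op f)"
  by (induction k) (simp_all add: walk_def sign_op_snd_refl sign_op_swap_op)

lemma R_scale: "R (\<lambda>t. c * f t) = (\<lambda>t. c * R f t)"
  by (auto simp: snd_refl_def reflection_def fun_eq_iff ip_scale_right algebra_simps)

lemma walk_pow_scale: "(walk Q ^^ k) (\<lambda>t. c * f t) = (\<lambda>t. c * (walk Q ^^ k) f t)"
proof (induction k)
  case (Suc k)
  have "swap_op (\<lambda>t. c * g t) = (\<lambda>t. c * swap_op g t)" for g
    by (auto simp: swap_op_def fun_eq_iff)
  then have "walk Q (\<lambda>t. c * g t) = (\<lambda>t. c * walk Q g t)" for g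
    by (simp add: walk_def R_scale)
  then show ?case using Suc by simp
qed simp

lemma sign_op_scale: "sign_op (\<lambda>t. c * f t) = (\<lambda>t. c * sign_op f t)"
  by (auto simp: sign_op_def fun_eq_iff)

text \<open>A power of the walk followed by R is a palindrome in the two reflections, hence an involution.\<close>
lemma select_select: "select_op u Q (select_op u Q y) = y"
proof -
  have "sign_op ((walk Q ^^ k) (R (sign_op ((walk Q ^^ k) (R f))))) = f" for k f
  proof -
    have "sign_op ((walk Q ^^ k) (R (sign_op ((walk Q ^^ k) (R f)))))
      = (walk Q ^^ k) (R (sign_op (sign_op ((walk Q ^^ k) (R f)))))"
      by (simp only: sign_op_walk_pow sign_op_snd_refl)
    also have "\<dots> = R (R f)" by (simp only: sign_op_sign_op walk_pow_R)
    finally show ?thesis by (simp only: snd_refl_snd_refl[OF ip_\<chi>])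
  qed
  moreover have "amp_sign u j * amp_sign u j = 1" for j by (simp add: amp_sign_def)
  ultimately show ?thesis
    by (auto simp del: funpow.simps simp: select_op_def fun_eq_iff R_scale walk_pow_scale sign_op_scale mult.assoc[symmetric])
qed

lemma uop_select: "uop Y (select_op u Q)"
proof -
  have "uop (G \<times> G) (\<lambda>f t. amp_sign u j * sign_op ((walk Q ^^ (2 * j + 1)) (R f)) t)" for j
    by (rule uop_comp[OF uop_signed_sign_op uop_comp[OF uop_funpow[OF uop_walk[OF Q_unitary]] uop_snd_refl[OF ip_\<chi>]]])
  then show ?thesis unfolding select_op_def[abs_def] by (rule uop_block)
qed

lemma uop_outer_walk: "uop Y (outer_walk u Q)"
  unfolding outer_walk_def[abs_def] by (rule uop_comp[OF uop_reflection[OF ip_\<Psi>] uop_select])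

definition amplitude :: real where
  "amplitude = (\<Sum>j<J. u j * (\<Sum>l<2 ^ n. \<mu> l / 2 * cos ((2 * real j + 1) * arccos (\<mu> l / 2)))) / l1 u J"

text \<open>The reflection fixes \<chi> tensor \<chi> and disappears, and the sign operator moves to
  the left vector; each j then contributes one odd moment of the inner walk.\<close>

lemma ip_\<Psi>_select: "ip Y \<Psi> (select_op u Q \<Psi>) = of_real amplitude"
proof -
  let ?L = "l1 u J" and ?g = "\<lambda>j. \<Sum>l<2 ^ n. \<mu> l / 2 * cos ((2 * real j + 1) * arccos (\<mu> l / 2))"
  have "ip Y \<Psi> (select_op u Q \<Psi>)
     = (\<Sum>j<J. of_real (u j * ?g j / ?L))"
    unfolding ip_Times[of _ "G \<times> G"]
  proof (rule sum.cong[OF refl])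
    fix j assume "j \<in> {..<J}"
    define s where "s = complex_of_real (sqrt (\<bar>u j\<bar> / ?L))"
    have ss: "cnj s * (amp_sign u j * s) = of_real (u j / ?L)"
    proof -
      have "cnj s * s = of_real (\<bar>u j\<bar> / ?L)" using u_pos by (simp add: s_def flip: of_real_mult)
      then have "cnj s * (amp_sign u j * s) = amp_sign u j * of_real (\<bar>u j\<bar> / ?L)"
        by (simp only: mult.left_commute[of "cnj s"])
      then show ?thesis by (simp add: amp_sign_def)
    qed
    have 1: "(\<lambda>t. \<Psi> (j, t)) = (\<lambda>t. s * tensor \<chi> \<chi> t)" by (simp add: amp_vec_def s_def)
    have 2: "(\<lambda>t. select_op u Q \<Psi> (j, t))
        = (\<lambda>t. (amp_sign u j * s) * sign_op ((walk Q ^^ (2 * j + 1)) (tensor \<chi> \<chi>)) t)"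
      unfolding select_op_def prod.case 1 R_scale walk_pow_scale sign_op_scale snd_refl_tensor[OF ip_\<chi>]
      by (simp only: mult.assoc)
    have 3: "ip (G \<times> G) (tensor \<chi> \<chi>) (sign_op f) = ip (G \<times> G) (tensor (\<lambda>g. box_sign (fst g) * \<chi> g) \<chi>) f" for f
      unfolding ip_def by (intro sum.cong refl) (auto simp: sign_op_def tensor_def)
    have "ip (G \<times> G) (\<lambda>t. \<Psi> (j, t)) (\<lambda>t. select_op u Q \<Psi> (j, t))
      = of_real (u j / ?L) * of_real (\<Sum>l<2 ^ n. \<mu> l / 2 * cos (real (2 * j + 1) * arccos (\<mu> l / 2)))"
      unfolding 1 2 ip_scale_left ip_scale_right 3 walk_moment_sum ss[symmetric] by (simp only: mult.assoc)
    then show "ip (G \<times> G) (\<lambda>t. \<Psi> (j, t)) (\<lambda>t. select_op u Q \<Psi> (j, t))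
      = of_real (u j * ?g j / ?L)"
      by (simp add: add.commute)
  qed
  then show ?thesis unfolding amplitude_def sum_divide_distrib of_real_sum .
qed

text \<open>The argument on two reflections again, now with a reflection about a single vector: its
  value on V \<Psi>, for V the selected involution, is 2A \<Psi> - V \<Psi>, where A is the
  expectation of V in \<Psi>.\<close>

lemma outer_walk_three_term:
  assumes "x \<in> Y"
  shows "(outer_walk u Q ^^ Suc (Suc l)) \<Psi> x
    = 2 * of_real amplitude * (outer_walk u Q ^^ Suc l) \<Psi> x - (outer_walk u Q ^^ l) \<Psi> x"
proof (rule three_term_funpow[OF uop_outer_walk _ assms])
  fix x assume "x \<in> Y"
  then show "outer_walk u Q (outer_walk u Q \<Psi>) x = 2 * of_real amplitude * outer_walk u Q \<Psi> x - \<Psi> x"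
    unfolding outer_walk_def
    by (intro walk_three_term[OF uop_reflection[OF ip_\<Psi>] uop_select])
      (simp_all add: select_select reflection_def ip_\<Psi> ip_\<Psi>_select)
qed

lemma ip_outer_walk_pow: "ip Y ((outer_walk u Q ^^ l) \<Psi>) ((outer_walk u Q ^^ l) \<Psi>) = 1"
  using uop_ip[OF uop_funpow[OF uop_outer_walk]] ip_\<Psi> by simp

end

text \<open>Half the adjacency matrix of a path. The entries 1/2 match the recurrence in the form:
  the mean of the two neighbouring states is A times the middle one.\<close>

definition path_mat :: "nat \<Rightarrow> complex mat" where
  "path_mat M = mat M M (\<lambda>(i, j). if j = Suc i \<or> i = Suc j then 1 / 2 else 0)"

lemma path_mat_sum:
  assumes "l < M"
  shows "(\<Sum>k<M. path_mat M $$ (l, k) * v k)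
    = ((if l = 0 then 0 else v (l - 1)) + (if Suc l < M then v (Suc l) else 0)) / 2"
proof -
  have "(\<Sum>k<M. path_mat M $$ (l, k) * v k)
     = (\<Sum>k<M. (if k = Suc l then v k / 2 else 0) + (if l \<noteq> 0 \<and> k = l - 1 then v k / 2 else 0))"
    using assms by (intro sum.cong refl) (auto simp: path_mat_def)
  also have "\<dots> = (if Suc l < M then v (Suc l) / 2 else 0) + (if l \<noteq> 0 then v (l - 1) / 2 else 0)"
    using assms by (cases l) (simp_all add: sum.distrib)
  finally show ?thesis by (simp add: add_divide_distrib)
qed

text \<open>A window of slope at most 1 that vanishes at both ends of the clock, so that neither the
  missing neighbours there nor the variation in between disturbs the approximate
  eigenvector.\<close>

definition tent :: "nat \<Rightarrow> nat \<Rightarrow> real" where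
  "tent M l = real (min l (M - 1 - l))"

definition tent_norm :: "nat \<Rightarrow> real" where
  "tent_norm M = (\<Sum>l<M. (tent M l)\<^sup>2)"

text \<open>On the middle half of the clock the tent is at least \<open>s\<close>. The cubic growth,
  against a residual that grows linearly in M, is what gives the second moment O(1/M^2).\<close>

lemma tent_norm_ge:
  assumes "s > 0"
  shows "2 * real s ^ 3 \<le> tent_norm (4 * s)"
proof -
  have "2 * real s ^ 3 = (\<Sum>l\<in>{s..<3 * s}. (real s)\<^sup>2)"
    by (simp add: power3_eq_cube power2_eq_square)
  also have "\<dots> \<le> (\<Sum>l\<in>{s..<3 * s}. (tent (4 * s) l)\<^sup>2)"
    by (intro sum_mono power_mono) (auto simp: tent_def)
  also have "\<dots> \<le> tent_norm (4 * s)"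
    unfolding tent_norm_def by (intro sum_mono2) auto
  finally show ?thesis .
qed

lemma tent_step: "\<bar>tent M (Suc l) - tent M l\<bar> \<le> 1"
  unfolding tent_def by (auto simp: min_def)

lemma cmod_half_sum_sq:
  assumes "\<bar>p\<bar> \<le> 1" "\<bar>r\<bar> \<le> 1"
  shows "(cmod ((of_real p * z + of_real r * w) / 2))\<^sup>2 \<le> ((cmod z)\<^sup>2 + (cmod w)\<^sup>2) / 2"
proof -
  have "cmod (of_real p * z + of_real r * w) \<le> \<bar>p\<bar> * cmod z + \<bar>r\<bar> * cmod w"
    using norm_triangle_ineq[of "of_real p * z" "of_real r * w"] by (simp only: norm_mult norm_of_real)
  also have "\<dots> \<le> 1 * cmod z + 1 * cmod w"
    using assms by (intro add_mono mult_right_mono) auto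
  finally have "(cmod ((of_real p * z + of_real r * w) / 2))\<^sup>2 \<le> ((cmod z + cmod w) / 2)\<^sup>2"
    by (intro power_mono) (simp_all add: norm_divide)
  also have "\<dots> \<le> ((cmod z)\<^sup>2 + (cmod w)\<^sup>2) / 2"
    using zero_le_power2[of "cmod z - cmod w"] by (simp add: power2_eq_square field_simps)
  finally show ?thesis .
qed

lemma parseval_adjoint:
  assumes F: "unitary_mat M F"
  shows "(\<Sum>y<M. (cmod (\<Sum>l<M. cnj (F $$ (l, y)) * g l))\<^sup>2) = (\<Sum>l<M. (cmod (g l))\<^sup>2)"
proof -
  have Fc: "F \<in> carrier_mat M M" using F by (simp add: unitary_mat_def)
  have "ip {..<M} (\<lambda>y. \<Sum>l<M. mat_adjoint F $$ (y, l) * g l) (\<lambda>y. \<Sum>l<M. mat_adjoint F $$ (y, l) * g l) = ip {..<M} g g"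
    by (rule uop_ip[OF uop_mat[OF unitary_mat_adjoint[OF F]]])
  moreover have "(\<Sum>l<M. mat_adjoint F $$ (y, l) * g l) = (\<Sum>l<M. cnj (F $$ (l, y)) * g l)" if "y < M" for y
    using Fc that by (intro sum.cong refl) simp
  ultimately have "complex_of_real (\<Sum>y<M. (cmod (\<Sum>l<M. cnj (F $$ (l, y)) * g l))\<^sup>2) = of_real (\<Sum>l<M. (cmod (g l))\<^sup>2)"
    unfolding ip_self by simp
  then show ?thesis by (simp only: of_real_eq_iff)
qed

text \<open>
  By the three-term recurrence, the path operator on the clock acts on the history state as
  multiplication by A, up to the variation of the window, which is small for the tent.
\<close>
lemma history_second_moment:
  fixes w :: "nat \<Rightarrow> 'i \<Rightarrow> complex" and D :: "nat \<Rightarrow> real"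
  assumes F: "unitary_mat M F" and P: "path_mat M = diag_conj M F D"
    and rec: "\<And>l x. x \<in> E \<Longrightarrow> w (Suc (Suc l)) x = 2 * of_real A * w (Suc l) x - w l x"
    and norm: "\<And>l. ip E (w l) (w l) = 1" and N: "tent_norm M > 0"
  shows "(\<Sum>y<M. (D y - A)\<^sup>2 * (\<Sum>x\<in>E. (cmod (\<Sum>l<M. cnj (F $$ (l, y)) * (of_real (tent M l / sqrt (tent_norm M)) * w l x)))\<^sup>2))
    \<le> real M / tent_norm M"
proof -
  let ?h = "\<lambda>y x. \<Sum>l<M. cnj (F $$ (l, y)) * (of_real (tent M l / sqrt (tent_norm M)) * w l x)"
  define c where "c = complex_of_real (1 / sqrt (tent_norm M))"
  define v where "v l x = of_real (tent M l) * w l x" for l x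
  \<comment> \<open>The residual of the windowed history as an eigenvector of the path operator for
    the value A.\<close>
  define r where "r l x = (\<Sum>k<M. path_mat M $$ (l, k) * v k x) - of_real A * v l x" for l x
  let ?hv = "\<lambda>y x. \<Sum>l<M. cnj (F $$ (l, y)) * v l x" and ?hr = "\<lambda>y x. \<Sum>l<M. cnj (F $$ (l, y)) * r l x"
  have Fc: "F \<in> carrier_mat M M" using F by (simp add: unitary_mat_def)
  have c2: "(cmod c)\<^sup>2 = 1 / tent_norm M" using N by (simp add: c_def norm_divide power_divide)
  have shift: "(\<Sum>l<M. cnj (F $$ (l, y)) * path_mat M $$ (l, k)) = of_real (D y) * cnj (F $$ (k, y))"
    if "y < M" "k < M" for y k
  proof -
    have "(\<Sum>l<M. cnj (F $$ (l, y)) * path_mat M $$ (l, k))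
       = (\<Sum>l<M. \<Sum>i<M. of_real (D i) * cnj (F $$ (k, i)) * (cnj (F $$ (l, y)) * F $$ (l, i)))"
      unfolding P using that by (intro sum.cong refl) (simp add: conj_diag_index[OF Fc] sum_distrib_left mult_ac)
    also have "\<dots> = (\<Sum>i<M. of_real (D i) * cnj (F $$ (k, i)) * (\<Sum>l<M. cnj (F $$ (l, y)) * F $$ (l, i)))"
      by (subst sum.swap) (simp add: sum_distrib_left)
    also have "\<dots> = (\<Sum>i<M. of_real (D i) * cnj (F $$ (k, i)) * (if y = i then 1 else 0))"
      using that by (intro sum.cong refl) (simp add: unitary_mat_col[OF F])
    also have "\<dots> = of_real (D y) * cnj (F $$ (k, y))"
      using that by (simp add: if_distrib[of "\<lambda>x. _ * x"] cong: if_cong)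
    finally show ?thesis .
  qed
  \<comment> \<open>In the eigenbasis of the path, the path operator minus A multiplies component y
    by \<open>D y - A\<close>. The weighted second moment is thus the norm of the transformed
    residual, and Parseval removes the transform.\<close>
  have diag: "of_real (D y - A) * (?hv y x) = (?hr y x)"
    if "y < M" for y x
  proof -
    have "(\<Sum>l<M. cnj (F $$ (l, y)) * (\<Sum>k<M. path_mat M $$ (l, k) * v k x))
        = (\<Sum>k<M. (\<Sum>l<M. cnj (F $$ (l, y)) * path_mat M $$ (l, k)) * v k x)"
      unfolding sum_distrib_left sum_distrib_right by (subst sum.swap) (simp add: mult.assoc)
    also have "\<dots> = of_real (D y) * (\<Sum>k<M. cnj (F $$ (k, y)) * v k x)"
      unfolding sum_distrib_left using that by (intro sum.cong refl) (simp add: shift mult.assoc)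
    finally show ?thesis
      unfolding r_def by (simp add: right_diff_distrib left_diff_distrib sum_subtractf sum_distrib_left mult_ac)
  qed
  note parseval = parseval_adjoint[OF F]
  have wn: "(\<Sum>x\<in>E. (cmod (w l x))\<^sup>2) = 1" for l
    using norm[of l] unfolding ip_self by (simp only: of_real_eq_1_iff)
  have rb: "(\<Sum>x\<in>E. (cmod (r l x))\<^sup>2) \<le> 1" if l: "l < M" for l
  proof (cases "l = 0")
    case True
    \<comment> \<open>At the left end the tent is 0, so only the neighbour at 1 remains; the zero
      summand adapts it to the two-term estimate.\<close>
    then have eq: "r l x = (of_real (if Suc l < M then tent M (Suc l) else 0) * w (Suc l) x + of_real 0 * w 0 x) / 2" for x
      using l by (simp add: r_def path_mat_sum v_def tent_def)
    have "\<bar>if Suc l < M then tent M (Suc l) else 0\<bar> \<le> 1"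
      using True by (auto simp: tent_def)
    then have "(cmod (r l x))\<^sup>2 \<le> ((cmod (w (Suc l) x))\<^sup>2 + (cmod (w 0 x))\<^sup>2) / 2" for x
      unfolding eq by (rule cmod_half_sum_sq) simp
    then have "(\<Sum>x\<in>E. (cmod (r l x))\<^sup>2) \<le> (\<Sum>x\<in>E. ((cmod (w (Suc l) x))\<^sup>2 + (cmod (w 0 x))\<^sup>2) / 2)"
      by (intro sum_mono)
    then show ?thesis by (simp add: sum_divide_distrib[symmetric] sum.distrib wn)
  next
    case False
    then obtain k where k: "l = Suc k" using not0_implies_Suc by blast
    define p where "p = tent M k - tent M l"
    define p' where "p' = (if Suc l < M then tent M (Suc l) - tent M l else 0)"
    have pp: "\<bar>p\<bar> \<le> 1" "\<bar>p'\<bar> \<le> 1"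
      using tent_step[of M k] tent_step[of M l] by (auto simp: p_def p'_def k abs_minus_commute)
    have eq: "r l x = (of_real p * w k x + of_real p' * w (Suc l) x) / 2" if "x \<in> E" for x
    proof -
      have Av: "of_real A * v l x = of_real (tent M l) * (w (Suc l) x + w k x) / 2"
        using rec[OF that, of k] by (simp add: v_def k algebra_simps)
      have "r l x = (v k x + (if Suc l < M then v (Suc l) x else 0) - of_real (tent M l) * (w (Suc l) x + w k x)) / 2"
        unfolding r_def Av path_mat_sum[OF l] by (simp add: k diff_divide_distrib)
      \<comment> \<open>At the right end the recurrence refers to a state beyond the clock; its
        coefficient is the tent at the last position, which is 0.\<close>
      moreover have "tent M l = 0" if "\<not> Suc l < M" using that l by (simp add: tent_def)
      ultimately show ?thesis by (auto simp: p_def p'_def v_def algebra_simps)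
    qed
    have "(cmod (r l x))\<^sup>2 \<le> ((cmod (w k x))\<^sup>2 + (cmod (w (Suc l) x))\<^sup>2) / 2" if "x \<in> E" for x
      unfolding eq[OF that] by (rule cmod_half_sum_sq[OF pp])
    then have "(\<Sum>x\<in>E. (cmod (r l x))\<^sup>2) \<le> (\<Sum>x\<in>E. ((cmod (w k x))\<^sup>2 + (cmod (w (Suc l) x))\<^sup>2) / 2)"
      by (rule sum_mono)
    then show ?thesis by (simp add: sum_divide_distrib[symmetric] sum.distrib wn)
  qed
  have "(\<Sum>y<M. (D y - A)\<^sup>2 * (\<Sum>x\<in>E. (cmod (?h y x))\<^sup>2))
     = (\<Sum>y<M. \<Sum>x\<in>E. (cmod c)\<^sup>2 * (cmod (?hr y x))\<^sup>2)"
  proof (rule sum.cong[OF refl])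
    fix y assume y: "y \<in> {..<M}"
    have "(D y - A)\<^sup>2 * (cmod (?h y x))\<^sup>2
       = (cmod c)\<^sup>2 * (cmod (?hr y x))\<^sup>2" for x
    proof -
      have "(?h y x)
         = c * (?hv y x)"
        unfolding sum_distrib_left by (intro sum.cong refl) (simp add: c_def v_def)
      moreover have "(D y - A)\<^sup>2 = (cmod (of_real (D y - A)))\<^sup>2" by (simp only: norm_of_real power2_abs)
      ultimately have "(D y - A)\<^sup>2 * (cmod (?h y x))\<^sup>2
        = (cmod c)\<^sup>2 * (cmod (of_real (D y - A) * (?hv y x)))\<^sup>2"
        by (simp only: norm_mult power_mult_distrib mult_ac)
      then show ?thesis using y by (simp only: diag lessThan_iff)
    qed
    then show "(D y - A)\<^sup>2 * (\<Sum>x\<in>E. (cmod (?h y x))\<^sup>2)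
       = (\<Sum>x\<in>E. (cmod c)\<^sup>2 * (cmod (?hr y x))\<^sup>2)"
      unfolding sum_distrib_left by (intro sum.cong refl) simp
  qed
  also have "\<dots> = (cmod c)\<^sup>2 * (\<Sum>x\<in>E. \<Sum>y<M. (cmod (?hr y x))\<^sup>2)"
    by (subst sum.swap) (simp only: sum_distrib_left)
  also have "\<dots> = (cmod c)\<^sup>2 * (\<Sum>l<M. \<Sum>x\<in>E. (cmod (r l x))\<^sup>2)"
    unfolding parseval by (subst sum.swap) (rule refl)
  also have "\<dots> \<le> (cmod c)\<^sup>2 * (\<Sum>l<M. 1)"
    by (intro mult_left_mono sum_mono rb) auto
  also have "\<dots> = real M / tent_norm M" by (simp add: c2)
  finally show ?thesis .
qed

context estimation
begin

definition history_state :: "nat \<Rightarrow> term_index \<Rightarrow> complex" where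
  "history_state l x = of_real (tent M l / sqrt (tent_norm M)) * (outer_walk u Q ^^ l) \<Psi> x"

definition outcome_prob :: "complex mat \<Rightarrow> nat \<Rightarrow> real" where
  "outcome_prob F y = (\<Sum>x\<in>Y. (cmod (\<Sum>l<M. cnj (F $$ (l, y)) * history_state l x))\<^sup>2)"

lemma outcome_prob_nonneg: "outcome_prob F y \<ge> 0"
  unfolding outcome_prob_def by (rule sum_nonneg) simp

lemma sum_outcome_prob:
  assumes F: "unitary_mat M F" and N: "tent_norm M > 0"
  shows "(\<Sum>y<M. outcome_prob F y) = 1"
proof -
  have w: "(\<Sum>x\<in>Y. (cmod ((outer_walk u Q ^^ l) \<Psi> x))\<^sup>2) = 1" for l
    using ip_outer_walk_pow[of l] unfolding ip_self by (simp only: of_real_eq_1_iff)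
  have "(\<Sum>y<M. outcome_prob F y) = (\<Sum>l<M. \<Sum>x\<in>Y. (cmod (history_state l x))\<^sup>2)"
    unfolding outcome_prob_def by (subst sum.swap) (simp only: parseval_adjoint[OF F], rule sum.swap)
  also have "\<dots> = (\<Sum>l<M. (tent M l)\<^sup>2 / tent_norm M * (\<Sum>x\<in>Y. (cmod ((outer_walk u Q ^^ l) \<Psi> x))\<^sup>2))"
    unfolding history_state_def sum_distrib_left using N
    by (intro sum.cong refl) (simp add: norm_mult norm_divide power_mult_distrib power_divide)
  also have "\<dots> = 1" unfolding w using N by (simp add: tent_norm_def flip: sum_divide_distrib)
  finally show ?thesis .
qed

text \<open>Chebyshev's inequality for the distribution of outcomes, with the second moment taken
  around the amplitude itself and not around the mean.\<close>

lemma outcome_concentration: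
  assumes F: "unitary_mat M F" and P: "path_mat M = diag_conj M F D"
    and N: "tent_norm M > 0" and \<eta>: "\<eta> > 0"
  shows "1 - real M / (tent_norm M * \<eta>\<^sup>2) \<le> (\<Sum>y | y < M \<and> \<bar>D y - amplitude\<bar> \<le> \<eta>. outcome_prob F y)"
proof -
  let ?good = "{y. y < M \<and> \<bar>D y - amplitude\<bar> \<le> \<eta>}" and ?bad = "{y. y < M \<and> \<not> \<bar>D y - amplitude\<bar> \<le> \<eta>}"
  have "\<eta>\<^sup>2 * (\<Sum>y\<in>?bad. outcome_prob F y) \<le> (\<Sum>y\<in>?bad. (D y - amplitude)\<^sup>2 * outcome_prob F y)"
    unfolding sum_distrib_left
  proof (rule sum_mono)
    fix y assume "y \<in> ?bad"
    then have "\<eta>\<^sup>2 \<le> (D y - amplitude)\<^sup>2" using \<eta> by (auto simp flip: abs_le_square_iff)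
    then show "\<eta>\<^sup>2 * outcome_prob F y \<le> (D y - amplitude)\<^sup>2 * outcome_prob F y"
      by (rule mult_right_mono[OF _ outcome_prob_nonneg])
  qed
  also have "\<dots> \<le> (\<Sum>y<M. (D y - amplitude)\<^sup>2 * outcome_prob F y)"
    by (rule sum_mono2) (auto intro!: mult_nonneg_nonneg outcome_prob_nonneg)
  also have "\<dots> \<le> real M / tent_norm M"
    unfolding outcome_prob_def history_state_def
    by (rule history_second_moment[where w = "\<lambda>l. (outer_walk u Q ^^ l) \<Psi>" and E = Y,
          OF F P outer_walk_three_term ip_outer_walk_pow N])
  finally have bad: "(\<Sum>y\<in>?bad. outcome_prob F y) \<le> real M / (tent_norm M * \<eta>\<^sup>2)"
    using \<eta> N by (simp add: field_simps)
  have "(\<Sum>y<M. outcome_prob F y) = (\<Sum>y\<in>?good. outcome_prob F y) + (\<Sum>y\<in>?bad. outcome_prob F y)"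
    by (subst sum.union_disjoint[symmetric]) (auto intro!: sum.cong)
  then show ?thesis using bad sum_outcome_prob[OF F N] by simp
qed

text \<open>Passing from \<nu>/2 back to \<nu> produces 2^(p+1). The uniform error \<open>B\<close>
  is multiplied by \<open>\<bar>\<mu> l / 2\<bar>\<close> and summed, so \<open>\<mu>_sum_le\<close>
  removes any dependence on the number of eigenvalues.\<close>

lemma amplitude_approx:
  assumes p: "p > 0"
    and B: "\<And>t. 0 \<le> t \<Longrightarrow> t \<le> pi \<Longrightarrow>
      expansion_error p u J t \<le> B"
  shows "\<bar>2 powr (p + 1) * l1 u J * amplitude - (\<Sum>l<2 ^ n. \<bar>\<mu> l\<bar> powr (p + 1))\<bar> \<le> 2 powr (p + 1) * B"
proof -
  define g where "g t = (\<Sum>j<J. u j * cos ((2 * real j + 1) * t))" for t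
  define t where "t l = arccos (\<mu> l / 2)" for l
  have t: "0 \<le> t l" "t l \<le> pi" "cos (t l) = \<mu> l / 2" if "l < 2 ^ n" for l
    using \<mu>_le[OF that] unfolding abs_le_iff t_def by (auto intro: arccos_lbound arccos_ubound cos_arccos)
  have B0: "B \<ge> 0" using B[of 0] by simp
  have "l1 u J * amplitude = (\<Sum>j<J. u j * (\<Sum>l<2 ^ n. \<mu> l / 2 * cos ((2 * real j + 1) * t l)))"
    using u_pos by (simp add: amplitude_def t_def)
  also have "\<dots> = (\<Sum>j<J. \<Sum>l<2 ^ n. \<mu> l / 2 * (u j * cos ((2 * real j + 1) * t l)))"
    by (simp add: sum_distrib_left mult_ac)
  also have "\<dots> = (\<Sum>l<2 ^ n. \<mu> l / 2 * g (t l))"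
    unfolding g_def sum_distrib_left by (rule sum.swap)
  finally have 1: "l1 u J * amplitude = (\<Sum>l<2 ^ n. \<mu> l / 2 * g (t l))" .
  have 2: "\<bar>\<mu> l\<bar> powr (p + 1) = 2 powr (p + 1) * (\<mu> l / 2 * (sgn (\<mu> l / 2) * \<bar>\<mu> l / 2\<bar> powr p))" for l
  proof -
    have "\<bar>\<mu> l\<bar> powr (p + 1) = (2 * \<bar>\<mu> l / 2\<bar>) powr (p + 1)" by simp
    also have "\<dots> = 2 powr (p + 1) * \<bar>\<mu> l / 2\<bar> powr (p + 1)" by (rule powr_mult)
    also have "\<bar>\<mu> l / 2\<bar> powr (p + 1) = \<bar>\<mu> l / 2\<bar> powr p * \<bar>\<mu> l / 2\<bar>"
      by (simp add: powr_add)
    also have "\<bar>\<mu> l / 2\<bar> powr p * \<bar>\<mu> l / 2\<bar> = \<mu> l / 2 * (sgn (\<mu> l / 2) * \<bar>\<mu> l / 2\<bar> powr p)"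
    proof -
      have "p * \<bar>x\<bar> = x * (sgn x * p)" for p x :: real by (simp add: sgn_if)
      then show ?thesis .
    qed
    finally show ?thesis .
  qed
  let ?d = "\<lambda>l. \<mu> l / 2 * g (t l) - \<mu> l / 2 * (sgn (\<mu> l / 2) * \<bar>\<mu> l / 2\<bar> powr p)"
  have le: "\<bar>\<Sum>l<2 ^ n. ?d l\<bar>
      \<le> (\<Sum>l<2 ^ n. \<bar>\<mu> l / 2\<bar> * B)"
  proof (rule order_trans[OF sum_abs], rule sum_mono)
    fix l :: nat assume "l \<in> {..<2 ^ n}"
    then have l: "l < 2 ^ n" by simp
    have "\<bar>x * y - x * z\<bar> = \<bar>x\<bar> * \<bar>z - y\<bar>" for x y z :: real
      unfolding right_diff_distrib[symmetric] abs_mult by (simp add: abs_minus_commute)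
    then have "\<bar>?d l\<bar>
      = \<bar>\<mu> l / 2\<bar> * \<bar>sgn (\<mu> l / 2) * \<bar>\<mu> l / 2\<bar> powr p - g (t l)\<bar>" .
    also have "\<dots> \<le> \<bar>\<mu> l / 2\<bar> * B"
      using B[OF t(1,2)[OF l]] unfolding t(3)[OF l] g_def by (rule mult_left_mono) simp
    finally show "\<bar>?d l\<bar> \<le> \<bar>\<mu> l / 2\<bar> * B" .
  qed
  have eq: "2 powr (p + 1) * l1 u J * amplitude - (\<Sum>l<2 ^ n. \<bar>\<mu> l\<bar> powr (p + 1))
     = 2 powr (p + 1) * (\<Sum>l<2 ^ n. ?d l)"
    unfolding mult.assoc 1 2 by (simp only: sum_subtractf right_diff_distrib sum_distrib_left)
  have "\<bar>2 powr (p + 1) * l1 u J * amplitude - (\<Sum>l<2 ^ n. \<bar>\<mu> l\<bar> powr (p + 1))\<bar>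
      = 2 powr (p + 1) * \<bar>\<Sum>l<2 ^ n. ?d l\<bar>"
    unfolding eq abs_mult by simp
  also have "\<dots> \<le> 2 powr (p + 1) * (\<Sum>l<2 ^ n. \<bar>\<mu> l / 2\<bar> * B)"
    by (rule mult_left_mono[OF le]) simp
  also have "\<dots> = 2 powr (p + 1) * ((\<Sum>l<2 ^ n. \<bar>\<mu> l / 2\<bar>) * B)" by (simp only: sum_distrib_right)
  also have "\<dots> \<le> 2 powr (p + 1) * (1 * B)"
    by (intro mult_left_mono mult_right_mono \<mu>_sum_le B0) simp
  finally show ?thesis by simp
qed

end

context workspace
begin

text \<open>The circuit is fixed before the boxes are: neither \<open>Q\<close> nor the spectral
  data of the states enter \<open>alg\<close>. A fixed unitary prepares window and coefficients,
  controlled powers write the history, and the adjoint of \<open>F\<close> rotates the eigenbasis of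
  the path into the measured basis.\<close>

lemma algorithm_exists:
  fixes u :: "nat \<Rightarrow> real" and res :: "nat \<Rightarrow> real"
  assumes u: "l1 u J > 0" and N: "tent_norm M > 0" and F: "unitary_mat M F"
  shows "\<exists>alg. valid_alg q alg \<and> num_queries alg \<le> 4 + M * (8 * J + 12) \<and>
    (\<forall>Q \<rho> U \<mu> S. estimation n a Q \<rho> U \<mu> M J m e u \<longrightarrow>
       prob_result q Q alg S = (\<Sum>y | y < M \<and> res y \<in> S. estimation.outcome_prob n a Q M J u F y))"
proof -
  let ?\<Omega> = "{..<M} \<times> Y"
  let ?d = "\<lambda>x. if x = e 0 then 1 else (0::complex)"
  let ?c = "\<lambda>l. complex_of_real (tent M l / sqrt (tent_norm M))"
  let ?v = "\<lambda>(l, x). ?c l * amp_vec u init x"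
  have fin: "finite ?\<Omega>" using finite_G by simp
  have e0: "e 0 \<in> ?\<Omega>" by (rule bij_betw_apply[OF e]) simp
  have dd: "ip ?\<Omega> ?d ?d = 1" "ip ?\<Omega> ?d ?v = ?v (e 0)"
    unfolding ip_def using fin e0 by (simp_all add: if_distrib[of cnj] if_distrib[of "\<lambda>x. x * _"] cong: if_cong)
  have vv: "ip ?\<Omega> ?v ?v = 1"
  proof -
    have "ip ?\<Omega> ?v ?v = (\<Sum>l<M. cnj (?c l) * (?c l * 1))"
      unfolding ip_Times[of _ Y] prod.case ip_scale_left ip_scale_right ip_amp_vec[OF ip_init u] ..
    also have "\<dots> = (\<Sum>l<M. of_real ((tent M l)\<^sup>2 / tent_norm M))"
      using N by (intro sum.cong refl) (simp add: power2_eq_square flip: of_real_mult)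
    also have "\<dots> = of_real ((\<Sum>l<M. (tent M l)\<^sup>2) / tent_norm M)"
      unfolding sum_divide_distrib of_real_sum ..
    finally show ?thesis using N by (simp add: tent_norm_def)
  qed
  \<comment> \<open>The Householder map from the zero state to the initial superposition needs a
    real overlap; all its amplitudes are real.\<close>
  have "?v x \<in> \<real>" for x
    by (auto simp: amp_vec_def tensor_def init_def half_amp_def split: prod.split intro!: Reals_mult Reals_divide)
  then have "ip ?\<Omega> ?d ?v \<in> \<real>" unfolding dd by blast
  then obtain V where V: "uop ?\<Omega> V" "\<And>x. x \<in> ?\<Omega> \<Longrightarrow> V ?d x = ?v x"
    using exists_uop_mapping[OF dd(1) vv _ fin] by blast
  let ?H = "\<lambda>Q l f. (outer_walk u Q ^^ l) (prep_pair Q f)"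
  let ?K = "\<lambda>f (y, x). \<Sum>l<M. mat_adjoint F $$ (y, l) * f (l, x)"
  have K: "uop ?\<Omega> ?K" by (rule uop_fst_factor[OF uop_mat[OF unitary_mat_adjoint[OF F]]])
  have "impl (0 + (4 + M * (8 * J + 12)) + 0) (\<lambda>Q f. ?K (lift_Y (?H Q) (V f)))"
    by (rule implements_comp[OF implements_comp[OF implements_fixed[OF V(1) e] impl_history[OF u]] implements_fixed[OF K e]])
  then obtain L where L: "\<forall>s\<in>set L. valid_step m q s" "length (filter is_query L) \<le> 4 + M * (8 * J + 12)"
    "\<And>Q f. \<forall>b. unitary_mat (2 ^ q b) (Q b) \<Longrightarrow>
       run_steps m q Q L (vec (2 ^ m) (\<lambda>i. f (e i))) = vec (2 ^ m) (\<lambda>i. ?K (lift_Y (?H Q) (V f)) (e i))"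
    unfolding implements_def by auto
  \<comment> \<open>The outcome is decoded by \<open>e\<close> and only its clock component is read,
    so the probabilities are summed over all other registers.\<close>
  let ?alg = "Query_Alg m L (\<lambda>i. res (fst (e i)))"
  have z: "zero_state m = vec (2 ^ m) (\<lambda>i. ?d (e i))"
  proof (rule eq_vecI)
    fix i assume "i < dim_vec (vec (2 ^ m) (\<lambda>i. ?d (e i)))"
    then have "e i = e 0 \<longleftrightarrow> i = 0" "i < 2 ^ m" using e by (auto simp: bij_betw_def inj_on_def)
    then show "zero_state m $ i = vec (2 ^ m) (\<lambda>i. ?d (e i)) $ i" by (simp add: zero_state_def)
  qed (simp add: zero_state_def)
  have "prob_result q Q ?alg S = (\<Sum>y | y < M \<and> res y \<in> S. estimation.outcome_prob n a Q M J u F y)"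
    if "estimation n a Q \<rho> U \<mu> M J m e u" for Q \<rho> U \<mu> S
  proof -
    interpret E: estimation n a Q \<rho> U \<mu> M J m e u by (rule that)
    let ?\<Phi> = "?K (lift_Y (?H Q) (V ?d))"
    have st: "final_state q Q ?alg = vec (2 ^ m) (\<lambda>i. ?\<Phi> (e i))"
      unfolding final_state_def query_alg.sel z using E.Q_unitary by (intro L(3)) simp
    have \<Phi>: "?\<Phi> (y, x) = (\<Sum>l<M. cnj (F $$ (l, y)) * E.history_state l x)" if "y < M" "x \<in> Y" for y x
    proof -
      have "lift_Y (?H Q) (V ?d) (l, x) = E.history_state l x" if l: "l < M" for l
      proof -
        note P = uop_prep_pair[OF E.Q_unitary] and W = uop_funpow[OF E.uop_outer_walk, of l]
        have "prep_pair Q (\<lambda>x. V ?d (l, x)) x = ?c l * amp_vec u (chi Q) x" if "x \<in> Y" for x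
        proof -
          have "prep_pair Q (\<lambda>x. V ?d (l, x)) x = prep_pair Q (\<lambda>x. ?c l * amp_vec u init x) x"
            by (rule uop_cong[OF P _ that]) (use V(2) l in auto)
          then show ?thesis
            by (simp only: uop_scale[OF P that] prep_pair_amp_vec[OF E.Q_unitary that])
        qed
        then have "(outer_walk u Q ^^ l) (prep_pair Q (\<lambda>x. V ?d (l, x))) x
            = (outer_walk u Q ^^ l) (\<lambda>x. ?c l * amp_vec u (chi Q) x) x"
          by (rule uop_cong[OF W _ \<open>x \<in> Y\<close>])
        then show ?thesis
          by (simp only: lift_Y_def prod.case E.history_state_def uop_scale[OF W \<open>x \<in> Y\<close>])
      qed
      then show ?thesis using that F by (auto simp: unitary_mat_def intro!: sum.cong)
    qed
    have "prob_result q Q ?alg S = (\<Sum>i | i < 2 ^ m \<and> res (fst (e i)) \<in> S. (cmod (?\<Phi> (e i)))\<^sup>2)"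
      unfolding prob_result_def st by (intro sum.cong) auto
    also have "\<dots> = (\<Sum>i<2 ^ m. if res (fst (e i)) \<in> S then (cmod (?\<Phi> (e i)))\<^sup>2 else 0)"
      by (subst sum.inter_filter[symmetric]) (auto intro: sum.cong)
    also have "\<dots> = (\<Sum>z\<in>?\<Omega>. if res (fst z) \<in> S then (cmod (?\<Phi> z))\<^sup>2 else 0)"
      by (rule sum.reindex_bij_betw[OF e, of "\<lambda>z. if res (fst z) \<in> S then (cmod (?\<Phi> z))\<^sup>2 else 0"])
    also have "\<dots> = (\<Sum>y<M. \<Sum>x\<in>Y. if res y \<in> S then (cmod (?\<Phi> (y, x)))\<^sup>2 else 0)"
      unfolding sum.cartesian_product by (intro sum.cong) auto
    also have "\<dots> = (\<Sum>y<M. if res y \<in> S then E.outcome_prob F y else 0)"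
    proof (rule sum.cong[OF refl])
      fix y assume y: "y \<in> {..<M}"
      have "(\<Sum>x\<in>Y. (cmod (?\<Phi> (y, x)))\<^sup>2) = E.outcome_prob F y"
        unfolding E.outcome_prob_def
        by (rule sum.cong[OF refl], rule arg_cong[where f = "\<lambda>z. (cmod z)\<^sup>2"], rule \<Phi>) (use y in auto)
      then show "(\<Sum>x\<in>Y. if res y \<in> S then (cmod (?\<Phi> (y, x)))\<^sup>2 else 0) = (if res y \<in> S then E.outcome_prob F y else 0)"
        by (cases "res y \<in> S") (simp_all only: if_True if_False sum.neutral_const)
    qed
    also have "\<dots> = (\<Sum>y | y < M \<and> res y \<in> S. E.outcome_prob F y)"
      by (subst sum.inter_filter[symmetric]) (auto intro: sum.cong)
    finally show ?thesis .
  qed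
  then show ?thesis using L(1,2) by (intro exI[of _ ?alg]) (simp add: valid_alg_def num_queries_def)
qed

end

section \<open>The estimator\<close>

lemma powr_add_le:
  fixes x y p :: real
  assumes "0 \<le> x" "0 \<le> y" "0 < p" "p \<le> 1"
  shows "(x + y) powr p \<le> x powr p + y powr p"
proof (cases "x + y = 0")
  case True
  then show ?thesis using assms by simp
next
  case False
  then have s: "x + y > 0" using assms by simp
  have le: "z \<le> z powr p" if "0 \<le> z" "z \<le> 1" for z :: real
    using powr_mono'[of p 1 z] that assms by simp
  have "1 = x / (x + y) + y / (x + y)" using s by (simp flip: add_divide_distrib)
  also have "\<dots> \<le> (x / (x + y)) powr p + (y / (x + y)) powr p"
    using s assms by (intro add_mono le) auto
  also have "\<dots> = (x powr p + y powr p) / (x + y) powr p"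
    using s assms by (simp add: powr_divide add_divide_distrib)
  finally show ?thesis using s by simp
qed

lemma abs_powr_diff_le:
  fixes x y p :: real
  assumes "0 \<le> x" "0 \<le> y" "0 < p" "p \<le> 1"
  shows "\<bar>x powr p - y powr p\<bar> \<le> \<bar>x - y\<bar> powr p"
proof (cases "x \<le> y")
  case True
  then show ?thesis using powr_add_le[of x "y - x" p] powr_mono2[of p x y] assms by simp
next
  case False
  then show ?thesis using powr_add_le[of y "x - y" p] powr_mono2[of p y x] assms by simp
qed

text \<open>Register sizes have to be powers of two. Rounding up at most doubles the target, and the
  summand 1 covers targets below 1.\<close>

lemma exists_two_power:
  fixes x :: real
  assumes "x \<ge> 0"
  shows "\<exists>k::nat. x \<le> 2 ^ k \<and> 2 ^ k \<le> 1 + 2 * x"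
proof -
  obtain k0 :: nat where k0: "x < 2 ^ k0" using real_arch_pow[of 2 x] by auto
  define k where "k = (LEAST k::nat. x \<le> 2 ^ k)"
  have k: "x \<le> 2 ^ k" unfolding k_def by (rule LeastI[of _ k0]) (use k0 in simp)
  show ?thesis
  proof (cases k)
    case 0
    then show ?thesis using k assms by (intro exI[of _ 0]) auto
  next
    case (Suc k')
    then have "\<not> x \<le> 2 ^ k'" using not_less_Least[of k' "\<lambda>k. x \<le> 2 ^ k"] by (simp add: k_def)
    then show ?thesis using k Suc by (intro exI[of _ k]) auto
  qed
qed

lemma hermitian_reduced_difference:
  assumes "\<And>b. prepares_purification n (a b) (Q b) (\<rho> b)"
  shows "\<rho> Box0 - \<rho> Box1 \<in> carrier_mat (2 ^ n) (2 ^ n)" "mat_adjoint (\<rho> Box0 - \<rho> Box1) = \<rho> Box0 - \<rho> Box1"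
proof -
  have c: "\<rho> b \<in> carrier_mat (2 ^ n) (2 ^ n)" for b
    using assms[of b] by (simp add: prepares_purification_def partial_trace_def)
  show *: "\<rho> Box0 - \<rho> Box1 \<in> carrier_mat (2 ^ n) (2 ^ n)" by (rule minus_carrier_mat[OF c])
  have lt: "i * 2 ^ a b + e < 2 ^ (n + a b)" if "i < 2 ^ n" "e < 2 ^ a b" for i e :: nat and b
    unfolding power_add using that by (rule block_index_less)
  have h: "\<rho> b $$ (i, j) = cnj (\<rho> b $$ (j, i))" if "i < 2 ^ n" "j < 2 ^ n" for b i j
  proof -
    have "dim_row (Q b) = 2 ^ (n + a b)" using assms[of b] by (auto simp: prepares_purification_def unitary_mat_def)
    then show ?thesis
      using assms[of b] that lt
      by (auto simp: prepares_purification_def partial_trace_def ket_bra_def mult.commute intro!: sum.cong)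
  qed
  show "mat_adjoint (\<rho> Box0 - \<rho> Box1) = \<rho> Box0 - \<rho> Box1"
  proof (rule eq_matI)
    fix i j assume "i < dim_row (\<rho> Box0 - \<rho> Box1)" "j < dim_col (\<rho> Box0 - \<rho> Box1)"
    then have "i < 2 ^ n" "j < 2 ^ n" using * by auto
    then show "mat_adjoint (\<rho> Box0 - \<rho> Box1) $$ (i, j) = (\<rho> Box0 - \<rho> Box1) $$ (i, j)"
      using c[of Box0] c[of Box1] h[of i j Box0] h[of i j Box1] by simp
  qed (use c[of Box0] c[of Box1] in auto)
qed

lemma path_mat_spectral:
  obtains F and D :: "nat \<Rightarrow> real" where "unitary_mat M F"
    "path_mat M = diag_conj M F D"
proof -
  have "path_mat M \<in> carrier_mat M M" by (simp add: path_mat_def)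
  moreover have "mat_adjoint (path_mat M) = path_mat M"
    by (rule eq_matI) (auto simp: path_mat_def)
  ultimately show thesis using hermitian_spectral[of "path_mat M" M] that by blast
qed

text \<open>Truncation and measurement each take half of the error budget for the trace. An
  eigenvalue \<open>D\<close> may be negative, and clipping at 0 brings the estimate no further from
  the nonnegative trace.\<close>

lemma (in estimation) estimate_accurate:
  assumes \<alpha>: "\<alpha> > 1" and \<epsilon>: "\<epsilon> > 0"
    and approx: "\<And>t. 0 \<le> t \<Longrightarrow> t \<le> pi \<Longrightarrow>
      expansion_error (\<alpha> - 1) u J t \<le> \<epsilon> powr \<alpha> / 2"
    and D: "l1 u J * \<bar>D - amplitude\<bar> \<le> \<epsilon> powr \<alpha> / 2"
  shows "\<bar>1 / 2 * max 0 (2 powr \<alpha> * l1 u J * D) powr (1 / \<alpha>) - T_dist \<alpha> (\<rho> Box0) (\<rho> Box1)\<bar> \<le> \<epsilon>"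
proof -
  let ?L = "l1 u J"
  define x where "x = (\<Sum>l<2 ^ n. \<bar>\<mu> l\<bar> powr \<alpha>)"
  define z where "z = 2 powr \<alpha> * ?L * D"
  have x0: "x \<ge> 0" unfolding x_def by (rule sum_nonneg) simp
  have T: "T_dist \<alpha> (\<rho> Box0) (\<rho> Box1) = 1 / 2 * x powr (1 / \<alpha>)"
    unfolding x_def by (rule T_dist_spectral[OF U diff])
  have 1: "\<bar>2 powr \<alpha> * ?L * amplitude - x\<bar> \<le> 2 powr \<alpha> * (\<epsilon> powr \<alpha> / 2)"
    using amplitude_approx[of "\<alpha> - 1", OF _ approx] \<alpha> unfolding x_def by simp
  have "\<bar>z - 2 powr \<alpha> * ?L * amplitude\<bar> = 2 powr \<alpha> * (?L * \<bar>D - amplitude\<bar>)"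
    using u_pos by (simp add: z_def abs_mult flip: right_diff_distrib)
  also have "\<dots> \<le> 2 powr \<alpha> * (\<epsilon> powr \<alpha> / 2)" using D by (rule mult_left_mono) simp
  finally have "\<bar>z - x\<bar> \<le> 2 powr \<alpha> * (\<epsilon> powr \<alpha> / 2) + 2 powr \<alpha> * (\<epsilon> powr \<alpha> / 2)" using 1 by linarith
  also have "\<dots> = (2 * \<epsilon>) powr \<alpha>" using \<epsilon> by (simp add: powr_mult)
  \<comment> \<open>The form (2\<epsilon>)^\<alpha> is chosen so that the root gives 2\<epsilon>,
    and the factor 1/2 in the distance leaves \<epsilon>.\<close>
  finally have zx: "\<bar>max 0 z - x\<bar> \<le> (2 * \<epsilon>) powr \<alpha>" using x0 by linarith
  have "\<bar>max 0 z powr (1 / \<alpha>) - x powr (1 / \<alpha>)\<bar> \<le> \<bar>max 0 z - x\<bar> powr (1 / \<alpha>)"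
    using x0 \<alpha> by (intro abs_powr_diff_le) auto
  also have "\<dots> \<le> ((2 * \<epsilon>) powr \<alpha>) powr (1 / \<alpha>)"
    using zx \<alpha> by (intro powr_mono2) auto
  also have "\<dots> = 2 * \<epsilon>" using \<epsilon> \<alpha> by (simp add: powr_powr)
  finally have "\<bar>max 0 z powr (1 / \<alpha>) - x powr (1 / \<alpha>)\<bar> \<le> 2 * \<epsilon>" .
  then show ?thesis unfolding T z_def[symmetric] by (simp flip: right_diff_distrib add: abs_mult)
qed

theorem theorem3p3:
  fixes \<alpha> :: real
  assumes "\<alpha> > 1"
  shows "\<exists>C>0. \<forall>(n::nat) (a :: black_box \<Rightarrow> nat) (\<epsilon>::real). 0 < \<epsilon> \<and> \<epsilon> < 1 \<longrightarrow>
    (\<exists>alg. valid_alg (\<lambda>b. n + a b) alg \<and>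
       real (num_queries alg) \<le> C * (1 / \<epsilon> powr (\<alpha> + 1 + 1 / (\<alpha> - 1))) \<and>
       (\<forall>Q \<rho>. (\<forall>b. prepares_purification n (a b) (Q b) (\<rho> b)) \<longrightarrow>
          prob_result (\<lambda>b. n + a b) Q alg
            {x. \<bar>x - T_dist \<alpha> (\<rho> Box0) (\<rho> Box1)\<bar> \<le> \<epsilon>} \<ge> 2/3))"
proof -
  define \<beta> where "\<beta> = \<alpha> - 1"
  have \<beta>: "\<beta> > 0" using assms by (simp add: \<beta>_def)
  obtain u :: "nat \<Rightarrow> real" and C L where u0: "u 0 \<noteq> 0" and C: "C > 0" and L: "\<And>J. l1 u J \<le> L"
    and approx: "\<And>J t. 0 \<le> t \<Longrightarrow> t \<le> pi \<Longrightarrow>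
      expansion_error \<beta> u J t \<le> C * real (Suc J) powr (- \<beta>)"
    using sgn_powr_cos_expansion[OF \<beta>] by blast
  have L0: "L > 0" using L[of 1] u0 by simp
  \<comment> \<open>The summand 12 L is 2 * (3 / \<eta>) multiplied by \<delta>, for \<eta> =
    \<delta> / (2 L); the 2 is lost in rounding to a power of two.\<close>
  define c1 where "c1 = 1 + 12 * L"
  define c2 where "c2 = 1 + 2 * (2 * C) powr (1 / \<beta>)"
  have c: "c1 > 0" "c2 > 0" using L0 C by (simp_all add: c1_def c2_def add_pos_nonneg)
  have "\<exists>alg. valid_alg (\<lambda>b. n + a b) alg \<and>
       real (num_queries alg) \<le> 84 * c1 * c2 * (1 / \<epsilon> powr (\<alpha> + 1 + 1 / (\<alpha> - 1))) \<and>
       (\<forall>Q \<rho>. (\<forall>b. prepares_purification n (a b) (Q b) (\<rho> b)) \<longrightarrow>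
          prob_result (\<lambda>b. n + a b) Q alg
            {x. \<bar>x - T_dist \<alpha> (\<rho> Box0) (\<rho> Box1)\<bar> \<le> \<epsilon>} \<ge> 2/3)"
    if \<epsilon>: "0 < \<epsilon>" "\<epsilon> < 1" for n and a :: "black_box \<Rightarrow> nat" and \<epsilon> :: real
  proof -
    define \<delta> where "\<delta> = \<epsilon> powr \<alpha>"
    have \<delta>: "0 < \<delta>" "\<delta> \<le> 1" using \<epsilon> assms by (simp_all add: \<delta>_def powr_le1)
    \<comment> \<open>The amplitude is the trace divided by at most \<open>L\<close>, up to
      constants; resolving it to \<eta> costs L \<eta> = \<delta>/2 of the budget.\<close>
    define \<eta> where "\<eta> = \<delta> / (2 * L)"
    have \<eta>: "\<eta> > 0" using \<delta> L0 by (simp add: \<eta>_def)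
    \<comment> \<open>The number of terms for which the truncation bound C K^(-\<beta>) equals
      \<delta>/2.\<close>
    define K where "K = (2 * C / \<delta>) powr (1 / \<beta>)"
    have K: "K > 0" using C \<delta> by (simp add: K_def)
    obtain k :: nat where k: "K \<le> 2 ^ k" "2 ^ k \<le> 1 + 2 * K" using exists_two_power[of K] K by auto
    obtain l :: nat where l: "3 / \<eta> \<le> 2 ^ l" "2 ^ l \<le> 1 + 2 * (3 / \<eta>)" using exists_two_power[of "3 / \<eta>"] \<eta> by auto
    define J :: nat where "J = 2 ^ k"
    define s :: nat where "s = 2 ^ l"
    define M where "M = 4 * s"
    interpret P: purification_setup n a .
    \<comment> \<open>The clock takes l+2 qubits because M = 4 * 2^l, the term index k, and each
      purification register a flag, the system and the common ancillas.\<close>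
    define m where "m = (l + 2) + k + ((1 + n + P.anc) + (1 + n + P.anc))"
    have "card ({..<M} \<times> {..<J} \<times> P.G \<times> P.G) = 2 ^ m"
      by (simp add: card_cartesian_product P.card_G M_def J_def s_def m_def power_add)
    then obtain e where e: "bij_betw e {..<(2::nat) ^ m} ({..<M} \<times> {..<J} \<times> P.G \<times> P.G)"
      using finite_same_card_bij[of "{..<2 ^ m :: nat}" "{..<M} \<times> {..<J} \<times> P.G \<times> P.G"] P.finite_G by auto
    interpret W: workspace n a M J m e by unfold_locales (rule e)
    have s1: "s \<ge> 1" and J1: "J \<ge> 1" by (simp_all add: s_def J_def)
    have LJ: "l1 u J > 0"
      using u0 J1 by (intro sum_pos2[of _ 0]) auto
    have TN: "2 * real s ^ 3 \<le> tent_norm M" unfolding M_def using s1 by (intro tent_norm_ge) simp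
    moreover have "0 < 2 * real s ^ 3" using s1 by simp
    ultimately have TN0: "tent_norm M > 0" by linarith
    obtain F and D :: "nat \<Rightarrow> real" where F: "unitary_mat M F"
      and FD: "path_mat M = diag_conj M F D"
      by (rule path_mat_spectral)
    define res where "res y = 1 / 2 * max 0 (2 powr \<alpha> * l1 u J * D y) powr (1 / \<alpha>)" for y
    obtain alg where alg: "valid_alg (\<lambda>b. n + a b) alg" "num_queries alg \<le> 4 + M * (8 * J + 12)"
      "\<And>Q \<rho> U \<mu> S. estimation n a Q \<rho> U \<mu> M J m e u \<Longrightarrow>
         prob_result (\<lambda>b. n + a b) Q alg S = (\<Sum>y | y < M \<and> res y \<in> S. estimation.outcome_prob n a Q M J u F y)"
      using W.algorithm_exists[OF LJ TN0 F, of res] by blast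
    have "real (num_queries alg) \<le> 84 * c1 * c2 * (1 / \<epsilon> powr (\<alpha> + 1 + 1 / (\<alpha> - 1)))"
    proof -
      have "4 + M * (8 * J + 12) \<le> 84 * (s * J)"
      proof -
        have "1 \<le> s * J" "s \<le> s * J" using s1 J1 by simp_all
        moreover have "4 + M * (8 * J + 12) = 4 + 32 * (s * J) + 48 * s" by (simp add: M_def algebra_simps)
        ultimately show ?thesis by linarith
      qed
      then have "real (num_queries alg) \<le> real (84 * (s * J))" using alg(2) by linarith
      also have "\<dots> = 84 * (real s * real J)" by simp
      also have "\<dots> \<le> 84 * ((c1 / \<delta>) * (c2 / \<delta> powr (1 / \<beta>)))"
      proof (intro mult_left_mono mult_mono)
        have "real s \<le> 1 + 12 * L / \<delta>" using l by (simp add: s_def \<eta>_def)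
        also have "\<dots> \<le> c1 / \<delta>" using \<delta> by (simp add: c1_def field_simps)
        finally show "real s \<le> c1 / \<delta>" .
        have "real J \<le> 1 + 2 * ((2 * C) powr (1 / \<beta>) / \<delta> powr (1 / \<beta>))"
          using k C \<delta> by (simp add: J_def K_def powr_divide)
        also have "\<dots> \<le> c2 / \<delta> powr (1 / \<beta>)"
          using \<delta> \<beta> powr_le1[of "1 / \<beta>" \<delta>] by (simp add: c2_def field_simps)
        finally show "real J \<le> c2 / \<delta> powr (1 / \<beta>)" .
      qed (use c \<delta> in auto)
      also have "\<dots> = 84 * c1 * c2 * (1 / (\<delta> * \<delta> powr (1 / \<beta>)))" by simp
      also have "\<delta> * \<delta> powr (1 / \<beta>) = \<epsilon> powr (\<alpha> + 1 + 1 / (\<alpha> - 1))"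
      proof -
        \<comment> \<open>The clock length contributes \<delta>^(-1) and the expansion
          \<delta>^(-1/\<beta>); in \<epsilon> the exponents \<alpha> and \<alpha>/(\<alpha>-1) add
          up to the claimed one.\<close>
        have "\<alpha> * (1 / \<beta>) = 1 + 1 / (\<alpha> - 1)" using \<beta> by (simp add: \<beta>_def field_simps)
        then show ?thesis unfolding \<delta>_def powr_powr by (simp add: powr_add[symmetric] add.assoc)
      qed
      finally show ?thesis .
    qed
    moreover have "prob_result (\<lambda>b. n + a b) Q alg {x. \<bar>x - T_dist \<alpha> (\<rho> Box0) (\<rho> Box1)\<bar> \<le> \<epsilon>} \<ge> 2/3"
      if prepares: "\<And>b. prepares_purification n (a b) (Q b) (\<rho> b)" for Q \<rho>
    proof -
      \<comment> \<open>The spectral decomposition is chosen after \<open>alg\<close>; it serves the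
        analysis only.\<close>
      obtain U and \<mu> :: "nat \<Rightarrow> real" where U: "unitary_mat (2 ^ n) U"
        "\<rho> Box0 - \<rho> Box1 = diag_conj (2 ^ n) U \<mu>"
        using hermitian_spectral[OF hermitian_reduced_difference[of n a Q \<rho>, OF prepares]] by blast
      interpret E: estimation n a Q \<rho> U \<mu> M J m e u
        by unfold_locales (rule prepares U LJ)+
      let ?S = "{x. \<bar>x - T_dist \<alpha> (\<rho> Box0) (\<rho> Box1)\<bar> \<le> \<epsilon>}"
      have good: "res y \<in> ?S" if "\<bar>D y - E.amplitude\<bar> \<le> \<eta>" for y
      proof -
        have "\<bar>res y - T_dist \<alpha> (\<rho> Box0) (\<rho> Box1)\<bar> \<le> \<epsilon>"
          unfolding res_def
        proof (rule E.estimate_accurate[OF assms \<epsilon>(1)])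
          fix t :: real assume t: "0 \<le> t" "t \<le> pi"
          have "real (Suc J) powr (- \<beta>) \<le> K powr (- \<beta>)"
            using k K \<beta> by (intro powr_mono2') (auto simp: J_def)
          also have "K powr (- \<beta>) = \<delta> / (2 * C)"
            using \<beta> C \<delta> by (simp add: K_def powr_powr powr_minus_divide)
          finally have "C * real (Suc J) powr (- \<beta>) \<le> \<epsilon> powr \<alpha> / 2"
            using C by (simp add: \<delta>_def field_simps)
          then show "expansion_error (\<alpha> - 1) u J t \<le> \<epsilon> powr \<alpha> / 2"
            using approx[OF t, of J] unfolding \<beta>_def by linarith
        next
          have "l1 u J * \<bar>D y - E.amplitude\<bar> \<le> L * \<eta>"
            using L[of J] that LJ by (intro mult_mono) auto
          also have "\<dots> = \<epsilon> powr \<alpha> / 2" using L0 by (simp add: \<eta>_def \<delta>_def)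
          finally show "l1 u J * \<bar>D y - E.amplitude\<bar> \<le> \<epsilon> powr \<alpha> / 2" .
        qed
        then show ?thesis by simp
      qed
      have "real M / (tent_norm M * \<eta>\<^sup>2) \<le> 1 / 3"
      proof -
        \<comment> \<open>With M = 4s and a squared window norm of at least 2 s^3, the failure bound
          is at most 2/(s \<eta>)^2 <= 2/9, below the allowed 1/3.\<close>
        have "3 \<le> real s * \<eta>" using l \<eta> by (simp add: s_def field_simps)
        then have "3\<^sup>2 \<le> (real s * \<eta>)\<^sup>2" by (intro power_mono) auto
        then have "4 * real s * 3 \<le> 2 * real s * (real s * \<eta>)\<^sup>2" using s1 by simp
        also have "\<dots> = 2 * real s ^ 3 * \<eta>\<^sup>2" by (simp add: power2_eq_square power3_eq_cube)
        also have "\<dots> \<le> tent_norm M * \<eta>\<^sup>2" using TN by (rule mult_right_mono) simp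
        finally show ?thesis using TN0 \<eta> by (simp add: M_def field_simps)
      qed
      then have "2 / 3 \<le> (\<Sum>y | y < M \<and> \<bar>D y - E.amplitude\<bar> \<le> \<eta>. E.outcome_prob F y)"
        using E.outcome_concentration[OF F FD TN0 \<eta>] by linarith
      also have "\<dots> \<le> (\<Sum>y | y < M \<and> res y \<in> ?S. E.outcome_prob F y)"
        using good by (intro sum_mono2) (auto intro: E.outcome_prob_nonneg)
      also have "\<dots> = prob_result (\<lambda>b. n + a b) Q alg ?S"
        by (rule alg(3)[symmetric]) (rule E.estimation_axioms)
      finally show ?thesis .
    qed
    ultimately show ?thesis using alg(1) by blast
  qed
  then show ?thesis using c by (intro exI[of _ "84 * c1 * c2"]) auto
qed

end
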